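(* Let $y\in\mathcal I(S_\infty)$ be weakly dominant with $k=\kappa(y)$. If $F_{r(y)}\in\Gamma$, then $$\hat F_y=\hat F_{g_k}F_{r(y)}\qquad\text{and}\qquad \hat F^{\mathrm{FPF}}_y=\hat F^{\mathrm{FPF}}_{g_k}F_{r(y)},$$ where the second identity applies only in the case when $y$ is fixed-point-free (that is, when $y$ is a fixed-point-free involution of $\{1,\dots,2k\}$).
   Context: $S_\infty$ is the group of permutations of $\{1,2,\dots\}$ with finite support; $S_n\subset S_\infty$ consists of the permutations fixing all $i>n$; $s_i=(i,i+1)$. $\mathcal I(S_\infty)=\{w\in S_\infty:w=w^{-1}\}$ and $\kappa(y)$ is the number of 2-cycles of $y$. An involution $y\in\mathcal I(S_\infty)$ is weakly dominant if $y=(1,b_1)(2,b_2)\cdots(k,b_k)$ for some $k\ge0$ and distinct integers $b_1,\dots,b_k$ with $b_i>k$ for all $i$. For such $y\in S_n$, $r(y)\in S_{n-k}$ is the permutation with one-line notation $[b_1-k,\dots,b_k-k,c_1,\dots,c_{n-2k}]$, where $c_1<\dots<c_{n-2k}$ are the elements of $\{1,\dots,n-k\}\setminus\{b_1-k,\dots,b_k-k\}$ (as an element of $S_\infty$ this does not depend on $n$). Let $g_k=(1,k+1)(2,k+2)\cdots(k,2k)\in S_{2k}$. For an involution $y$, set $y\rtimes s_i = ys_i$ if $ys_i=s_iy$ and $y\rtimes s_i=s_iys_i$ otherwise. An involution word for an involution $z$ is a sequence of positive integers $(a_1,\dots,a_k)$ of shortest possible length such that $z=(\cdots((1\rtimes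 s_{a_1})\rtimes s_{a_2})\rtimes\cdots)\rtimes s_{a_k}$. For involutions $y,z$, $\hat{\mathcal R}(y,z)$ is the set of sequences which, when appended to involution words of $y$, produce involution words of $z$ (this does not depend on the chosen involution word of $y$). $\mathcal R(w)$ is the set of reduced words of $w\in S_\infty$, i.e. sequences $(a_1,\dots,a_k)$ of shortest possible length with $w=s_{a_1}\cdots s_{a_k}$. For a sequence $a=(a_1,\dots,a_k)$ of positive integers, $C(a)$ is the set of sequences of positive integers $I=(i_1\le\dots\le i_k)$ with $i_j<i_{j+1}$ whenever $a_j<a_{j+1}$; $x_I=x_{i_1}\cdots x_{i_k}$. The Stanley symmetric function of $w\in S_\infty$ is $F_w=\sum_{a\in\mathcal R(w)}\sum_{I\in C(a)}x_I$. The involution Stanley symmetric functions are $\hat F_{y,z}=\sum_{a\in\hat{\mathcal R}(y,z)}\sum_{I\in C(a)}x_I$, $\hat F_y=\hat F_{1,y}$, and $\hat F^{\mathrm{FPF}}_z=\hat F_{v_m,z}$ for a fixed-point-free involution $z\in S_{2m}$, where $v_m=(1,2)(3,4)\cdots(2m-1,2m)$. $\Lambda$ is the ring of symmetric functions over $\mathbb Z$ in $x_1,x_2,\dots$; $p_n=x_1^n+x_2^n+\cdots$ is the power sum; and $\Gamma=\mathbb Q[p_1,p_3,p_5,\dots]\cap\Lambda$. *)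

theory Defs
  imports Complex_Main "HOL-Library.Multiset" "HOL-Combinatorics.Permutations"
begin

section \<open>Formal power series in countably many variables\<close>

text \<open>
  A monomial in the variables \<open>x\<^sub>i\<close> is the multiset of its indices, so that
  \<open>x\<^sub>I\<close> is \<open>mset I\<close>; a power series is an arbitrary assignment of coefficients to
  monomials. The index type is \<^typ>\<open>nat\<close>, but the variables in use are \<open>x\<^sub>1, x\<^sub>2, \<dots>\<close>:
  the variable \<open>x\<^sub>0\<close> does not occur in any of the series considered below.
\<close>

typedef 'a mfps = "UNIV :: (nat multiset \<Rightarrow> 'a) set"
  morphisms mcoeff Abs_mfps by simp

lemma mcoeff_Abs_mfps [simp]: "mcoeff (Abs_mfps f) = f"
  by (simp add: Abs_mfps_inverse)

lemma mfps_eqI: "(\<And>M. mcoeff f M = mcoeff g M) \<Longrightarrow> f = g"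
  by (metis ext mcoeff_inject)

definition msplits :: "nat multiset \<Rightarrow> (nat multiset \<times> nat multiset) set" where
  "msplits M = {(A, B). A + B = M}"

lemma mem_msplits [simp]: "(A, B) \<in> msplits M \<longleftrightarrow> A + B = M"
  by (simp add: msplits_def)

lemma finite_msplits [simp, intro]: "finite (msplits M)"
proof (rule finite_subset)
  show "msplits M \<subseteq> (\<lambda>A. (A, M - A)) ` {A. A \<subseteq># M}"
    by (auto simp: msplits_def)
  have "finite {A. A \<subseteq># M}"
  proof (induction M)
    case empty
    then show ?case by simp
  next
    case (add x M)
    have "{A. A \<subseteq># add_mset x M} \<subseteq> {A. A \<subseteq># M} \<union> add_mset x ` {A. A \<subseteq># M}"
    proof
      fix A assume "A \<in> {A. A \<subseteq># add_mset x M}"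
      then have A: "A \<subseteq># add_mset x M" by simp
      show "A \<in> {A. A \<subseteq># M} \<union> add_mset x ` {A. A \<subseteq># M}"
      proof (cases "x \<in># A")
        case True
        then obtain A' where "A = add_mset x A'" by (metis insert_DiffM)
        with A show ?thesis by auto
      next
        case False
        with A have "A \<subseteq># M"
          by (metis diff_single_trivial subset_eq_diff_conv add_mset_add_single)
        then show ?thesis by simp
      qed
    qed
    with add.IH show ?case by (auto intro: finite_subset)
  qed
  then show "finite ((\<lambda>A. (A, M - A)) ` {A. A \<subseteq># M})" by simp
qed

instantiation mfps :: (comm_ring_1) comm_ring_1
begin

definition "0 = Abs_mfps (\<lambda>_. 0)"
definition "1 = Abs_mfps (\<lambda>M. if M = {#} then 1 else 0)"
definition "f + g = Abs_mfps (\<lambda>M. mcoeff f M + mcoeff g M)"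
definition "- f = Abs_mfps (\<lambda>M. - mcoeff f M)"
definition "f - g = Abs_mfps (\<lambda>M. mcoeff f M - mcoeff g M)"
definition "f * g = Abs_mfps (\<lambda>M. \<Sum>(A, B)\<in>msplits M. mcoeff f A * mcoeff g B)"

instance
proof
  fix f g h :: "'a mfps"
  show "f + g + h = f + (g + h)" "f + g = g + f" "0 + f = f" "- f + f = 0" "f - g = f + - g"
    by (auto intro!: mfps_eqI simp: plus_mfps_def zero_mfps_def uminus_mfps_def minus_mfps_def)
  show "(0 :: 'a mfps) \<noteq> 1"
  proof
    assume "(0 :: 'a mfps) = 1"
    then have "mcoeff (0 :: 'a mfps) {#} = mcoeff 1 {#}" by simp
    then show False by (simp add: zero_mfps_def one_mfps_def)
  qed
  show "(f + g) * h = f * h + g * h"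
    by (auto intro!: mfps_eqI simp: plus_mfps_def times_mfps_def distrib_right
        sum.distrib[symmetric] case_prod_unfold)
  show "f * g = g * f"
  proof (rule mfps_eqI)
    fix M
    show "mcoeff (f * g) M = mcoeff (g * f) M"
      unfolding times_mfps_def mcoeff_Abs_mfps
      by (rule sum.reindex_bij_witness[where i = prod.swap and j = prod.swap])
        (auto simp: mult.commute add.commute)
  qed
  show "1 * f = f"
  proof (rule mfps_eqI)
    fix M
    have "mcoeff (1 * f) M = (\<Sum>(A, B)\<in>msplits M. (if A = {#} then 1 else 0) * mcoeff f B)"
      by (simp add: times_mfps_def one_mfps_def)
    also have "\<dots> = (\<Sum>(A, B)\<in>{({#} :: nat multiset, M)}. (if A = {#} then 1 else 0) * mcoeff f B)"
      by (rule sum.mono_neutral_right[OF finite_msplits]) (auto split: if_splits)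
    finally show "mcoeff (1 * f) M = mcoeff f M" by simp
  qed
  show "f * g * h = f * (g * h)"
  proof (rule mfps_eqI)
    fix M
    have "mcoeff (f * g * h) M = (\<Sum>p\<in>msplits M. \<Sum>q\<in>msplits (fst p).
        mcoeff f (fst q) * mcoeff g (snd q) * mcoeff h (snd p))"
      by (simp add: times_mfps_def case_prod_unfold sum_distrib_right)
    also have "\<dots> = (\<Sum>(p, q)\<in>(SIGMA p:msplits M. msplits (fst p)).
        mcoeff f (fst q) * mcoeff g (snd q) * mcoeff h (snd p))"
      by (simp add: sum.Sigma)
    also have "\<dots> = (\<Sum>(p, q)\<in>(SIGMA p:msplits M. msplits (snd p)).
        mcoeff f (fst p) * (mcoeff g (fst q) * mcoeff h (snd q)))"
      by (rule sum.reindex_bij_witness[where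
            i = "\<lambda>(p, q). ((fst p + fst q, snd q), (fst p, fst q))" and
            j = "\<lambda>(p, q). ((fst q, snd q + snd p), (snd q, snd p))"])
        (auto simp: mult.assoc add.assoc)
    also have "\<dots> = (\<Sum>p\<in>msplits M. \<Sum>q\<in>msplits (snd p).
        mcoeff f (fst p) * (mcoeff g (fst q) * mcoeff h (snd q)))"
      by (simp add: sum.Sigma)
    also have "\<dots> = mcoeff (f * (g * h)) M"
      by (simp add: times_mfps_def case_prod_unfold sum_distrib_left)
    finally show "mcoeff (f * g * h) M = mcoeff (f * (g * h)) M" .
  qed
qed

end

definition mconst :: "'a::comm_ring_1 \<Rightarrow> 'a mfps" where
  "mconst c = Abs_mfps (\<lambda>M. if M = {#} then c else 0)"

definition map_mfps :: "('a \<Rightarrow> 'b) \<Rightarrow> 'a mfps \<Rightarrow> 'b mfps" where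
  "map_mfps h f = Abs_mfps (\<lambda>M. h (mcoeff f M))"


section \<open>Finitely supported permutations and involutions\<close>

definition S_inf :: "(nat \<Rightarrow> nat) set" where
  "S_inf = {w. w permutes {1..} \<and> finite {i. w i \<noteq> i}}"

definition S_fin :: "nat \<Rightarrow> (nat \<Rightarrow> nat) set" where
  "S_fin n = {w \<in> S_inf. \<forall>i>n. w i = i}"

definition Invol :: "(nat \<Rightarrow> nat) set" where
  "Invol = {w \<in> S_inf. w = inv w}"

definition kappa :: "(nat \<Rightarrow> nat) \<Rightarrow> nat" where
  "kappa y = card {{i, j} | i j. i \<noteq> j \<and> y i = j \<and> y j = i}"

definition simple_transp :: "nat \<Rightarrow> nat \<Rightarrow> nat" where
  "simple_transp i = transpose i (i + 1)"

definition prod_transp :: "(nat \<times> nat) list \<Rightarrow> nat \<Rightarrow> nat" where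
  "prod_transp ps = foldr (\<lambda>(a, b) f. transpose a b \<circ> f) ps id"

definition weakly_dominant :: "(nat \<Rightarrow> nat) \<Rightarrow> bool" where
  "weakly_dominant y \<longleftrightarrow>
    (\<exists>bs. distinct bs \<and> (\<forall>b\<in>set bs. b > length bs) \<and>
          y = prod_transp (zip [1..<length bs + 1] bs))"

definition g_invol :: "nat \<Rightarrow> nat \<Rightarrow> nat" where
  "g_invol k = prod_transp (map (\<lambda>i. (i, k + i)) [1..<k + 1])"

definition v_invol :: "nat \<Rightarrow> nat \<Rightarrow> nat" where
  "v_invol m = prod_transp (map (\<lambda>i. (2 * i - 1, 2 * i)) [1..<m + 1])"

definition fpf_invol :: "nat \<Rightarrow> (nat \<Rightarrow> nat) \<Rightarrow> bool" where
  "fpf_invol m z \<longleftrightarrow> z \<in> Invol \<and> z \<in> S_fin (2 * m) \<and> (\<forall>i\<in>{1..2 * m}. z i \<noteq> i)"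

definition perm_of_word :: "nat list \<Rightarrow> nat \<Rightarrow> nat" where
  "perm_of_word u i = (if 1 \<le> i \<and> i \<le> length u then u ! (i - 1) else i)"

text \<open>
  If \<open>y = (1,b\<^sub>1)\<cdots>(k,b\<^sub>k)\<close> is weakly dominant then \<open>k = kappa y\<close> and \<open>b\<^sub>i = y i\<close> for
  \<open>1 \<le> i \<le> k\<close>, which is how \<open>r(y)\<close> is expressed in terms of \<open>y\<close> here. The argument \<open>n\<close> is
  any number with \<open>y \<in> S_fin n\<close>.
\<close>

definition r_perm :: "nat \<Rightarrow> (nat \<Rightarrow> nat) \<Rightarrow> nat \<Rightarrow> nat" where
  "r_perm n y = (let k = kappa y; bs = map (\<lambda>i. y i - k) [1..<k + 1]
            in perm_of_word (bs @ sorted_list_of_set ({1..n - k} - set bs)))"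


section \<open>Reduced words and involution words\<close>

definition shortest_words :: "(nat list \<Rightarrow> nat \<Rightarrow> nat) \<Rightarrow> (nat \<Rightarrow> nat) \<Rightarrow> nat list set" where
  "shortest_words \<pi> w = {a. (\<forall>i\<in>set a. 1 \<le> i) \<and> \<pi> a = w \<and>
     (\<forall>b. (\<forall>i\<in>set b. 1 \<le> i) \<and> \<pi> b = w \<longrightarrow> length a \<le> length b)}"

definition reduced_words :: "(nat \<Rightarrow> nat) \<Rightarrow> nat list set" where
  "reduced_words = shortest_words (\<lambda>a. foldr (\<lambda>i f. simple_transp i \<circ> f) a id)"

definition rtimes :: "(nat \<Rightarrow> nat) \<Rightarrow> nat \<Rightarrow> nat \<Rightarrow> nat" where
  "rtimes y i = (let t = simple_transp i in
     if y \<circ> t = t \<circ> y then y \<circ> t else t \<circ> y \<circ> t)"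

definition involution_words :: "(nat \<Rightarrow> nat) \<Rightarrow> nat list set" where
  "involution_words = shortest_words (foldl rtimes id)"

definition rel_involution_words :: "(nat \<Rightarrow> nat) \<Rightarrow> (nat \<Rightarrow> nat) \<Rightarrow> nat list set" where
  "rel_involution_words y z = {a. \<forall>b\<in>involution_words y. b @ a \<in> involution_words z}"


section \<open>Stanley symmetric functions\<close>

definition compat :: "nat list \<Rightarrow> nat list set" where
  "compat a = {I. length I = length a \<and> (\<forall>i\<in>set I. 1 \<le> i) \<and> sorted I \<and>
     (\<forall>j. j + 1 < length a \<and> a ! j < a ! (j + 1) \<longrightarrow> I ! j < I ! (j + 1))}"

text \<open>
  The series \<open>\<Sum>a\<in>W. \<Sum>I\<in>compat a. x\<^sub>I\<close>, described by its coefficients. It is used for finite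
  \<open>W\<close> only; there is at most one weakly increasing \<open>I\<close> with a given \<open>mset I\<close>.
\<close>

definition word_series :: "nat list set \<Rightarrow> int mfps" where
  "word_series W = Abs_mfps (\<lambda>M. \<Sum>a\<in>W. int (card {I \<in> compat a. mset I = M}))"

definition F_Stanley :: "(nat \<Rightarrow> nat) \<Rightarrow> int mfps" where
  "F_Stanley w = word_series (reduced_words w)"

definition Fhat_rel :: "(nat \<Rightarrow> nat) \<Rightarrow> (nat \<Rightarrow> nat) \<Rightarrow> int mfps" where
  "Fhat_rel y z = word_series (rel_involution_words y z)"

definition Fhat :: "(nat \<Rightarrow> nat) \<Rightarrow> int mfps" where
  "Fhat y = Fhat_rel id y"

definition Fhat_FPF :: "nat \<Rightarrow> (nat \<Rightarrow> nat) \<Rightarrow> int mfps" where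
  "Fhat_FPF m z = Fhat_rel (v_invol m) z"


section \<open>The rings of symmetric functions involved\<close>

definition Lambda :: "int mfps set" where
  "Lambda = {f. (\<forall>M. mcoeff f M \<noteq> 0 \<longrightarrow> set_mset M \<subseteq> {1..}) \<and>
                (\<exists>d. \<forall>M. mcoeff f M \<noteq> 0 \<longrightarrow> size M \<le> d) \<and>
                (\<forall>\<sigma>\<in>S_inf. \<forall>M. mcoeff f (image_mset \<sigma> M) = mcoeff f M)}"

definition power_sum :: "nat \<Rightarrow> rat mfps" where
  "power_sum n = Abs_mfps (\<lambda>M. if \<exists>i\<ge>1. M = replicate_mset n i then 1 else 0)"

inductive_set Q_odd_power_sums :: "rat mfps set" where
  const: "mconst c \<in> Q_odd_power_sums"
| gen: "odd n \<Longrightarrow> power_sum n \<in> Q_odd_power_sums"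
| add: "f \<in> Q_odd_power_sums \<Longrightarrow> h \<in> Q_odd_power_sums \<Longrightarrow> f + h \<in> Q_odd_power_sums"
| mult: "f \<in> Q_odd_power_sums \<Longrightarrow> h \<in> Q_odd_power_sums \<Longrightarrow> f * h \<in> Q_odd_power_sums"

definition Gamma_ring :: "int mfps set" where
  "Gamma_ring = {f \<in> Lambda. map_mfps rat_of_int f \<in> Q_odd_power_sums}"

end

theory Submission
  imports Defs "HOL-Library.Sublist" "HOL-Computational_Algebra.Polynomial"
begin

text \<open>
  Let \<open>U\<^sub>i\<close> be the nilCoxeter operators on functions of involutions, dual to the right action that
  sends \<open>z\<close> to \<open>rtimes z i\<close> if this increases the length and to \<open>0\<close> otherwise. Put
  \<open>h\<^sub>i(x) = 1 + x U\<^sub>i\<close>, let \<open>A\<^sub>i(x)\<close> be the product of \<open>h\<^sub>j(x)\<close>, \<open>i \<le> j < N\<close>, in decreasing order of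
  \<open>j\<close>, and \<open>B\<^sub>i(x) = A\<^sub>i(-x)\<^sup>-\<^sup>1\<close> the product in increasing order (factors act from left to right). By
  the Yang-Baxter equation the \<open>A\<^sub>i(x)\<close> commute, and the series of the pair \<open>e, z\<close> in variables
  \<open>x\<^sub>1, \<dots>, x\<^sub>m\<close> is the coefficient of \<open>z\<close> in \<open>e A\<^sub>1(x\<^sub>1) \<dots> A\<^sub>1(x\<^sub>m)\<close>.

  Lagrange interpolation at \<open>0\<close> expands \<open>A\<^sub>1(x\<^sub>1) \<dots> A\<^sub>1(x\<^sub>m)\<close> as a combination of products
  \<open>A\<^sub>1(x\<^sub>K) A\<^sub>k\<^sub>+\<^sub>1(x\<^sub>L)\<close> over splittings of the variables into \<open>K\<close> and \<open>L\<close> with \<open>|K| = k\<close>. For a weakly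
  dominant \<open>z\<close> with \<open>k\<close> cycles, the coefficient of \<open>z\<close> in \<open>e A\<^sub>1(x\<^sub>K) A\<^sub>k\<^sub>+\<^sub>1(-x\<^sub>K)\<close> is symmetric, of degree
  at most \<open>k\<close> in each variable (\<open>k - 1\<close> in the fixed-point-free case), and vanishes at \<open>x\<^sub>i = -x\<^sub>j\<close> (and at
  \<open>x\<^sub>i = 0\<close> if \<open>e = 1\<close>): indeed \<open>e A\<^sub>1(x) A\<^sub>1(-x) = e\<close>, and each factor \<open>A\<^sub>1\<close> raises the maximal number of
  arcs crossing a point by at most one. So it is a multiple of the product of all \<open>x\<^sub>i + x\<^sub>j\<close> (and all
  \<open>x\<^sub>i\<close>), and by homogeneity it is zero unless \<open>z = g\<^sub>k\<close>. Hence the coefficient of \<open>y\<close> in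
  \<open>e A\<^sub>1(x\<^sub>K) A\<^sub>k\<^sub>+\<^sub>1(x\<^sub>L)\<close> is \<open>c(x\<^sub>K) F\<^sub>r(x\<^sub>K / x\<^sub>L)\<close>, with a factor \<open>c\<close> that does not depend on \<open>y\<close> and the
  supersymmetric Stanley function of \<open>r = r(y)\<close>. If \<open>F\<^sub>r\<close> is in \<open>\<Gamma>\<close>, then
  \<open>F\<^sub>r(x\<^sub>K / x\<^sub>L) = F\<^sub>r(x\<^sub>1, \<dots>, x\<^sub>m)\<close> comes out of the sum.
\<close>

section \<open>The nilCoxeter action on involutions\<close>

lemma Invol_iff: "z \<in> Invol \<longleftrightarrow> (\<forall>p. z (z p) = p) \<and> z 0 = 0 \<and> finite {i. z i \<noteq> i}"
proof
  assume z: "z \<in> Invol"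
  then have p: "z permutes {1..}" and f: "finite {i. z i \<noteq> i}" and i: "z = inv z"
    by (auto simp: Invol_def S_inf_def)
  have "z (z p) = p" for p
    using i p by (metis permutes_inverses(1))
  moreover have "z 0 = 0" using p by (simp add: permutes_def)
  ultimately show "(\<forall>p. z (z p) = p) \<and> z 0 = 0 \<and> finite {i. z i \<noteq> i}" using f by simp
next
  assume a: "(\<forall>p. z (z p) = p) \<and> z 0 = 0 \<and> finite {i. z i \<noteq> i}"
  then have zz: "\<And>p. z (z p) = p" by simp
  have "z permutes {1..}" unfolding permutes_def
  proof (intro conjI allI impI)
    fix x :: nat assume "x \<notin> {1..}" then show "z x = x" using a by (cases x) auto
  next
    fix y show "\<exists>!x. z x = y" using zz by metis
  qed
  moreover have "inv z = z" using zz by (intro inv_equality) auto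
  ultimately show "z \<in> Invol" using a by (simp add: Invol_def S_inf_def)
qed

lemma Invol_invol: "z \<in> Invol \<Longrightarrow> z (z p) = p"
  by (simp add: Invol_iff)

lemma Invol_eq_iff: "z \<in> Invol \<Longrightarrow> z p = z q \<longleftrightarrow> p = q"
  by (metis Invol_invol)

lemma Invol_pos: "z \<in> Invol \<Longrightarrow> 0 < z p \<longleftrightarrow> 0 < p"
  by (metis Invol_iff neq0_conv)

lemma id_Invol [simp]: "id \<in> Invol"
  by (simp add: Invol_iff)

lemma simple_transp_simps [simp]:
  "simple_transp i i = Suc i" "simple_transp i (Suc i) = i"
  "simple_transp i (simple_transp i p) = p"
  "simple_transp i \<circ> simple_transp i = id"
  by (auto simp: simple_transp_def)

lemma simple_transp_other [simp]:
  "p \<noteq> i \<Longrightarrow> p \<noteq> Suc i \<Longrightarrow> simple_transp i p = p"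
  by (simp add: simple_transp_def)

lemma simple_transp_eq_iff [simp]: "simple_transp i p = simple_transp i q \<longleftrightarrow> p = q"
  by (metis simple_transp_simps(3))

lemma simple_transp_less:
  "p < q \<Longrightarrow> \<not> (p = i \<and> q = Suc i) \<Longrightarrow> simple_transp i p < simple_transp i q"
  by (cases "p = i"; cases "p = Suc i"; cases "q = i"; cases "q = Suc i"; simp)

lemma commute_simple_transp_iff:
  assumes "z \<in> Invol"
  shows "z \<circ> simple_transp i = simple_transp i \<circ> z \<longleftrightarrow> z i \<in> {i, Suc i} \<and> z (Suc i) \<in> {i, Suc i}"
proof
  assume c: "z \<circ> simple_transp i = simple_transp i \<circ> z"
  have "z (Suc i) = simple_transp i (z i)" "z i = simple_transp i (z (Suc i))"
    using fun_cong[OF c, of i] fun_cong[OF c, of "Suc i"] by simp_all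
  moreover have "z i \<noteq> z (Suc i)" using Invol_eq_iff[OF assms] by simp
  ultimately show "z i \<in> {i, Suc i} \<and> z (Suc i) \<in> {i, Suc i}"
    by (metis insert_iff simple_transp_other)
next
  assume "z i \<in> {i, Suc i} \<and> z (Suc i) \<in> {i, Suc i}"
  moreover have "z i \<noteq> z (Suc i)" using Invol_eq_iff[OF assms] by simp
  moreover have "z p \<noteq> i" "z p \<noteq> Suc i" if "p \<noteq> i" "p \<noteq> Suc i" for p
    using that calculation Invol_invol[OF assms] by (metis insertE singletonD)+
  ultimately show "z \<circ> simple_transp i = simple_transp i \<circ> z"
    by (intro ext, rename_tac p) (case_tac "p = i"; case_tac "p = Suc i"; auto)
qed

lemma rtimes_commuting:
  "z \<in> Invol \<Longrightarrow> z i \<in> {i, Suc i} \<Longrightarrow> z (Suc i) \<in> {i, Suc i} \<Longrightarrow> rtimes z i = z \<circ> simple_transp i"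
  by (simp add: rtimes_def Let_def commute_simple_transp_iff)

lemma rtimes_conj:
  "z \<in> Invol \<Longrightarrow> \<not> (z i \<in> {i, Suc i} \<and> z (Suc i) \<in> {i, Suc i}) \<Longrightarrow>
    rtimes z i = simple_transp i \<circ> z \<circ> simple_transp i"
  by (simp only: rtimes_def Let_def commute_simple_transp_iff if_False)

lemma rtimes_desc:
  assumes "z \<in> Invol" "z (Suc i) < z i"
  shows "rtimes z i = (if z i = Suc i then z \<circ> simple_transp i else simple_transp i \<circ> z \<circ> simple_transp i)"
proof (cases "z i = Suc i")
  case True
  then have "z (Suc i) = i" using Invol_invol[OF assms(1)] by metis
  then show ?thesis using True assms by (simp add: rtimes_commuting)
next
  case False
  then show ?thesis using assms by (subst rtimes_conj) auto
qed

lemma rtimes_Invol: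
  assumes "z \<in> Invol" "1 \<le> i"
  shows "rtimes z i \<in> Invol"
proof -
  have fin: "finite {p. (simple_transp i \<circ> z \<circ> simple_transp i) p \<noteq> p}" "finite {p. (z \<circ> simple_transp i) p \<noteq> p}"
  proof -
    have "{p. (simple_transp i \<circ> z \<circ> simple_transp i) p \<noteq> p} \<subseteq> {p. z p \<noteq> p} \<union> {i, Suc i}"
      "{p. (z \<circ> simple_transp i) p \<noteq> p} \<subseteq> {p. z p \<noteq> p} \<union> {i, Suc i}"
      by (force, force)
    then show "finite {p. (simple_transp i \<circ> z \<circ> simple_transp i) p \<noteq> p}" "finite {p. (z \<circ> simple_transp i) p \<noteq> p}"
      using assms(1) by (auto simp: Invol_iff intro: finite_subset)
  qed
  show ?thesis
  proof (cases "z i \<in> {i, Suc i} \<and> z (Suc i) \<in> {i, Suc i}")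
    case True
    then have c: "z \<circ> simple_transp i = simple_transp i \<circ> z" using commute_simple_transp_iff[OF assms(1)] by blast
    have "z (simple_transp i (z (simple_transp i p))) = p" for p
      using fun_cong[OF c, of "z (simple_transp i p)"] Invol_invol[OF assms(1)] by simp
    then show ?thesis using True assms fin
      by (subst rtimes_commuting) (auto simp: Invol_iff)
  next
    case False
    then show ?thesis using assms fin
      by (subst rtimes_conj) (auto simp: Invol_iff)
  qed
qed

text \<open>The case, commuting or conjugating, that applies to \<open>z\<close> applies to the
  result as well, so the second step undoes the first.\<close>

lemma rtimes_rtimes:
  assumes "z \<in> Invol" "1 \<le> i"
  shows "rtimes (rtimes z i) i = z"
proof (cases "z i \<in> {i, Suc i} \<and> z (Suc i) \<in> {i, Suc i}")
  case True
  then have "rtimes z i = z \<circ> simple_transp i" using assms by (simp add: rtimes_commuting)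
  moreover have "rtimes (rtimes z i) i = rtimes z i \<circ> simple_transp i"
    using True calculation rtimes_Invol[OF assms] by (intro rtimes_commuting) auto
  ultimately show ?thesis by (simp add: comp_assoc)
next
  case False
  then have e: "rtimes z i = simple_transp i \<circ> z \<circ> simple_transp i" using assms by (simp add: rtimes_conj)
  have "\<not> (rtimes z i i \<in> {i, Suc i} \<and> rtimes z i (Suc i) \<in> {i, Suc i})"
    using False unfolding e
    by (auto simp: simple_transp_def transpose_def split: if_splits)
  then have "rtimes (rtimes z i) i = simple_transp i \<circ> rtimes z i \<circ> simple_transp i"
    using rtimes_Invol[OF assms] by (intro rtimes_conj)
  then show ?thesis by (simp add: e fun_eq_iff)
qed

lemma rtimes_at:
  assumes "z \<in> Invol" "z (Suc i) < z i"
  shows "rtimes z i i < rtimes z i (Suc i)"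
  using assms by (auto simp: rtimes_desc Invol_invol intro!: simple_transp_less)

lemma rtimes_at':
  assumes "z \<in> Invol" "z i < z (Suc i)"
  shows "rtimes z i (Suc i) < rtimes z i i"
proof (cases "z i \<in> {i, Suc i} \<and> z (Suc i) \<in> {i, Suc i}")
  case True
  then show ?thesis using assms by (simp add: rtimes_commuting)
next
  case False
  then show ?thesis using assms by (subst (1 2) rtimes_conj) (auto intro!: simple_transp_less)
qed

section \<open>The operators \<open>U i\<close> and the nilCoxeter relations\<close>

definition U :: "nat \<Rightarrow> ((nat \<Rightarrow> nat) \<Rightarrow> real) \<Rightarrow> (nat \<Rightarrow> nat) \<Rightarrow> real" where
  "U i f z = (if z \<in> Invol \<and> 1 \<le> i \<and> z (Suc i) < z i then f (rtimes z i) else 0)"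

lemma U_linear: "U i (\<lambda>z. f z + c * g z) = (\<lambda>z. U i f z + c * U i g z)"
  by (auto simp: U_def)

lemma U_U: "U i (U i f) = (\<lambda>_. 0)"
  by (rule ext) (auto simp: U_def dest: rtimes_at)

lemma simple_transp_far:
  assumes "Suc i < j"
  shows "simple_transp i \<circ> simple_transp j = simple_transp j \<circ> simple_transp i"
proof
  fix p show "(simple_transp i \<circ> simple_transp j) p = (simple_transp j \<circ> simple_transp i) p"
    using assms by (cases "p = i"; cases "p = Suc i"; cases "p = j"; cases "p = Suc j"; simp)
qed

lemma simple_transp_braid:
  "simple_transp i \<circ> simple_transp (Suc i) \<circ> simple_transp i
    = simple_transp (Suc i) \<circ> simple_transp i \<circ> simple_transp (Suc i)"
proof
  fix p show "(simple_transp i \<circ> simple_transp (Suc i) \<circ> simple_transp i) p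
    = (simple_transp (Suc i) \<circ> simple_transp i \<circ> simple_transp (Suc i)) p"
    by (cases "p = i"; cases "p = Suc i"; cases "p = Suc (Suc i)"; simp)
qed

lemma U_eq_0: "z \<notin> Invol \<or> \<not> 1 \<le> i \<or> \<not> z (Suc i) < z i \<Longrightarrow> U i f z = 0"
  by (auto simp: U_def)

text \<open>If \<open>z\<close> descends at both \<open>i\<close> and \<open>j\<close>, the two
  lowering steps commute, except when the arcs joining \<open>i\<close> to \<open>j + 1\<close> and
  \<open>i + 1\<close> to \<open>j\<close> are nested: then one step removes both descents and both
  sides are \<open>0\<close>. If one descent is missing, lowering at the other does not create
  it.\<close>

lemma U_far:
  assumes "Suc i < j"
  shows "U i (U j f) = U j (U i f)"
proof
  fix z
  show "U i (U j f) z = U j (U i f) z"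
  proof (cases "z \<in> Invol \<and> 1 \<le> i")
    case False
    then have "U i g z = 0" "i = 0 \<Longrightarrow> U i g w = 0" for g w by (auto simp: U_def)
    then show ?thesis using False by (auto simp: U_def)
  next
    case True
    then have z: "z \<in> Invol" and i: "1 \<le> i" and j: "1 \<le> j" using assms by auto
    note zz = Invol_invol[OF z] and inj = Invol_eq_iff[OF z]
    show ?thesis
    proof (cases "z (Suc i) < z i \<and> z (Suc j) < z j")
      case False
      have A: "U j f (rtimes z i) = 0" if d: "z (Suc i) < z i" "\<not> z (Suc j) < z j"
      proof -
        have "z j < z (Suc j)" using d inj[of j "Suc j"] by linarith
        moreover have "z j \<noteq> i \<or> z (Suc j) \<noteq> Suc i" using d zz by (metis assms less_trans lessI not_less_iff_gr_or_eq)
        ultimately have "rtimes z i j < rtimes z i (Suc j)"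
          using d z assms by (auto simp: rtimes_desc intro!: simple_transp_less)
        then show ?thesis by (simp add: U_eq_0)
      qed
      have B: "U i f (rtimes z j) = 0" if d: "z (Suc j) < z j" "\<not> z (Suc i) < z i"
      proof -
        have "z i < z (Suc i)" using d inj[of i "Suc i"] by linarith
        moreover have "z i \<noteq> j \<or> z (Suc i) \<noteq> Suc j" using d zz by (metis assms less_trans lessI not_less_iff_gr_or_eq)
        ultimately have "rtimes z j i < rtimes z j (Suc i)"
          using d z assms by (auto simp: rtimes_desc intro!: simple_transp_less)
        then show ?thesis by (simp add: U_eq_0)
      qed
      show ?thesis using False A B z i j by (auto simp: U_def[of i "U j f"] U_def[of j "U i f"])
    next
      case D: True
      show ?thesis
      proof (cases "z i = Suc j \<and> z (Suc i) = j")
        case True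
        then have v: "z (Suc j) = i" "z j = Suc i" by (metis zz)+
        have "rtimes z i j < rtimes z i (Suc j)" "rtimes z j i < rtimes z j (Suc i)"
          using z assms True v by (simp_all add: rtimes_desc)
        then show ?thesis using D z i j by (simp add: U_def)
      next
        case no': False
        have no: "\<not> (z (Suc j) = i \<and> z j = Suc i)"
          using no' zz by metis
        have d1: "rtimes z i (Suc j) < rtimes z i j"
          using D z assms no by (auto simp: rtimes_desc intro!: simple_transp_less)
        have d2: "rtimes z j (Suc i) < rtimes z j i"
          using D z assms no' by (auto simp: rtimes_desc intro!: simple_transp_less)
        let ?s = "simple_transp i" and ?t = "simple_transp j"
        have st: "?s (?t p) = ?t (?s p)" for p using simple_transp_far[OF assms] by (simp add: fun_eq_iff)
        \<comment> \<open>Which of the two cases of \<open>rtimes\<close> occurs at \<open>j\<close>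
          is not affected by the step at \<open>i\<close>; \<open>e2\<close> is the
          converse.\<close>
        have e1: "rtimes z i j = Suc j \<longleftrightarrow> z j = Suc j"
        proof -
          have "simple_transp i p = Suc j \<longleftrightarrow> p = Suc j" for p
            using assms by (metis simple_transp_simps(3) simple_transp_other Suc_lessD less_irrefl_nat lessI less_Suc_eq)
          then show ?thesis using D z assms by (simp add: rtimes_desc)
        qed
        have e2: "rtimes z j i = Suc i \<longleftrightarrow> z i = Suc i"
        proof -
          have "simple_transp j p = Suc i \<longleftrightarrow> p = Suc i" for p
            using assms by (metis simple_transp_simps(3) simple_transp_other Suc_lessD less_irrefl_nat lessI less_Suc_eq)
          then show ?thesis using D z assms by (simp add: rtimes_desc)
        qed
        have "rtimes (rtimes z i) j = rtimes (rtimes z j) i"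
          using D z d1 d2 e1 e2 rtimes_Invol[OF z i] rtimes_Invol[OF z j]
          by (subst (1 3) rtimes_desc) (auto simp: fun_eq_iff rtimes_desc st)
        then show ?thesis using D z i j d1 d2 rtimes_Invol[OF z i] rtimes_Invol[OF z j] by (simp add: U_def)
      qed
    qed
  qed
qed

lemma simple_transp_if: "simple_transp i p = (if p = i then Suc i else if p = Suc i then i else p)"
  by auto

lemma simple_transp_mono2:
  "p \<noteq> i \<Longrightarrow> q \<noteq> i \<Longrightarrow> simple_transp (Suc i) (simple_transp i p) < simple_transp (Suc i) (simple_transp i q) \<longleftrightarrow> p < q"
  "p \<noteq> Suc (Suc i) \<Longrightarrow> q \<noteq> Suc (Suc i) \<Longrightarrow>
    simple_transp i (simple_transp (Suc i) p) < simple_transp i (simple_transp (Suc i) q) \<longleftrightarrow> p < q"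
  by (auto simp: simple_transp_if)

lemma U_braid: "U i (U (Suc i) (U i f)) = U (Suc i) (U i (U (Suc i) f))"
proof
  fix z
  show "U i (U (Suc i) (U i f)) z = U (Suc i) (U i (U (Suc i) f)) z"
  proof (cases "z \<in> Invol \<and> 1 \<le> i")
    case False
    then have "U i g z = 0" "i = 0 \<Longrightarrow> U i g w = 0" for g w by (auto simp: U_def)
    then show ?thesis using False by (auto simp: U_def)
  next
    case True
    then have z: "z \<in> Invol" and i: "1 \<le> i" and i': "1 \<le> Suc i" by auto
    note zz = Invol_invol[OF z] and inj = Invol_eq_iff[OF z]
    define a b c where "a = z i" "b = z (Suc i)" "c = z (Suc (Suc i))"
    note abc = this
    have rel: "a = Suc i \<longleftrightarrow> b = i" "a = Suc (Suc i) \<longleftrightarrow> c = i" "b = Suc (Suc i) \<longleftrightarrow> c = Suc i"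
      "a \<noteq> b" "b \<noteq> c" "a \<noteq> c" unfolding abc using inj by (metis zz, metis zz, metis zz, simp_all)
    let ?s = "simple_transp i" and ?t = "simple_transp (Suc i)"
    have sd: "w \<in> Invol \<Longrightarrow> w (Suc j) < w j \<Longrightarrow>
       rtimes w j p = (if w j = Suc j then w (simple_transp j p) else simple_transp j (w (simple_transp j p)))" for w j p
      by (simp add: rtimes_desc)
    define z1 where "z1 = rtimes z i"
    define z2 where "z2 = rtimes z1 (Suc i)"
    define y1 where "y1 = rtimes z (Suc i)"
    define y2 where "y2 = rtimes y1 i"
    have I1: "z1 \<in> Invol" "y1 \<in> Invol" using z i i' by (auto simp: z1_def y1_def intro: rtimes_Invol)
    then have I2: "z2 \<in> Invol" "y2 \<in> Invol" using i i' by (auto simp: z2_def y2_def intro: rtimes_Invol)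
    have L: "U i (U (Suc i) (U i f)) z = (if b < a \<and> z1 (Suc (Suc i)) < z1 (Suc i) \<and> z2 (Suc i) < z2 i
        then f (rtimes z2 i) else 0)"
      using z i i' I1 I2 by (simp add: U_def abc z1_def z2_def)
    have R: "U (Suc i) (U i (U (Suc i) f)) z = (if c < b \<and> y1 (Suc i) < y1 i \<and> y2 (Suc (Suc i)) < y2 (Suc i)
        then f (rtimes y2 (Suc i)) else 0)"
      using z i i' I1 I2 by (simp add: U_def abc y1_def y2_def)
    have v1: "z1 i = (if a = Suc i then i else ?s b)" "z1 (Suc i) = (if a = Suc i then Suc i else ?s a)"
      "z1 (Suc (Suc i)) = ?s c" if "b < a"
      using that z rel by (auto simp: z1_def sd abc)
    have w1: "y1 i = ?t a" "y1 (Suc i) = (if b = Suc (Suc i) then Suc i else ?t c)"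
      "y1 (Suc (Suc i)) = (if b = Suc (Suc i) then Suc (Suc i) else ?t b)" if "c < b"
      using that z rel by (auto simp: y1_def sd abc)
    have v2: "z2 i = ?t (z1 i)" "z2 (Suc i) = (if z1 (Suc i) = Suc (Suc i) then Suc i else ?t (z1 (Suc (Suc i))))"
      "z2 (Suc (Suc i)) = (if z1 (Suc i) = Suc (Suc i) then Suc (Suc i) else ?t (z1 (Suc i)))"
      if "z1 (Suc (Suc i)) < z1 (Suc i)"
      using that I1 Invol_invol[OF I1(1), of i] Invol_invol[OF I1(1), of "Suc i"] Invol_invol[OF I1(1), of "Suc (Suc i)"]
        simple_transp_other[of "z1 i" "Suc i"] Invol_eq_iff[OF I1(1), of i "Suc i"] Invol_eq_iff[OF I1(1), of i "Suc (Suc i)"]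
      by (auto simp: z2_def sd)
    have w2: "y2 i = (if y1 i = Suc i then i else ?s (y1 (Suc i)))" "y2 (Suc i) = (if y1 i = Suc i then Suc i else ?s (y1 i))"
      "y2 (Suc (Suc i)) = ?s (y1 (Suc (Suc i)))"
      if "y1 (Suc i) < y1 i"
      using that I1 Invol_invol[OF I1(2), of i] Invol_invol[OF I1(2), of "Suc i"] Invol_invol[OF I1(2), of "Suc (Suc i)"]
        simple_transp_other[of "y1 (Suc (Suc i))" i] Invol_eq_iff[OF I1(2), of "Suc (Suc i)" i] Invol_eq_iff[OF I1(2), of "Suc (Suc i)" "Suc i"]
      by (auto simp: y2_def sd)
    \<comment> \<open>Three lowering steps are possible exactly when the three values decrease and
      \<open>z\<close> does not exchange \<open>i\<close> and \<open>i + 2\<close>; with that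
      exchange only two steps lead down. \<open>C2\<close> finds the same condition for the other
      side.\<close>
    have C1: "b < a \<and> z1 (Suc (Suc i)) < z1 (Suc i) \<and> z2 (Suc i) < z2 i \<longleftrightarrow> b < a \<and> c < b \<and> a \<noteq> Suc (Suc i)"
    proof (cases "b < a")
      case ba: True
      note v1 = v1[OF ba]
      show ?thesis
      proof (cases "a = Suc i")
        case True
        then have "?s c = c" "b = i" "c \<noteq> i" "c \<noteq> Suc i" using rel by auto
        then show ?thesis using True v1 v2 ba by (cases "c < i") auto
      next
        case ai: False
        then have v: "z1 i = ?s b" "z1 (Suc i) = ?s a" using v1 by simp_all
        have bi: "b \<noteq> i" using ai rel by simp
        show ?thesis
        proof (cases "a = Suc (Suc i)")
          case True
          then have "\<not> z2 (Suc i) < z2 i" if "z1 (Suc (Suc i)) < z1 (Suc i)"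
            using v2(1,2)[OF that] v bi ba rel by (cases "b = Suc i") auto
          then show ?thesis using True by blast
        next
          case False
          then have c: "c \<noteq> i" using rel by simp
          have "?s a = Suc (Suc i) \<longleftrightarrow> False" using False by (auto simp: simple_transp_if)
          then have "z2 (Suc i) < z2 i \<longleftrightarrow> c < b" if "z1 (Suc (Suc i)) < z1 (Suc i)"
            using v2(1,2)[OF that] v v1(3) simple_transp_mono2(1)[OF c bi] by simp
          moreover have "z1 (Suc (Suc i)) < z1 (Suc i)" if "c < b"
            using v v1(3) that ba c by (auto intro!: simple_transp_less)
          ultimately show ?thesis using ba False by blast
        qed
      qed
    qed simp
    have C2: "c < b \<and> y1 (Suc i) < y1 i \<and> y2 (Suc (Suc i)) < y2 (Suc i) \<longleftrightarrow> b < a \<and> c < b \<and> a \<noteq> Suc (Suc i)"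
    proof (cases "c < b")
      case cb: True
      note w1 = w1[OF cb]
      show ?thesis
      proof (cases "b = Suc (Suc i)")
        case True
        then have "?t a = a" "c = Suc i" "a \<noteq> Suc i" "a \<noteq> Suc (Suc i)" using rel by auto
        then show ?thesis using True w1 w2 cb by (cases "Suc i < a") auto
      next
        case bi: False
        then have v: "y1 (Suc i) = ?t c" "y1 (Suc (Suc i)) = ?t b" using w1 by simp_all
        show ?thesis
        proof (cases "a = Suc (Suc i)")
          case True
          then have "\<not> y2 (Suc (Suc i)) < y2 (Suc i)" if "y1 (Suc i) < y1 i"
            using w2(2,3)[OF that] v w1(1) bi cb rel by (cases "b = Suc i") auto
          then show ?thesis using True by blast
        next
          case False
          have "?t a = Suc i \<longleftrightarrow> False" using False by (auto simp: simple_transp_if)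
          then have "y2 (Suc (Suc i)) < y2 (Suc i) \<longleftrightarrow> b < a" if "y1 (Suc i) < y1 i"
            using w2(2,3)[OF that] v w1(1) simple_transp_mono2(2)[OF bi False] by simp
          moreover have "y1 (Suc i) < y1 i" if "b < a"
            using v w1(1) that cb False by (auto intro!: simple_transp_less)
          ultimately show ?thesis using cb False by blast
        qed
      qed
    qed simp
    show ?thesis
    proof (cases "b < a \<and> c < b \<and> a \<noteq> Suc (Suc i)")
      case False
      then show ?thesis unfolding L R C1 C2 by (simp only: if_False)
    next
      case True
      have br: "?s (?t (?s p)) = ?t (?s (?t p))" for p
        using simple_transp_braid[of i] by (simp add: fun_eq_iff)
      have z3: "rtimes z2 i p = (if z2 i = Suc i then z2 (?s p) else ?s (z2 (?s p)))" for p
        using True C1 I2 by (simp add: sd)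
      have y3: "rtimes y2 (Suc i) p = (if y2 (Suc i) = Suc (Suc i) then y2 (?t p) else ?t (y2 (?t p)))" for p
        using True C2 I2 by (simp add: sd)
      have z2p: "z2 p = (if z1 (Suc i) = Suc (Suc i) then z1 (?t p) else ?t (z1 (?t p)))" for p
        using True C1 I1 by (simp add: z2_def sd)
      have y2p: "y2 p = (if y1 i = Suc i then y1 (?s p) else ?s (y1 (?s p)))" for p
        using True C2 I1 by (simp add: y2_def sd)
      have z1p: "z1 p = (if a = Suc i then z (?s p) else ?s (z (?s p)))" for p
        using True z by (simp add: z1_def sd abc)
      have y1p: "y1 p = (if b = Suc (Suc i) then z (?t p) else ?t (z (?t p)))" for p
        using True z by (simp add: y1_def sd abc)
      have e1: "z1 (Suc i) = Suc (Suc i) \<longleftrightarrow> False"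
        using True v1(2) by (auto simp: simple_transp_if split: if_splits)
      have e2: "z2 i = Suc i \<longleftrightarrow> b = Suc (Suc i)"
      proof -
        have "z2 i = ?t (z1 i)" "z1 i = (if a = Suc i then i else ?s b)" using v2(1) v1(1) True C1 by blast+
        then show ?thesis using rel(1) True by (cases "a = Suc i") (auto simp: simple_transp_if)
      qed
      have f1: "y1 i = Suc i \<longleftrightarrow> False"
        using True w1(1) by (auto simp: simple_transp_if split: if_splits)
      have f2: "y2 (Suc i) = Suc (Suc i) \<longleftrightarrow> a = Suc i"
      proof -
        have "y2 (Suc i) = ?s (y1 i)" "y1 i = ?t a" using w2(2) w1(1) True C2 f1 by simp_all
        then show ?thesis using True by (auto simp: simple_transp_if)
      qed
      have z2q: "z2 p = ?t (z1 (?t p))" for p using z2p e1 by simp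
      have y2q: "y2 p = ?s (y1 (?s p))" for p using y2p f1 by simp
      have "rtimes z2 i p = rtimes y2 (Suc i) p" for p
      proof -
        \<comment> \<open>If an arc joins two neighbours, exactly one of the three steps multiplies
          instead of conjugating: the first step on one side, the last on the other. In every case
          the braid relation on points identifies the results.\<close>
        consider "a = Suc i" "b \<noteq> Suc (Suc i)" | "a \<noteq> Suc i" "b = Suc (Suc i)" | "a \<noteq> Suc i" "b \<noteq> Suc (Suc i)"
          using rel(1) by fastforce
        then show ?thesis
        proof cases
          case 1
          then have "rtimes z2 i p = ?s (z2 (?s p))" "rtimes y2 (Suc i) p = y2 (?t p)" by (simp_all add: z3 e2 y3 f2)
          then show ?thesis using 1 by (simp only: z2q y2q z1p y1p br if_True if_False simp_thms)
        next
          case 2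
          then have "rtimes z2 i p = z2 (?s p)" "rtimes y2 (Suc i) p = ?t (y2 (?t p))" by (simp_all add: z3 e2 y3 f2)
          then show ?thesis using 2 by (simp only: z2q y2q z1p y1p br if_True if_False simp_thms)
        next
          case 3
          then have "rtimes z2 i p = ?s (z2 (?s p))" "rtimes y2 (Suc i) p = ?t (y2 (?t p))" by (simp_all add: z3 e2 y3 f2)
          then show ?thesis using 3 by (simp only: z2q y2q z1p y1p br if_True if_False simp_thms)
        qed
      qed
      then have "rtimes z2 i = rtimes y2 (Suc i)" by blast
      then show ?thesis unfolding L R C1 C2 by simp
    qed
  qed
qed

section \<open>The Yang-Baxter equation and commuting products\<close>

definition h :: "nat \<Rightarrow> real \<Rightarrow> ((nat \<Rightarrow> nat) \<Rightarrow> real) \<Rightarrow> (nat \<Rightarrow> nat) \<Rightarrow> real" where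
  "h i x f = (\<lambda>z. f z + x * U i f z)"

definition hs :: "nat list \<Rightarrow> real \<Rightarrow> ((nat \<Rightarrow> nat) \<Rightarrow> real) \<Rightarrow> (nat \<Rightarrow> nat) \<Rightarrow> real" where
  "hs ls x = fold (\<lambda>i. h i x) ls"

text \<open>\<open>N\<close> truncates the product over all letters. This loses nothing at
  involutions that fix every point above \<open>N\<close>, since their descents lie below
  \<open>N\<close>. Because of \<open>rev\<close> the largest letter acts first.\<close>

abbreviation A :: "nat \<Rightarrow> nat \<Rightarrow> real \<Rightarrow> ((nat \<Rightarrow> nat) \<Rightarrow> real) \<Rightarrow> (nat \<Rightarrow> nat) \<Rightarrow> real" where
  "A i N \<equiv> hs (rev [i..<N])"

abbreviation B :: "nat \<Rightarrow> nat \<Rightarrow> real \<Rightarrow> ((nat \<Rightarrow> nat) \<Rightarrow> real) \<Rightarrow> (nat \<Rightarrow> nat) \<Rightarrow> real" where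
  "B i N \<equiv> hs [i..<N]"

lemma hs_simps [simp]: "hs [] x f = f" "hs (i # ls) x f = hs ls x (h i x f)"
  "hs (ls @ ls') x f = hs ls' x (hs ls x f)"
  by (simp_all add: hs_def)

lemma U_0 [simp]: "U i (\<lambda>z. 0) = (\<lambda>z. 0)"
  by (rule ext) (simp add: U_def)

lemma U_h: "U j (h i x f) = (\<lambda>z. U j f z + x * U j (U i f) z)"
  unfolding h_def U_linear ..

lemma h_h_expand: "h i x (h j y f) z = f z + x * U i f z + y * U j f z + x * y * U i (U j f) z"
  unfolding h_def[of i x] U_h by (simp add: h_def algebra_simps)

text \<open>\<open>U i\<close> squares to zero, so \<open>h i\<close> is a one-parameter
  group.\<close>

lemma h_h: "h i x (h i y f) = h i (x + y) f"
  by (rule ext) (simp add: h_h_expand U_U, simp add: h_def algebra_simps)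

lemma h_0 [simp]: "h i 0 f = f"
  by (simp add: h_def)

lemma h_inverse [simp]: "h i x (h i (- x) f) = f" "h i (- x) (h i x f) = f"
  by (simp_all add: h_h)

lemma h_commute:
  assumes "Suc i < j \<or> Suc j < i"
  shows "h i x (h j y f) = h j y (h i x f)"
proof -
  have "U i (U j f) = U j (U i f)" using assms U_far by metis
  then show ?thesis
    by (intro ext) (simp add: h_h_expand mult_ac)
qed

text \<open>After expansion the squares of \<open>U\<close> vanish. The linear terms agree because
  the middle parameter is the sum of the outer ones, the quadratic terms agree literally, and the
  cubic terms agree by \<open>U_braid\<close>.\<close>

lemma yang_baxter:
  "h (Suc i) v (h i (u + v) (h (Suc i) u f)) = h i u (h (Suc i) (u + v) (h i v f))"
proof
  fix z
  have e: "h j a (h k b (h j c f)) z = f z + (a + c) * U j f z + b * U k f z + a * b * U j (U k f) z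
      + b * c * U k (U j f) z + a * b * c * U j (U k (U j f)) z" for j k a b c
    unfolding h_def[of j a] h_def[of k b] U_h U_linear by (simp add: h_def U_h U_linear U_U algebra_simps)
  show "h (Suc i) v (h i (u + v) (h (Suc i) u f)) z = h i u (h (Suc i) (u + v) (h i v f)) z"
    unfolding e U_braid[of i f] by (simp add: algebra_simps)
qed

lemma hs_inverse [simp]: "hs (rev ls) (- x) (hs ls x f) = f"
  by (induction ls arbitrary: f) simp_all

lemma hs_inverse' [simp]: "hs ls (- x) (hs (rev ls) x f) = f" "hs ls x (hs (rev ls) (- x) f) = f"
  "hs (rev ls) x (hs ls (- x) f) = f"
  using hs_inverse[of "rev ls" x f] hs_inverse[of "rev ls" "- x" f] hs_inverse[of ls "- x" f] by simp_all

lemma hs_0 [simp]: "hs ls 0 f = f"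
  by (induction ls arbitrary: f) simp_all

lemma A_rec: "i < N \<Longrightarrow> A i N x f = h i x (A (Suc i) N x f)"
  by (simp add: upt_conv_Cons)

lemma A_triv [simp]: "N \<le> i \<Longrightarrow> A i N x f = f" "N \<le> i \<Longrightarrow> B i N x f = f"
  by simp_all

lemma B_rec: "i < N \<Longrightarrow> B i N x f = B (Suc i) N x (h i x f)"
  by (simp add: upt_conv_Cons)

lemma h_hs_commute:
  "(\<And>j. j \<in> set ls \<Longrightarrow> Suc i < j \<or> Suc j < i) \<Longrightarrow> h i x (hs ls y f) = hs ls y (h i x f)"
  by (induction ls arbitrary: f) (simp_all add: h_commute)

text \<open>Induction on the number of letters. By \<open>key\<close> the product equals a factor in
  the letters \<open>i\<close> and \<open>i + 1\<close>, applied to the product for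
  \<open>i + 1\<close>. That factor is symmetric in \<open>x\<close> and \<open>y\<close> by the
  Yang-Baxter equation, and the rest is symmetric by induction.\<close>

lemma A_commute: "A i N x (A i N y f) = A i N y (A i N x f)"
proof (induction "N - i" arbitrary: i f x y)
  case 0
  then show ?case by simp
next
  case (Suc d)
  then have iN: "i < N" and d: "d = N - Suc i" by simp_all
  show ?case
  proof (cases "Suc i < N")
    case False
    then have "N = Suc i" using iN by simp
    then show ?thesis by (simp add: h_h add.commute)
  next
    case True
    \<comment> \<open>\<open>h i y\<close> slides past the factors of \<open>A (Suc i) N x\<close>
      with letters above \<open>i + 1\<close>. To write these again as all of
      \<open>A (Suc i) N x\<close>, the inverse factor \<open>h (Suc i) (- x)\<close> is
      inserted.\<close>
    have key: "A i N x (A i N y f) = h i x (h (Suc i) x (h i y (h (Suc i) (- x) (A (Suc i) N x (A (Suc i) N y f)))))" for x y f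
    proof -
      have c: "h (Suc i) (- x) (A (Suc i) N x g) = A (Suc (Suc i)) N x g" for g
        using True by (simp add: A_rec)
      then have "h (Suc i) x (h i y (h (Suc i) (- x) (A (Suc i) N x g))) = A (Suc i) N x (h i y g)" for g
      proof -
        have "h i y (A (Suc (Suc i)) N x g) = A (Suc (Suc i)) N x (h i y g)"
          by (rule h_hs_commute) auto
        then show ?thesis using c A_rec[OF True] by metis
      qed
      then show ?thesis using iN by (simp add: A_rec)
    qed
    have sw: "h i x (h (Suc i) x (h i y (h (Suc i) (- x) F))) = h i y (h (Suc i) y (h i x (h (Suc i) (- y) F)))" for F
    proof -
      have yb: "h (Suc i) x (h i y (h (Suc i) (y - x) G)) = h i (y - x) (h (Suc i) y (h i x G))" for G
        using yang_baxter[of i x "y - x" G] by simp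
      have F: "h (Suc i) (- x) F = h (Suc i) (y - x) (h (Suc i) (- y) F)"
        by (simp add: h_h)
      show ?thesis unfolding F yb by (simp add: h_h)
    qed
    have "A (Suc i) N x (A (Suc i) N y f) = A (Suc i) N y (A (Suc i) N x f)"
      using Suc.hyps(1)[OF d] .
    then show ?thesis using key[of x y f] key[of y x f] sw by simp
  qed
qed

lemma A_B_commute: "A i N x (B i N y f) = B i N y (A i N x f)"
proof -
  have "A i N x (B i N y f) = B i N y (A i N (- y) (A i N x (B i N y f)))" by simp
  also have "A i N (- y) (A i N x (B i N y f)) = A i N x f"
    by (subst A_commute) simp
  finally show ?thesis .
qed

lemma B_commute: "B i N x (B i N y f) = B i N y (B i N x f)"
proof -
  have "B i N x (B i N y f) = B i N y (A i N (- y) (B i N x (B i N y f)))" by simp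
  also have "A i N (- y) (B i N x (B i N y f)) = B i N x f"
    by (subst A_B_commute) simp
  finally show ?thesis .
qed

lemma fold_commute1:
  "(\<And>x f. T (g x f) = g x (T f)) \<Longrightarrow> T (fold g xs f) = fold g xs (T f)"
  by (induction xs arbitrary: f) simp_all

lemma fold_A_mset: "mset xs = mset ys \<Longrightarrow> fold (A i N) xs f = fold (A i N) ys f"
  by (rule fun_cong[OF fold_multiset_equiv]) (simp_all add: fun_eq_iff A_commute)

lemma fold_B_mset: "mset xs = mset ys \<Longrightarrow> fold (B i N) xs f = fold (B i N) ys f"
  by (rule fun_cong[OF fold_multiset_equiv]) (simp_all add: fun_eq_iff B_commute)

lemma fold_A_B_commute: "fold (A i N) xs (fold (B i N) ys f) = fold (B i N) ys (fold (A i N) xs f)"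
proof -
  have "A i N x (fold (B i N) ys f) = fold (B i N) ys (A i N x f)" for x f
    by (rule fold_commute1) (simp add: A_B_commute)
  then show ?thesis
    by (intro fold_commute1[symmetric, where T = "fold (B i N) ys"]) simp
qed

section \<open>Linear operators and polynomial dependence on a parameter\<close>

definition linear_op :: "(((nat \<Rightarrow> nat) \<Rightarrow> real) \<Rightarrow> (nat \<Rightarrow> nat) \<Rightarrow> real) \<Rightarrow> bool" where
  "linear_op T \<longleftrightarrow> (\<forall>f g c. T (\<lambda>z. f z + c * g z) = (\<lambda>z. T f z + c * T g z))"

lemma lin_h: "linear_op (h i x)"
  by (auto simp: linear_op_def h_def U_linear algebra_simps)

lemma lin_fold: "(\<And>x. linear_op (g x)) \<Longrightarrow> linear_op (fold g xs)"
  by (induction xs) (auto simp: linear_op_def)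

lemma lin_hs: "linear_op (hs ls x)"
  unfolding hs_def by (intro lin_fold lin_h)

lemma linD: "linear_op T \<Longrightarrow> T (\<lambda>z. f z + c * g z) = (\<lambda>z. T f z + c * T g z)"
  by (simp add: linear_op_def)

lemma lin_0: "linear_op T \<Longrightarrow> T (\<lambda>z. 0) = (\<lambda>z. 0)"
  using linD[of T "\<lambda>z. 0" "- 1" "\<lambda>z. 0"] by simp

lemma lin_scale: "linear_op T \<Longrightarrow> T (\<lambda>z. c * g z) = (\<lambda>z. c * T g z)"
  using linD[of T "\<lambda>z. 0" c g] by (simp add: lin_0)

lemma lin_sum_list:
  assumes "linear_op T"
  shows "T (\<lambda>z. \<Sum>t\<leftarrow>ts. c t * g t z) = (\<lambda>z. \<Sum>t\<leftarrow>ts. c t * T (g t) z)"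
proof (induction ts)
  case Nil
  then show ?case by (simp add: lin_0[OF assms])
next
  case (Cons t ts)
  have "T (\<lambda>z. \<Sum>t\<leftarrow>t # ts. c t * g t z) = T (\<lambda>z. (\<Sum>t\<leftarrow>ts. c t * g t z) + c t * g t z)"
    by (simp add: add.commute)
  also have "\<dots> = (\<lambda>z. T (\<lambda>z. \<Sum>t\<leftarrow>ts. c t * g t z) z + c t * T (g t) z)"
    by (rule linD[OF assms])
  finally show ?case using Cons by (simp add: add.commute)
qed

definition poly_family :: "nat \<Rightarrow> (real \<Rightarrow> (nat \<Rightarrow> nat) \<Rightarrow> real) \<Rightarrow> bool" where
  "poly_family d F \<longleftrightarrow> (\<forall>z. \<exists>p. degree p \<le> d \<and> (\<forall>t. F t z = poly p t))"

lemma polyn_U: "poly_family d F \<Longrightarrow> poly_family d (\<lambda>t. U i (F t))"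
  unfolding poly_family_def
proof (intro allI)
  fix z
  assume F: "\<forall>z. \<exists>p. degree p \<le> d \<and> (\<forall>t. F t z = poly p t)"
  show "\<exists>p. degree p \<le> d \<and> (\<forall>t. U i (F t) z = poly p t)"
  proof (cases "z \<in> Invol \<and> 1 \<le> i \<and> z (Suc i) < z i")
    case True
    then show ?thesis using F by (simp add: U_def)
  next
    case False
    then show ?thesis by (intro exI[of _ 0]) (auto simp: U_def)
  qed
qed

lemma polyn_add_mult: "poly_family d F \<Longrightarrow> poly_family d G \<Longrightarrow> poly_family d (\<lambda>t z. F t z + x * G t z)"
  unfolding poly_family_def
proof (intro allI)
  fix z
  assume F: "\<forall>z. \<exists>p. degree p \<le> d \<and> (\<forall>t. F t z = poly p t)" and G: "\<forall>z. \<exists>p. degree p \<le> d \<and> (\<forall>t. G t z = poly p t)"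
  obtain p q where "degree p \<le> d" "\<And>t. F t z = poly p t" "degree q \<le> d" "\<And>t. G t z = poly q t"
    using F G by metis
  then show "\<exists>p. degree p \<le> d \<and> (\<forall>t. F t z + x * G t z = poly p t)"
    by (intro exI[of _ "p + smult x q"]) (auto intro!: degree_add_le order.trans[OF degree_smult_le])
qed

lemma polyn_h: "poly_family d F \<Longrightarrow> poly_family d (\<lambda>t. h i x (F t))"
  unfolding h_def by (intro polyn_add_mult polyn_U)

lemma polyn_hs: "poly_family d F \<Longrightarrow> poly_family d (\<lambda>t. hs ls x (F t))"
  by (induction ls arbitrary: F) (simp_all add: polyn_h)

lemma polyn_fold: "(\<And>x F. poly_family d F \<Longrightarrow> poly_family d (\<lambda>t. g x (F t))) \<Longrightarrow> poly_family d F \<Longrightarrow> poly_family d (\<lambda>t. fold g xs (F t))"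
  by (induction xs arbitrary: F) simp_all

lemma polyn_mono: "poly_family d F \<Longrightarrow> d \<le> d' \<Longrightarrow> poly_family d' F"
  unfolding poly_family_def by (meson order.trans)

lemma polyn_const: "poly_family d (\<lambda>t. f)"
  unfolding poly_family_def by (auto intro!: exI[of _ "[:_:]"])

lemma polyn_times_var:
  assumes "poly_family d F"
  shows "poly_family (Suc d) (\<lambda>t z. t * F t z)"
  unfolding poly_family_def
proof (intro allI)
  fix z
  obtain p where "degree p \<le> d" "\<And>t. F t z = poly p t" using assms unfolding poly_family_def by metis
  then show "\<exists>p. degree p \<le> Suc d \<and> (\<forall>t. t * F t z = poly p t)"
    by (intro exI[of _ "pCons 0 p"]) (auto simp: degree_pCons_eq_if)
qed

lemma polyn_h_var: "poly_family d F \<Longrightarrow> poly_family (Suc d) (\<lambda>t. h i t (F t))"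
proof -
  assume F: "poly_family d F"
  have "poly_family (Suc d) (\<lambda>t z. F t z + 1 * (t * U i (F t) z))"
    by (intro polyn_add_mult polyn_times_var polyn_U F polyn_mono[OF F]) simp
  then show ?thesis by (simp add: h_def)
qed

lemma polyn_hs_var: "poly_family d F \<Longrightarrow> poly_family (d + length ls) (\<lambda>t. hs ls t (F t))"
proof (induction ls arbitrary: F d)
  case (Cons i ls)
  then show ?case using Cons.IH[OF polyn_h_var[OF Cons.prems]] by simp
qed simp

text \<open>Lagrange interpolation at \<open>0\<close>; the variable \<open>core_vector\<close> is
  here just the finite set of nodes. A node \<open>t\<close> is added by writing
  \<open>p(l) = p(t) + (l - t) q(l)\<close>, where the quotient \<open>q\<close> has smaller degree
  and the weights for the old nodes apply to it.\<close>

lemma polyn_zero_weights: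
  fixes core_vector :: "real set"
  assumes "finite core_vector"
  shows "\<exists>w. \<forall>p :: real poly. degree p < card core_vector \<longrightarrow> (\<Sum>l\<in>core_vector. w l * poly p l) = poly p 0"
  using assms
proof (induction core_vector rule: finite_induct)
  case (insert t core_vector)
  from insert.IH obtain w where w: "\<forall>p :: real poly. degree p < card core_vector \<longrightarrow> (\<Sum>l\<in>core_vector. w l * poly p l) = poly p 0"
    by (rule exE)
  \<comment> \<open>The new weights satisfy \<open>w' l * (l - t) = - t * w l\<close>, which turns
    the contribution of \<open>q\<close> into \<open>- t * poly q 0\<close>. The weight at
    \<open>t\<close> makes all weights add up to 1, as constant polynomials require.\<close>
  define s where "s = (\<Sum>l\<in>core_vector. w l * (t / (t - l)))"
  define w' where "w' l = (if l = t then 1 - s else w l * (t / (t - l)))" for l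
  show ?case
  proof (intro exI[of _ w'] allI impI)
    fix p :: "real poly" assume d: "degree p < card (insert t core_vector)"
    define q where "q = synthetic_div p t"
    have pq: "poly p l = poly p t + (l - t) * poly q l" for l
    proof -
      have "poly p l = poly ([:- t, 1:] * q + [:poly p t:]) l"
        using synthetic_div_correct'[of t p] by (simp add: q_def)
      then show ?thesis by (simp add: algebra_simps)
    qed
    have sx: "(\<Sum>l\<in>core_vector. w' l * poly p l) = s * poly p t - t * (\<Sum>l\<in>core_vector. w l * poly q l)"
    proof -
      have "w' l * poly p l = w l * (t / (t - l)) * poly p t - t * (w l * poly q l)" if "l \<in> core_vector" for l
      proof -
        have "l \<noteq> t" using that insert by auto
        then show ?thesis unfolding w'_def pq[of l] by (simp add: field_simps)
      qed
      then show ?thesis by (simp add: s_def sum_subtractf sum_distrib_left sum_distrib_right)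
    qed
    have sq: "t * (\<Sum>l\<in>core_vector. w l * poly q l) = t * poly q 0"
    proof (cases "degree p = 0")
      case True
      then have "q = 0" by (metis q_def synthetic_div_eq_0_iff)
      then show ?thesis by simp
    next
      case False
      then have "degree q < card core_vector" using d insert by (simp add: q_def degree_synthetic_div)
      then show ?thesis using w by simp
    qed
    have "(\<Sum>l\<in>insert t core_vector. w' l * poly p l) = (1 - s) * poly p t + (\<Sum>l\<in>core_vector. w' l * poly p l)"
      using insert by (simp add: w'_def)
    also have "\<dots> = poly p 0" using sx sq pq[of 0] by (simp add: algebra_simps)
    finally show "(\<Sum>l\<in>insert t core_vector. w' l * poly p l) = poly p 0" .
  qed
qed simp

section \<open>The rank of an involution\<close>

definition invs :: "(nat \<Rightarrow> nat) \<Rightarrow> (nat \<times> nat) set" where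
  "invs w = {(a, b). a < b \<and> w b < w a}"

text \<open>Twice the length in the involution weak order.\<close>

definition rank2 :: "(nat \<Rightarrow> nat) \<Rightarrow> nat" where
  "rank2 z = card (invs z) + card {i. i < z i}"

lemma finite_invs:
  assumes "inj w" "finite {i. w i \<noteq> i}"
  shows "finite (invs w)"
proof -
  obtain n where n: "\<And>i. n < i \<Longrightarrow> w i = i"
    using assms(2) by (metis (mono_tags, lifting) finite_nat_set_iff_bounded_le linorder_not_le mem_Collect_eq)
  have "invs w \<subseteq> {..n} \<times> {..n}"
  proof
    fix p assume "p \<in> invs w"
    then obtain a b where p: "p = (a, b)" "a < b" "w b < w a" by (auto simp: invs_def)
    have "b \<le> n"
    proof (rule ccontr)
      assume "\<not> b \<le> n"
      then have "w b = b" "n < w a" using n p by auto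
      then have "w a = a" using n[of "w a"] assms(1) by (simp add: inj_eq)
      then show False using p \<open>w b = b\<close> by simp
    qed
    then show "p \<in> {..n} \<times> {..n}" using p by simp
  qed
  then show ?thesis using finite_subset by blast
qed

text \<open>Applying \<open>simple_transp i\<close> to both positions carries the inversions of
  \<open>w\<close> to those of the product other than the new one \<open>(i, Suc i)\<close>.\<close>

lemma card_invs_right:
  assumes "inj w" "finite {i. w i \<noteq> i}" "w i < w (Suc i)"
  shows "card (invs (w \<circ> simple_transp i)) = Suc (card (invs w))"
proof -
  let ?s = "simple_transp i"
  have "invs (w \<circ> ?s) = insert (i, Suc i) (map_prod ?s ?s ` invs w)"
  proof (intro equalityI subsetI)
    fix p assume "p \<in> invs (w \<circ> ?s)"
    then obtain a b where p: "p = (a, b)" "a < b" "w (?s b) < w (?s a)" by (auto simp: invs_def)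
    show "p \<in> insert (i, Suc i) (map_prod ?s ?s ` invs w)"
    proof (cases "a = i \<and> b = Suc i")
      case False
      then have "(?s a, ?s b) \<in> invs w" using p simple_transp_less by (simp add: invs_def)
      then show ?thesis using p by (metis insertI2 image_eqI map_prod_simp simple_transp_simps(3))
    qed (use p in simp)
  next
    fix p assume "p \<in> insert (i, Suc i) (map_prod ?s ?s ` invs w)"
    then show "p \<in> invs (w \<circ> ?s)" using assms(3)
      by (auto simp: invs_def intro!: simple_transp_less)
  qed
  moreover have "(i, Suc i) \<notin> map_prod ?s ?s ` invs w"
  proof
    assume "(i, Suc i) \<in> map_prod ?s ?s ` invs w"
    then obtain a b where ab: "(a, b) \<in> invs w" "?s a = i" "?s b = Suc i" by auto
    then have "a = Suc i" "b = i" by (metis simple_transp_simps)+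
    then show False using ab by (simp add: invs_def)
  qed
  moreover have "inj_on (map_prod ?s ?s) (invs w)" by (auto simp: inj_on_def)
  ultimately show ?thesis using finite_invs[OF assms(1,2)] by (simp add: card_image)
qed

lemma card_invs_inv:
  assumes "bij w"
  shows "card (invs (inv w)) = card (invs w)"
proof (rule bij_betw_same_card[symmetric])
  have "inv w (w p) = p" "w (inv w p) = p" for p
    using assms by (simp_all add: bij_is_inj bij_is_surj surj_f_inv_f)
  then show "bij_betw (\<lambda>(a, b). (w b, w a)) (invs w) (invs (inv w))"
    by (intro bij_betw_byWitness[where f' = "\<lambda>(a, b). (inv w b, inv w a)"]) (auto simp: invs_def)
qed

lemma card_invs_left:
  assumes "bij w" "finite {i. w i \<noteq> i}" "inv w i < inv w (Suc i)"
  shows "card (invs (simple_transp i \<circ> w)) = Suc (card (invs w))"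
proof -
  have b: "bij (simple_transp i)" by (simp add: simple_transp_def)
  have "inv (simple_transp i \<circ> w) = inv w \<circ> simple_transp i"
    using assms(1) b by (simp add: o_inv_distrib simple_transp_def)
  then have "card (invs (simple_transp i \<circ> w)) = card (invs (inv w \<circ> simple_transp i))"
    using card_invs_inv[of "simple_transp i \<circ> w"] assms(1) b by (simp add: bij_comp)
  also have "\<dots> = Suc (card (invs (inv w)))"
  proof (rule card_invs_right)
    show "inj (inv w)" using assms(1) by (simp add: bij_imp_bij_inv bij_is_inj)
    have "{i. inv w i \<noteq> i} \<subseteq> {i. w i \<noteq> i}"
      using assms(1) by (auto simp: bij_inv_eq_iff) (metis bij_inv_eq_iff)
    then show "finite {i. inv w i \<noteq> i}" using assms(2) finite_subset by blast
  qed (rule assms(3))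
  also have "\<dots> = Suc (card (invs w))" by (simp add: card_invs_inv[OF assms(1)])
  finally show ?thesis .
qed

lemma Invol_bij: "z \<in> Invol \<Longrightarrow> bij z" "z \<in> Invol \<Longrightarrow> inj z" "z \<in> Invol \<Longrightarrow> inv z = z"
  "z \<in> Invol \<Longrightarrow> finite {i. z i \<noteq> i}"
proof -
  assume z: "z \<in> Invol"
  show "bij z" by (rule o_bij[of z]) (use z in \<open>auto simp: Invol_iff\<close>)
  then show "inj z" by (rule bij_is_inj)
  show "inv z = z" using z by (auto simp: Invol_def)
  show "finite {i. z i \<noteq> i}" using z by (simp add: Invol_iff)
qed

text \<open>A commuting step at an ascent adds one inversion and one exceedance, the left end of a
  new arc. A conjugating step adds two inversions and keeps the number of arcs.\<close>

lemma rank2_rtimes_asc: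
  assumes z: "z \<in> Invol" and i: "1 \<le> i" and asc: "z i < z (Suc i)"
  shows "rank2 (rtimes z i) = rank2 z + 2"
proof -
  let ?s = "simple_transp i"
  note zz = Invol_invol[OF z] and inj = Invol_eq_iff[OF z]
  have r: "card (invs (z \<circ> ?s)) = Suc (card (invs z))"
    using card_invs_right Invol_bij[OF z] asc by blast
  have exf: "finite {p. p < z p}"
    by (rule finite_subset[OF _ Invol_bij(4)[OF z]]) auto
  show ?thesis
  proof (cases "z i \<in> {i, Suc i} \<and> z (Suc i) \<in> {i, Suc i}")
    case True
    then have f: "z i = i" "z (Suc i) = Suc i" using asc by auto
    have "p < z (?s p) \<longleftrightarrow> p = i \<or> p < z p" for p
      using f by (cases "p = i"; cases "p = Suc i"; simp)
    then have "{p. p < (z \<circ> ?s) p} = insert i {p. p < z p}" by auto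
    moreover have "i \<notin> {p. p < z p}" using f by simp
    ultimately show ?thesis using True exf r by (simp add: rtimes_commuting[OF z] rank2_def del: Collect_conv_if)
  next
    case False
    have e: "rtimes z i = ?s \<circ> (z \<circ> ?s)" using False z by (simp add: rtimes_conj comp_assoc)
    have b: "bij (z \<circ> ?s)" using Invol_bij(1)[OF z] by (simp add: bij_comp simple_transp_def)
    have iv: "inv (z \<circ> ?s) = ?s \<circ> z"
      using Invol_bij(1)[OF z] Invol_bij(3)[OF z] by (simp add: o_inv_distrib simple_transp_def)
    have "{p. (z \<circ> ?s) p \<noteq> p} \<subseteq> {p. z p \<noteq> p} \<union> {i, Suc i}" by force
    then have fin: "finite {p. (z \<circ> ?s) p \<noteq> p}"
      by (rule finite_subset) (use Invol_bij(4)[OF z] in simp)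
    have "?s (z i) < ?s (z (Suc i))" using False asc by (intro simple_transp_less) auto
    then have l: "card (invs (rtimes z i)) = Suc (Suc (card (invs z)))"
    proof -
      have "inv (z \<circ> ?s) i < inv (z \<circ> ?s) (Suc i)" unfolding iv using \<open>?s (z i) < ?s (z (Suc i))\<close> by simp
      from card_invs_left[OF b fin this] r show ?thesis unfolding e by (simp only:)
    qed
    have "{p. p < rtimes z i p} = ?s ` {p. p < z p}"
    proof (intro equalityI subsetI)
      fix p assume "p \<in> {p. p < rtimes z i p}"
      then have p: "p < ?s (z (?s p))" by (simp add: e)
      have "?s p < z (?s p)"
      proof (rule ccontr)
        assume "\<not> ?s p < z (?s p)"
        moreover have "z (?s p) \<noteq> ?s p" using p by auto
        ultimately have "z (?s p) < ?s p" by simp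
        then have "?s (z (?s p)) < p \<or> z (?s p) = i \<and> ?s p = Suc i"
          using simple_transp_less[of "z (?s p)" "?s p" i] by auto
        then show False using p False by (metis insertCI less_asym zz)
      qed
      then show "p \<in> ?s ` {p. p < z p}" by (metis (mono_tags) image_eqI mem_Collect_eq simple_transp_simps(3))
    next
      fix p assume "p \<in> ?s ` {p. p < z p}"
      then obtain q where q: "q < z q" "p = ?s q" by auto
      have "\<not> (q = i \<and> z q = Suc i)" using False by (metis insertCI zz)
      then show "p \<in> {p. p < rtimes z i p}" using q by (auto simp: e intro!: simple_transp_less)
    qed
    then have "card {p. p < rtimes z i p} = card {p. p < z p}"
      by (simp add: card_image inj_on_def)
    then show ?thesis using l by (simp add: rank2_def)
  qed
qed

lemma rank2_rtimes_desc:
  assumes z: "z \<in> Invol" and i: "1 \<le> i" and d: "z (Suc i) < z i"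
  shows "rank2 z = rank2 (rtimes z i) + 2"
  using rank2_rtimes_asc[OF rtimes_Invol[OF z i] i rtimes_at[OF z d]] rtimes_rtimes[OF z i] by simp

section \<open>Splitting the variables\<close>

text \<open>The case \<open>k = 0\<close> is listed separately because \<open>N\<close> may then be
  \<open>0\<close> too.\<close>

lemma A_split:
  assumes "k < N \<or> k = 0"
  shows "A 1 N x f = hs (rev [1..<Suc k]) x (A (Suc k) N x f)"
proof (cases "k = 0")
  case False
  then have "[1..<N] = [1..<Suc k] @ [Suc k..<N]" using assms
    by (metis Suc_le_eq le_add1 plus_1_eq_Suc upt_add_eq_append le_add_diff_inverse Suc_leI)
  then show ?thesis by (simp del: upt_Suc)
qed simp

lemma B_split:
  assumes "k < N \<or> k = 0"
  shows "B 1 N x f = B (Suc k) N x (B 1 (Suc k) x f)"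
proof (cases "k = 0")
  case False
  then have "[1..<N] = [1..<Suc k] @ [Suc k..<N]" using assms
    by (metis Suc_le_eq le_add1 plus_1_eq_Suc upt_add_eq_append le_add_diff_inverse Suc_leI)
  then show ?thesis by (simp del: upt_Suc)
qed simp

text \<open>Since \<open>A\<^sub>k\<^sub>+\<^sub>1(l) = A\<^sub>1(l) h\<^sub>1(-l) \<dots> h\<^sub>k(-l)\<close>, each summand is a polynomial of degree at most \<open>k\<close> in
  \<open>l\<close> with value \<open>A\<^sub>1(us)\<close> at \<open>0\<close>.\<close>

lemma A_peel:
  assumes "k < N \<or> k = 0" "distinct us" "length us = Suc k"
  shows "\<exists>w. \<forall>f z. fold (A 1 N) us f z = (\<Sum>l\<leftarrow>us. w l * A (Suc k) N l (fold (A 1 N) (remove1 l us) f) z)"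
proof -
  obtain w where w: "\<forall>p :: real poly. degree p < card (uminus ` set us) \<longrightarrow>
      (\<Sum>l\<in>uminus ` set us. w l * poly p l) = poly p 0"
    using polyn_zero_weights[of "uminus ` set us"] by auto
  have c: "card (uminus ` set us) = Suc k" using assms(2,3) by (simp add: card_image distinct_card)
  show ?thesis
  proof (intro exI[of _ "\<lambda>l. w (- l)"] allI)
    fix f z
    let ?G = "fold (A 1 N) us f"
    have "poly_family (0 + length [1..<Suc k]) (\<lambda>t. hs [1..<Suc k] t ?G)"
      by (intro polyn_hs_var polyn_const)
    then have "\<exists>p. degree p \<le> k \<and> (\<forall>t. hs [1..<Suc k] t ?G z = poly p t)"
      unfolding poly_family_def by (simp del: upt_Suc)
    then obtain p where p: "degree p \<le> k" "\<And>t. hs [1..<Suc k] t ?G z = poly p t" by metis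
    have l: "A (Suc k) N l (fold (A 1 N) (remove1 l us) f) z = poly p (- l)" if "l \<in> set us" for l
    proof -
      have "mset us = mset (remove1 l us @ [l])" using that by simp
      then have "?G = A 1 N l (fold (A 1 N) (remove1 l us) f)"
        using fold_A_mset by (metis fold_append fold_simps(1,2) comp_apply)
      also have "\<dots> = hs (rev [1..<Suc k]) l (A (Suc k) N l (fold (A 1 N) (remove1 l us) f))"
        by (rule A_split[OF assms(1)])
      finally have "A (Suc k) N l (fold (A 1 N) (remove1 l us) f) = hs [1..<Suc k] (- l) ?G"
        by (simp del: upt_Suc)
      then show ?thesis using p(2)[of "- l"] by simp
    qed
    have "(\<Sum>l\<leftarrow>us. w (- l) * A (Suc k) N l (fold (A 1 N) (remove1 l us) f) z) = (\<Sum>l\<in>set us. w (- l) * poly p (- l))"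
      using l by (simp add: sum_list_distinct_conv_sum_set[OF assms(2)])
    also have "\<dots> = (\<Sum>l\<in>uminus ` set us. w l * poly p l)" by (simp add: sum.reindex)
    also have "\<dots> = poly p 0" using w c p(1) by simp
    also have "\<dots> = ?G z" using p(2)[of 0] by (simp del: upt_Suc)
    finally show "?G z = (\<Sum>l\<leftarrow>us. w (- l) * A (Suc k) N l (fold (A 1 N) (remove1 l us) f) z)" by simp
  qed
qed

lemma sum_list_concat_map: "(\<Sum>x\<leftarrow>concat (map F ts). G x) = (\<Sum>t\<leftarrow>ts. \<Sum>x\<leftarrow>F t. G x)"
  by (induction ts) simp_all

text \<open>Induction on the list of variables: the new variable joins the block \<open>us\<close>,
  which then has \<open>k + 1\<close> elements, and \<open>A_peel\<close> moves one of them over to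
  \<open>vs\<close>. The variables must be distinct because they serve as interpolation
  nodes.\<close>

lemma A_expand:
  assumes "k < N \<or> k = 0" "distinct xs" "k \<le> length xs"
  shows "\<exists>T. (\<forall>(c, us, vs)\<in>set T. length us = k \<and> mset us + mset vs = mset xs) \<and>
    (\<forall>f z. fold (A 1 N) xs f z = (\<Sum>(c, us, vs)\<leftarrow>T. c * fold (A (Suc k) N) vs (fold (A 1 N) us f) z))"
  using assms(2,3)
proof (induction xs)
  case Nil
  then show ?case by (intro exI[of _ "[(1, [], [])]"]) simp
next
  case (Cons t ys)
  show ?case
  proof (cases "k = length (t # ys)")
    case True
    then show ?thesis by (intro exI[of _ "[(1, t # ys, [])]"]) simp
  next
    case False
    then have "k \<le> length ys" using Cons.prems by simp
    then obtain T where T: "\<And>c us vs. (c, us, vs) \<in> set T \<Longrightarrow> length us = k \<and> mset us + mset vs = mset ys"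
      "\<And>f z. fold (A 1 N) ys f z = (\<Sum>(c, us, vs)\<leftarrow>T. c * fold (A (Suc k) N) vs (fold (A 1 N) us f) z)"
      using Cons by fastforce
    \<comment> \<open>The interpolation weights depend on the block \<open>us\<close>;
      \<open>w us\<close> fixes one choice for each block.\<close>
    define W where "W us w \<longleftrightarrow> (\<forall>f z. fold (A 1 N) (t # us) f z =
        (\<Sum>l\<leftarrow>t # us. w l * A (Suc k) N l (fold (A 1 N) (remove1 l (t # us)) f) z))" for us w
    define w where "w us = (SOME w. W us w)" for us
    have w: "W us (w us)" if "(c, us, vs) \<in> set T" for c us vs
      unfolding w_def
    proof (rule someI_ex[of "W us"], unfold W_def, rule A_peel[OF assms(1)])
      have m: "mset us + mset vs = mset ys" using T(1)[OF that] by simp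
      then have "distinct (us @ vs)" using Cons.prems by (metis distinct.simps(2) mset_append mset_eq_imp_distinct_iff)
      moreover have "set us \<subseteq> set ys" using m by (metis mset_subset_eq_add_left set_mset_mono set_mset_mset)
      ultimately show "distinct (t # us)" using Cons.prems by auto
      show "length (t # us) = Suc k" using T(1)[OF that] by simp
    qed
    let ?F = "\<lambda>(c, us, vs). map (\<lambda>l. (c * w us l, remove1 l (t # us), l # vs)) (t # us)"
    show ?thesis
    proof (intro exI[of _ "concat (map ?F T)"] conjI allI)
      show "\<forall>(c, us, vs)\<in>set (concat (map ?F T)). length us = k \<and> mset us + mset vs = mset (t # ys)"
      proof
        fix x assume "x \<in> set (concat (map ?F T))"
        then obtain c us vs l where x: "(c, us, vs) \<in> set T" "l \<in> set (t # us)"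
            "x = (c * w us l, remove1 l (t # us), l # vs)"
          by (auto simp del: remove1.simps)
        have "length (remove1 l (t # us)) = k" using T(1)[OF x(1)] x(2) by (subst length_remove1) auto
        moreover have "mset (remove1 l (t # us)) + mset (l # vs) = mset (t # us) + mset vs"
        proof -
          have "l \<in># mset (t # us)" using x(2) by (simp only: set_mset_mset)
          then have "add_mset l (mset (t # us) - {#l#}) = mset (t # us)" by (rule insert_DiffM)
          then show ?thesis by (simp only: mset_remove1 mset.simps(2)[of l vs] union_mset_add_mset_right
                union_mset_add_mset_left[symmetric])
        qed
        ultimately show "case x of (c, us, vs) \<Rightarrow> length us = k \<and> mset us + mset vs = mset (t # ys)"
          using T(1)[OF x(1)] by (simp add: x(3) del: remove1.simps)
      qed
      fix f z
      have step: "fold (A (Suc k) N) vs (fold (A 1 N) us (A 1 N t f)) z =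
          (\<Sum>l\<leftarrow>t # us. w us l * fold (A (Suc k) N) (l # vs) (fold (A 1 N) (remove1 l (t # us)) f) z)"
        if "(c, us, vs) \<in> set T" for c us vs
      proof -
        have "fold (A 1 N) us (A 1 N t f) = (\<lambda>z. \<Sum>l\<leftarrow>t # us. w us l * A (Suc k) N l (fold (A 1 N) (remove1 l (t # us)) f) z)"
          using w[OF that] unfolding W_def fold_simps(2) by blast
        then show ?thesis
          by (simp only: lin_sum_list[OF lin_fold[OF lin_hs]] fold_simps)
      qed
      have "fold (A 1 N) (t # ys) f z = (\<Sum>(c, us, vs)\<leftarrow>T. c * fold (A (Suc k) N) vs (fold (A 1 N) us (A 1 N t f)) z)"
        by (simp only: fold_simps T(2))
      also have "\<dots> = (\<Sum>t\<leftarrow>T. \<Sum>(c, us, vs)\<leftarrow>?F t. c * fold (A (Suc k) N) vs (fold (A 1 N) us f) z)"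
      proof (rule arg_cong[where f = sum_list], rule map_cong[OF refl])
        fix x assume "x \<in> set T"
        moreover obtain c us vs where x: "x = (c, us, vs)" by (cases x)
        ultimately have m: "(c, us, vs) \<in> set T" by simp
        show "(case x of (c, us, vs) \<Rightarrow> c * fold (A (Suc k) N) vs (fold (A 1 N) us (A 1 N t f)) z) =
            (\<Sum>(c, us, vs)\<leftarrow>?F x. c * fold (A (Suc k) N) vs (fold (A 1 N) us f) z)"
          unfolding x prod.case step[OF m] by (simp add: sum_list_const_mult comp_def mult.assoc distrib_left del: remove1.simps)
      qed
      also have "\<dots> = (\<Sum>(c, us, vs)\<leftarrow>concat (map ?F T). c * fold (A (Suc k) N) vs (fold (A 1 N) us f) z)"
        by (simp only: sum_list_concat_map)
      finally show "fold (A 1 N) (t # ys) f z = \<dots>" .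
    qed
  qed
qed

section \<open>Coefficients of weakly dominant involutions\<close>

text \<open>Weak dominance with \<open>k\<close> cycles, expressed without the list of the
  \<open>b_i\<close>: every point of \<open>1, ..., k\<close> has its partner above
  \<open>k\<close>, and no arc lies entirely above \<open>k\<close>.\<close>

definition wd :: "nat \<Rightarrow> (nat \<Rightarrow> nat) \<Rightarrow> bool" where
  "wd k z \<longleftrightarrow> z \<in> Invol \<and> (\<forall>i. 1 \<le> i \<longrightarrow> i \<le> k \<longrightarrow> k < z i) \<and> (\<forall>i>k. z i \<le> k \<or> z i = i)"

definition delta :: "(nat \<Rightarrow> nat) \<Rightarrow> (nat \<Rightarrow> nat) \<Rightarrow> real" where
  "delta w = (\<lambda>z. if z = w then 1 else 0)"

text \<open>For an involution, the number of arcs over the gap between \<open>a\<close> and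
  \<open>a + 1\<close>.\<close>

definition crossing :: "nat \<Rightarrow> (nat \<Rightarrow> nat) \<Rightarrow> nat" where
  "crossing a z = card {i. i \<le> a \<and> a < z i}"

lemma simple_transp_le_iff: "a \<noteq> i \<Longrightarrow> simple_transp i p \<le> a \<longleftrightarrow> p \<le> a"
  by (cases "p = i"; cases "p = Suc i"; auto)

text \<open>No arc joins \<open>i\<close> and \<open>i + 1\<close> since both exceed
  \<open>k\<close>, so lowering conjugates by \<open>simple_transp i\<close>, which fixes
  \<open>1, ..., k\<close> pointwise.\<close>

lemma wd_lower:
  assumes "wd k z" "k < i" "z (Suc i) < z i"
  shows "wd k (rtimes z i)"
proof -
  have z: "z \<in> Invol" using assms by (simp add: wd_def)
  have "z i \<noteq> Suc i" using assms by (auto simp: wd_def)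
  then have e: "rtimes z i = simple_transp i \<circ> z \<circ> simple_transp i" using rtimes_desc[OF z assms(3)] by simp
  have s: "simple_transp i p \<le> k \<longleftrightarrow> p \<le> k" "p \<le> k \<Longrightarrow> simple_transp i p = p" for p
    using assms(2) by (auto simp: simple_transp_le_iff)
  have "k < rtimes z i p" if "1 \<le> p" "p \<le> k" for p
    using that assms(1) s by (simp add: e wd_def not_le[symmetric])
  moreover have "rtimes z i p \<le> k \<or> rtimes z i p = p" if "k < p" for p
  proof -
    have "k < simple_transp i p" using that s(1) by (simp add: not_le[symmetric])
    then have "z (simple_transp i p) \<le> k \<or> z (simple_transp i p) = simple_transp i p"
      using assms(1) by (simp add: wd_def)
    then show ?thesis by (auto simp: e s)
  qed
  ultimately show ?thesis using rtimes_Invol[OF z] assms(2) by (simp add: wd_def)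
qed

lemma crossing_rtimes:
  assumes "z \<in> Invol" "z (Suc i) < z i" "a \<noteq> i"
  shows "crossing a (rtimes z i) = crossing a z"
proof -
  have s: "simple_transp i p \<le> a \<longleftrightarrow> p \<le> a" "a < simple_transp i p \<longleftrightarrow> a < p" for p
    using simple_transp_le_iff[OF assms(3)] by (auto simp: not_le[symmetric])
  have "{p. p \<le> a \<and> a < rtimes z i p} = simple_transp i ` {p. p \<le> a \<and> a < z p}"
  proof (intro equalityI subsetI)
    fix p assume "p \<in> {p. p \<le> a \<and> a < rtimes z i p}"
    then have "simple_transp i p \<in> {p. p \<le> a \<and> a < z p}"
      using assms by (auto simp: rtimes_desc s split: if_splits)
    then show "p \<in> simple_transp i ` {p. p \<le> a \<and> a < z p}"
      by (metis image_eqI simple_transp_simps(3))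
  next
    fix p assume "p \<in> simple_transp i ` {p. p \<le> a \<and> a < z p}"
    then show "p \<in> {p. p \<le> a \<and> a < rtimes z i p}"
      using assms by (auto simp: rtimes_desc s)
  qed
  then show ?thesis unfolding crossing_def by (simp add: card_image inj_on_def)
qed

lemma crossing_Suc: "crossing (Suc a) z \<le> Suc (crossing a z)"
proof -
  have "{i. i \<le> Suc a \<and> Suc a < z i} \<subseteq> insert (Suc a) {i. i \<le> a \<and> a < z i}" by auto
  then have "crossing (Suc a) z \<le> card (insert (Suc a) {i. i \<le> a \<and> a < z i})"
    unfolding crossing_def by (rule card_mono[rotated]) simp
  then show ?thesis by (simp add: crossing_def card_insert_if split: if_splits)
qed

lemma h_nonzero_cases:
  assumes "h i x f z \<noteq> 0"
  obtains "f z \<noteq> 0" | "z \<in> Invol" "1 \<le> i" "z (Suc i) < z i" "f (rtimes z i) \<noteq> 0"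
  using assms by (cases "f z = 0") (auto simp: h_def U_def split: if_splits)

text \<open>The letters act in decreasing order, and the letter \<open>i\<close> changes only the
  count over gap \<open>i\<close>. Gap \<open>i - 1\<close> is still untouched at that moment, so
  its count is at most \<open>c\<close>, and counts over adjacent gaps increase by at most
  one.\<close>

lemma crossing_A_from:
  assumes "\<And>z a. f z \<noteq> 0 \<Longrightarrow> crossing a z \<le> c" "1 \<le> i"
  shows "A i N x f z \<noteq> 0 \<Longrightarrow> crossing a z \<le> (if a < i then c else Suc c)"
  using assms(2)
proof (induction "N - i" arbitrary: i z a)
  case 0
  then show ?case using assms(1) by (auto simp: le_Suc_eq)
next
  case (Suc d)
  then have iN: "i < N" and d: "d = N - Suc i" by simp_all
  note IH = Suc.hyps(1)[OF d]
  have "h i x (A (Suc i) N x f) z \<noteq> 0" using Suc.prems A_rec[OF iN] by metis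
  then show ?case
  proof (cases rule: h_nonzero_cases)
    case 1
    then show ?thesis using IH[of z a] by (auto split: if_splits)
  next
    case 2
    have le: "crossing b (rtimes z i) \<le> (if b < Suc i then c else Suc c)" for b
      using IH[OF 2(4)] by simp
    show ?thesis
    proof (cases "a = i")
      case False
      then show ?thesis using le[of a] crossing_rtimes[OF 2(1,3), of a] by (auto split: if_splits)
    next
      case True
      obtain j where j: "i = Suc j" using Suc.prems(2) by (cases i) auto
      have "crossing i z \<le> Suc (crossing j z)" using crossing_Suc j by simp
      moreover have "crossing j z \<le> c" using le[of j] crossing_rtimes[OF 2(1,3), of j] j by simp
      ultimately show ?thesis using True by simp
    qed
  qed
qed

lemma crossing_fold_A:
  assumes "\<And>z a. f z \<noteq> 0 \<Longrightarrow> crossing a z \<le> c" "fold (A 1 N) xs f z \<noteq> 0"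
  shows "crossing a z \<le> c + length xs"
  using assms
proof (induction xs arbitrary: f c)
  case (Cons x xs)
  have "crossing a z \<le> Suc c" if "A 1 N x f z \<noteq> 0" for a z
    using crossing_A_from[OF Cons.prems(1) order.refl that, of a] by (simp split: if_splits)
  from Cons.IH[OF this] Cons.prems(2) show ?case by simp
qed simp

lemma wd_crossing:
  assumes "wd k z"
  shows "k \<le> crossing k z"
proof -
  have "card {1..k} \<le> card {i. i \<le> k \<and> k < z i}"
    using assms by (intro card_mono) (auto simp: wd_def)
  then show ?thesis by (simp add: crossing_def)
qed

text \<open>Letters above \<open>k\<close> evaluate their argument only at \<open>z\<close> and at
  involutions below it, and by \<open>wd_lower\<close> these all satisfy
  \<open>wd k\<close>.\<close>

lemma hs_local:
  assumes "\<And>z. wd k z \<Longrightarrow> f z = g z" "\<And>i. i \<in> set ls \<Longrightarrow> k < i" "wd k z"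
  shows "hs ls x f z = hs ls x g z"
  using assms
proof (induction ls arbitrary: f g)
  case (Cons i ls)
  have "h i x f w = h i x g w" if "wd k w" for w
    using that Cons.prems(1,2) wd_lower[OF that, of i] by (auto simp: h_def U_def)
  moreover have "\<And>j. j \<in> set ls \<Longrightarrow> k < j" using Cons.prems(2) by simp
  ultimately show ?case unfolding hs_simps using Cons.prems(3) by (rule Cons.IH)
qed simp

lemma fold_hs_local:
  assumes "\<And>z. wd k z \<Longrightarrow> f z = g z" "\<And>i. i \<in> set ls \<Longrightarrow> k < i" "wd k z"
  shows "fold (hs ls) xs f z = fold (hs ls) xs g z"
  using assms
proof (induction xs arbitrary: f g)
  case (Cons x xs)
  have "hs ls x f w = hs ls x g w" if "wd k w" for w
    using hs_local[OF Cons.prems(1,2) that] .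
  then show ?case unfolding fold_simps using Cons.prems(2,3) by (rule Cons.IH)
qed simp

lemma fold_A_local:
  "(\<And>z. wd k z \<Longrightarrow> f z = g z) \<Longrightarrow> wd k z \<Longrightarrow> fold (A (Suc k) N) xs f z = fold (A (Suc k) N) xs g z"
  "(\<And>z. wd k z \<Longrightarrow> f z = g z) \<Longrightarrow> wd k z \<Longrightarrow> fold (B (Suc k) N) xs f z = fold (B (Suc k) N) xs g z"
  by (rule fold_hs_local; auto)+

lemma fold_zero:
  "fold (A (Suc k) N) xs (\<lambda>z. 0) = (\<lambda>z. 0)" "fold (B (Suc k) N) xs (\<lambda>z. 0) = (\<lambda>z. 0)"
  by (simp_all only: lin_0[OF lin_fold[OF lin_hs]])

lemma fold_A_uminus: "fold (B i N) xs (fold (A i N) (map uminus xs) f) = f"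
proof (induction xs arbitrary: f)
  case (Cons t ys)
  have "B i N t (fold (A i N) (map uminus ys) (A i N (- t) f)) = fold (A i N) (map uminus ys) (B i N t (A i N (- t) f))"
    by (rule fold_commute1) (simp add: A_B_commute)
  then show ?case using Cons by simp
qed simp

section \<open>Polynomials with prescribed roots, products of pairwise sums, and rescaling of
  variables\<close>

lemma poly_eq_prod_roots:
  fixes p :: "real poly"
  assumes "finite R" "degree p \<le> card R" "\<And>r. r \<in> R \<Longrightarrow> poly p r = 0"
  shows "\<exists>c. \<forall>t. poly p t = c * (\<Prod>r\<in>R. t - r)"
  using assms
proof (induction R arbitrary: p rule: finite_induct)
  case empty
  then obtain c where "p = [:c:]" using degree_0_id by (metis card.empty le_zero_eq)
  then show ?case by auto
next
  case (insert r R)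
  then have "[:- r, 1:] dvd p" by (simp add: poly_eq_0_iff_dvd)
  then obtain q where q: "p = [:- r, 1:] * q" by (rule dvdE)
  have "degree q \<le> card R"
  proof (cases "q = 0")
    case False
    then have "degree p = 1 + degree q" unfolding q by (subst degree_mult_eq) auto
    then show ?thesis using insert by simp
  qed simp
  moreover have "poly q s = 0" if "s \<in> R" for s
    using insert.prems(2)[of s] insert.hyps(2) that q by auto
  ultimately obtain c where c: "\<And>t. poly q t = c * (\<Prod>r\<in>R. t - r)" using insert.IH by blast
  show ?case using c insert.hyps by (intro exI[of _ c]) (simp add: q algebra_simps)
qed

text \<open>The product of all \<open>x_i + x_j\<close> with \<open>i < j\<close>, times the product
  of all \<open>x_i\<close> if \<open>\<epsilon> = 1\<close>.\<close>

fun core_denom :: "nat \<Rightarrow> real list \<Rightarrow> real" where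
  "core_denom \<epsilon> [] = 1"
| "core_denom \<epsilon> (t # ys) = t ^ \<epsilon> * prod_list (map (\<lambda>y. t + y) ys) * core_denom \<epsilon> ys"

lemma vand_rotate: "core_denom \<epsilon> (xs @ [t]) = core_denom \<epsilon> (t # xs)"
  by (induction xs) (simp_all add: mult_ac add.commute)

lemma prod_list_pos: "(\<And>x. x \<in> set xs \<Longrightarrow> 0 < x) \<Longrightarrow> 0 < prod_list (xs :: real list)"
  by (induction xs) simp_all

lemma vand_pos: "(\<And>x. x \<in> set xs \<Longrightarrow> 0 < x) \<Longrightarrow> 0 < core_denom \<epsilon> xs"
  by (induction xs) (auto intro!: mult_pos_pos prod_list_pos add_pos_pos)

lemma prod_list_scale: "prod_list (map (\<lambda>y. s * t + y) (map ((*) s) ys)) = s ^ length ys * prod_list (map (\<lambda>y. t + y) ys)" for s t :: real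
  by (induction ys) (simp_all add: algebra_simps)

text \<open>The exponent is twice the degree of \<open>core_denom\<close>: the variables are scaled
  by a square in order to match \<open>rank2\<close>, which is a doubled length.\<close>

lemma vand_scale:
  "core_denom \<epsilon> (map ((*) (r\<^sup>2)) xs) = r ^ (length xs * (length xs - 1) + 2 * length xs * \<epsilon>) * core_denom \<epsilon> xs"
proof (induction xs)
  case (Cons t ys)
  let ?n = "length ys"
  have e: "Suc ?n * (Suc ?n - 1) + 2 * Suc ?n * \<epsilon> = 2 * \<epsilon> + 2 * ?n + (?n * (?n - 1) + 2 * ?n * \<epsilon>)"
    by (cases ?n) (simp_all add: algebra_simps)
  have "core_denom \<epsilon> (map ((*) (r\<^sup>2)) (t # ys)) =
      (r\<^sup>2 * t) ^ \<epsilon> * ((r\<^sup>2) ^ ?n * prod_list (map (\<lambda>y. t + y) ys)) * (r ^ (?n * (?n - 1) + 2 * ?n * \<epsilon>) * core_denom \<epsilon> ys)"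
    by (simp only: list.map core_denom.simps prod_list_scale Cons.IH)
  also have "\<dots> = r ^ (2 * \<epsilon> + 2 * ?n + (?n * (?n - 1) + 2 * ?n * \<epsilon>)) * core_denom \<epsilon> (t # ys)"
    by (simp add: power_add power_mult_distrib mult_ac flip: power_mult)
  finally show ?case unfolding e[symmetric] by simp
qed simp

definition weigh :: "real \<Rightarrow> ((nat \<Rightarrow> nat) \<Rightarrow> real) \<Rightarrow> (nat \<Rightarrow> nat) \<Rightarrow> real" where
  "weigh r f = (\<lambda>z. r ^ rank2 z * f z)"

text \<open>Every factor \<open>U i\<close> comes with one variable and raises \<open>rank2\<close>
  by 2, so rescaling the variables by \<open>r\<^sup>2\<close> amounts to weighting each coefficient
  by \<open>r\<close> to the power of its rank.\<close>

lemma hs_weigh: "hs ls (r\<^sup>2 * x) (weigh r f) = weigh r (hs ls x f)"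
proof (induction ls arbitrary: f)
  case (Cons i ls)
  have "h i (r\<^sup>2 * x) (weigh r f) = weigh r (h i x f)"
  proof
    fix z
    show "h i (r\<^sup>2 * x) (weigh r f) z = weigh r (h i x f) z"
    proof (cases "z \<in> Invol \<and> 1 \<le> i \<and> z (Suc i) < z i")
      case True
      then have "rank2 z = rank2 (rtimes z i) + 2" using rank2_rtimes_desc by blast
      then show ?thesis using True by (simp add: h_def weigh_def U_def power_add algebra_simps power2_eq_square)
    next
      case False
      then show ?thesis by (auto simp: h_def weigh_def U_def)
    qed
  qed
  then show ?case using Cons by simp
qed simp

lemma fold_hs_weigh: "fold (hs ls) (map ((*) (r\<^sup>2)) xs) (weigh r f) = weigh r (fold (hs ls) xs f)"
  by (induction xs arbitrary: f) (simp_all add: hs_weigh)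

text \<open>A factor \<open>s\<close> above all ratios works. It keeps the variables distinct while
  some of them are already rescaled and others are not yet.\<close>

lemma exists_separating_scale:
  assumes "finite core_vector" "\<And>x. x \<in> core_vector \<Longrightarrow> 0 < (x :: real)"
  shows "\<exists>s>1. \<forall>x\<in>core_vector. \<forall>y\<in>core_vector. s * x \<noteq> y"
proof -
  let ?Q = "insert 1 ((\<lambda>(x, y). y / x) ` (core_vector \<times> core_vector))"
  have f: "finite ?Q" using assms(1) by simp
  show ?thesis
  proof (intro exI[of _ "Max ?Q + 1"] conjI ballI notI)
    show "1 < Max ?Q + 1" using Max_ge[OF f, of 1] by simp
    fix x y assume xy: "x \<in> core_vector" "y \<in> core_vector" "(Max ?Q + 1) * x = y"
    have "y / x \<le> Max ?Q" using xy by (intro Max_ge[OF f]) auto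
    moreover have "y / x = Max ?Q + 1" using xy assms(2)[OF xy(1)] by auto
    ultimately show False by simp
  qed
qed

text \<open>Combines two equations of ratios. The common factor \<open>b\<close> stays on both
  sides, to be cancelled where it is known to be nonzero.\<close>

lemma cross_mult: "a * b = c * d \<Longrightarrow> c * V = Y * b \<Longrightarrow> a * V * b = Y * d * b" for a b c d V Y :: real
  by algebra

lemma cross_mult': "b * R = S * a \<Longrightarrow> a * W = b * v \<Longrightarrow> W = D * v \<Longrightarrow> a * (D * v) * R = S * a * v"
  for a b R S W v D :: real
  by algebra

section \<open>Coefficients of weakly dominant involutions over an abstract base vector\<close>

text \<open>\<open>\<epsilon>\<close> is \<open>1\<close> for \<open>e = 1\<close> and \<open>0\<close> in the fixed-point-free case.\<close>

locale base_vector =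
  fixes N k \<epsilon> r0 :: nat and e :: "(nat \<Rightarrow> nat) \<Rightarrow> real" and g :: "nat \<Rightarrow> nat"
  assumes kN: "k < N \<or> k = 0"
    and eps: "\<epsilon> \<le> 1"
    and A_e: "A 1 N x e = B 1 N x e"
    and crossing_e: "e z \<noteq> 0 \<Longrightarrow> crossing a z \<le> 1 - \<epsilon>"
    and rank2_e: "e z \<noteq> 0 \<Longrightarrow> rank2 z = r0"
    and rank2_wd: "wd k z \<Longrightarrow> z \<noteq> g \<Longrightarrow> r0 + k * (k - 1) + 2 * k * \<epsilon> < rank2 z"
    and degree_e: "wd k z \<Longrightarrow> 1 \<le> k \<Longrightarrow> \<exists>p. degree p \<le> k - 1 + \<epsilon> \<and>
      (\<forall>t. fold (A (Suc k) N) vs (B 1 (Suc k) t (fold (A 1 N) ys e)) z = poly p t)"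
begin

text \<open>The vector \<open>e A_1(x_K) A_{k+1}(-x_K)\<close>: the first block of variables is
  undone again on all letters above \<open>k\<close>.\<close>

definition core_vector :: "real list \<Rightarrow> (nat \<Rightarrow> nat) \<Rightarrow> real" where
  "core_vector xs = fold (A (Suc k) N) (map uminus xs) (fold (A 1 N) xs e)"

lemma X_mset: "mset xs = mset ys \<Longrightarrow> core_vector xs = core_vector ys"
  unfolding core_vector_def using fold_A_mset[of xs ys] fold_A_mset[of "map uminus xs" "map uminus ys"]
  by (simp add: mset_map)

text \<open>On \<open>e\<close> the operator \<open>A 1 N y\<close> may be replaced by
  \<open>B 1 N y\<close>, which is the inverse of \<open>A 1 N (- y)\<close>.\<close>

lemma A_cancel: "fold (A 1 N) (- y # y # xs) e = fold (A 1 N) xs e"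
proof -
  have "fold (A 1 N) (- y # y # xs) e = fold (A 1 N) xs (A 1 N (- y) (A 1 N y e))"
    by (simp only: fold_simps A_commute)
  then show ?thesis by (simp only: A_e[of y] hs_inverse)
qed

text \<open>Moving the factor of \<open>t\<close> next to \<open>e\<close> turns it into
  \<open>B 1 N t\<close>, whose part with letters above \<open>k\<close> is cancelled by
  \<open>A (Suc k) N (- t)\<close>. Only the letters \<open>1, ..., k\<close> keep the variable
  \<open>t\<close>, which makes the vector polynomial in \<open>t\<close>.\<close>

lemma X_Cons: "core_vector (t # ys) = fold (A (Suc k) N) (map uminus ys) (B 1 (Suc k) t (fold (A 1 N) ys e))"
proof -
  have "fold (A 1 N) (t # ys) e = fold (A 1 N) ys (B 1 N t e)" by (simp only: fold_simps A_e)
  also have "\<dots> = B 1 N t (fold (A 1 N) ys e)"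
    by (rule fold_commute1[symmetric]) (simp only: A_B_commute)
  also have "\<dots> = B (Suc k) N t (B 1 (Suc k) t (fold (A 1 N) ys e))" by (rule B_split[OF kN])
  finally have "A (Suc k) N (- t) (fold (A 1 N) (t # ys) e) = B 1 (Suc k) t (fold (A 1 N) ys e)"
    by (simp only: hs_inverse)
  then show ?thesis unfolding core_vector_def by (simp only: list.map fold_simps)
qed

text \<open>With so few factors no involution with \<open>k\<close> arcs over gap \<open>k\<close>
  is reached, and by locality the remaining letters above \<open>k\<close> see only the zero
  vector.\<close>

lemma fold_A_wd_0:
  assumes "length xs + 1 - \<epsilon> < k" "wd k z"
  shows "fold (A (Suc k) N) vs (fold (A 1 N) xs e) z = 0"
proof -
  have "fold (A 1 N) xs e w = 0" if "wd k w" for w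
  proof (rule ccontr)
    assume "fold (A 1 N) xs e w \<noteq> 0"
    then have "crossing k w \<le> 1 - \<epsilon> + length xs"
      using crossing_fold_A[of e "1 - \<epsilon>"] crossing_e by blast
    then show False using wd_crossing[OF that] assms(1) eps by simp
  qed
  then have "fold (A (Suc k) N) vs (fold (A 1 N) xs e) z = fold (A (Suc k) N) vs (\<lambda>z. 0) z"
    by (intro fold_A_local(1)[OF _ assms(2)])
  then show ?thesis by (simp only: fold_zero)
qed

text \<open>As a polynomial in \<open>t\<close> the coefficient has degree at most
  \<open>k - 1 + \<epsilon>\<close>, and it has just as many known roots. At \<open>t = - y\<close>
  two factors cancel, and at \<open>t = 0\<close> with \<open>\<epsilon> = 1\<close> one factor is
  trivial; either way too few arcs over gap \<open>k\<close> can arise.\<close>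

lemma X_Cons_shape:
  assumes "wd k z" "length ys = k - 1" "1 \<le> k" "distinct ys" "\<And>y. y \<in> set ys \<Longrightarrow> 0 < y"
  shows "\<exists>c. \<forall>t. core_vector (t # ys) z = c * (t ^ \<epsilon> * prod_list (map (\<lambda>y. t + y) ys))"
proof -
  obtain p where p: "degree p \<le> k - 1 + \<epsilon>" "\<And>t. core_vector (t # ys) z = poly p t"
    unfolding X_Cons using degree_e[OF assms(1,3)] by metis
  define R where "R = uminus ` set ys \<union> (if \<epsilon> = 1 then {0} else {})"
  have c: "card R = k - 1 + \<epsilon>"
  proof -
    have "card (uminus ` set ys) = k - 1" using assms(2,4) by (simp add: card_image distinct_card)
    moreover have "0 \<notin> uminus ` set ys" using assms(5) by force
    ultimately show ?thesis using eps by (cases "\<epsilon> = 1") (auto simp: R_def)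
  qed
  have "poly p r = 0" if "r \<in> R" for r
  proof (cases "r \<in> uminus ` set ys")
    case True
    then obtain y where y: "y \<in> set ys" "r = - y" by auto
    have "mset (- y # ys) = mset (- y # y # remove1 y ys)" using y(1) by simp
    then have "fold (A 1 N) (- y # ys) e = fold (A 1 N) (- y # y # remove1 y ys) e"
      by (rule fold_A_mset)
    also have "\<dots> = fold (A 1 N) (remove1 y ys) e" by (rule A_cancel)
    finally have f: "fold (A 1 N) (- y # ys) e = fold (A 1 N) (remove1 y ys) e" .
    have "1 \<le> length ys" using y(1) by (cases ys) auto
    then have "length (remove1 y ys) + 1 - \<epsilon> < k" using assms(2) y(1) by (simp add: length_remove1)
    then have "core_vector (- y # ys) z = 0" unfolding core_vector_def f using assms(1) by (rule fold_A_wd_0)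
    then show ?thesis using p(2)[of r] y(2) by simp
  next
    case False
    then have "r = 0" "\<epsilon> = 1" using that by (auto simp: R_def split: if_splits)
    moreover have "length ys + 1 - \<epsilon> < k" using assms(2,3) \<open>\<epsilon> = 1\<close> by simp
    from fold_A_wd_0[OF this assms(1)] have "core_vector (0 # ys) z = 0" unfolding X_Cons by (simp only: hs_0)
    ultimately show ?thesis using p(2)[of 0] by simp
  qed
  moreover have "finite R" by (simp add: R_def)
  ultimately obtain c where c: "\<And>t. poly p t = c * (\<Prod>r\<in>R. t - r)"
    using poly_eq_prod_roots[of R p] p(1) unfolding c by metis
  have "(\<Prod>r\<in>R. t - r) = t ^ \<epsilon> * prod_list (map (\<lambda>y. t + y) ys)" for t
  proof -
    have "(\<Prod>r\<in>uminus ` set ys. t - r) = (\<Prod>y\<in>set ys. t + y)" by (simp add: prod.reindex)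
    also have "\<dots> = prod_list (map (\<lambda>y. t + y) ys)" by (simp add: prod.distinct_set_conv_list[OF assms(4)])
    finally have *: "(\<Prod>r\<in>uminus ` set ys. t - r) = prod_list (map (\<lambda>y. t + y) ys)" .
    show ?thesis
    proof (cases "\<epsilon> = 1")
      case True
      have "0 \<notin> uminus ` set ys" using assms(5) by force
      then show ?thesis using True * by (simp add: R_def)
    next
      case False
      then have "\<epsilon> = 0" using eps by simp
      then show ?thesis using * by (simp add: R_def)
    qed
  qed
  then show ?thesis using c p(2) by metis
qed

lemma X_exchange:
  assumes "wd k z" "length ys = k - 1" "1 \<le> k" "distinct ys" "\<And>y. y \<in> set ys \<Longrightarrow> 0 < y"
  shows "core_vector (t # ys) z * core_denom \<epsilon> (t' # ys) = core_vector (t' # ys) z * core_denom \<epsilon> (t # ys)"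
  using X_Cons_shape[OF assms] by (auto simp: mult_ac)

text \<open>The ratio of the coefficient and the denominator does not change when one variable is replaced;
  here the variables are rescaled one after the other, staying distinct.\<close>

lemma X_scale:
  assumes "wd k z" "length (us @ vs) = k" "distinct (us @ vs)" "\<And>x. x \<in> set (us @ vs) \<Longrightarrow> 0 < x"
    "1 < s" "\<And>x y. x \<in> set (us @ vs) \<Longrightarrow> y \<in> set (us @ vs) \<Longrightarrow> s * x \<noteq> y"
  shows "core_vector (us @ map ((*) s) vs) z * core_denom \<epsilon> (map ((*) s) (vs @ us)) =
    core_vector (map ((*) s) (vs @ us)) z * core_denom \<epsilon> (us @ map ((*) s) vs)"
  using assms(2-4,6)
proof (induction us arbitrary: vs)
  case Nil
  then show ?case by simp
next
  case (Cons u us)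
  let ?ys = "us @ map ((*) s) vs"
  have d: "distinct (us @ vs)" "u \<notin> set (us @ vs)" using Cons.prems(2) by auto
  have "distinct (map ((*) s) vs)" using d(1) assms(5) by (simp add: distinct_map inj_on_def)
  moreover have "x \<notin> set (map ((*) s) vs)" if "x \<in> set us" for x
  proof
    assume "x \<in> set (map ((*) s) vs)"
    then obtain v where "v \<in> set vs" "x = s * v" by auto
    then show False using Cons.prems(4)[of v x] that by simp
  qed
  ultimately have dy: "distinct ?ys" using d(1) unfolding distinct_append by blast
  have py: "0 < y" if "y \<in> set ?ys" for y using that Cons.prems(3) assms(5) by auto
  have k1: "1 \<le> k" "length ?ys = k - 1" using Cons.prems(1) by auto
  have ex: "core_vector (u # ?ys) z * core_denom \<epsilon> (s * u # ?ys) = core_vector (s * u # ?ys) z * core_denom \<epsilon> (u # ?ys)"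
    by (rule X_exchange[OF assms(1) k1(2,1) dy py])
  have IH: "core_vector (us @ map ((*) s) (vs @ [u])) z * core_denom \<epsilon> (map ((*) s) ((vs @ [u]) @ us)) =
    core_vector (map ((*) s) ((vs @ [u]) @ us)) z * core_denom \<epsilon> (us @ map ((*) s) (vs @ [u]))"
    by (rule Cons.IH) (use Cons.prems in auto)
  have 1: "us @ map ((*) s) (vs @ [u]) = ?ys @ [s * u]" by simp
  have Xr: "core_vector (?ys @ [s * u]) = core_vector (s * u # ?ys)" by (rule X_mset) simp
  have p: "0 < core_denom \<epsilon> (s * u # ?ys)"
    using py Cons.prems(3)[of u] assms(5) by (intro vand_pos) auto
  have IH': "core_vector (s * u # ?ys) z * core_denom \<epsilon> (map ((*) s) (vs @ u # us)) =
    core_vector (map ((*) s) (vs @ u # us)) z * core_denom \<epsilon> (s * u # ?ys)"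
    using IH unfolding 1 Xr vand_rotate by (simp only: append_assoc append_Cons append_Nil)
  have "core_vector (u # ?ys) z * core_denom \<epsilon> (map ((*) s) (vs @ u # us)) * core_denom \<epsilon> (s * u # ?ys) =
     core_vector (map ((*) s) (vs @ u # us)) z * core_denom \<epsilon> (u # ?ys) * core_denom \<epsilon> (s * u # ?ys)"
    using cross_mult[OF ex IH'] .
  then show ?case using p by (simp only: mult_right_cancel less_numeral_extra(3) append_Cons neq_iff simp_thms)
qed

text \<open>Multiply all variables by \<open>s = r\<^sup>2\<close>. By the weights the coefficient
  is multiplied by \<open>r ^ (rank2 z - r0)\<close>, but by \<open>X_scale\<close> it scales like
  \<open>core_denom\<close>. For \<open>z\<close> other than \<open>g\<close> the first exponent is
  strictly larger, so the coefficient is zero.\<close>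

lemma X_eq_0:
  assumes "wd k z" "z \<noteq> g" "length xs = k" "distinct xs" "\<And>x. x \<in> set xs \<Longrightarrow> 0 < x"
  shows "core_vector xs z = 0"
proof -
  obtain s where s: "1 < s" "\<And>x y. x \<in> set xs \<Longrightarrow> y \<in> set xs \<Longrightarrow> s * x \<noteq> y"
    using exists_separating_scale[of "set xs"] assms(5) by auto
  define r where "r = sqrt s"
  have r: "1 < r" "s = r\<^sup>2" using s(1) by (auto simp: r_def)
  let ?d = "k * (k - 1) + 2 * k * \<epsilon>"
  have e: "weigh r e = (\<lambda>w. r ^ r0 * e w)"
    using rank2_e by (auto simp: weigh_def fun_eq_iff)
  have "core_vector (map ((*) s) xs) z * r ^ r0 = r ^ rank2 z * core_vector xs z"
  proof -
    have "map uminus (map ((*) s) xs) = map ((*) s) (map uminus xs)" by simp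
    then have "fold (A (Suc k) N) (map uminus (map ((*) s) xs)) (fold (A 1 N) (map ((*) s) xs) (weigh r e)) = weigh r (core_vector xs)"
      unfolding r(2) core_vector_def by (simp only: fold_hs_weigh)
    moreover have "fold (A (Suc k) N) (map uminus (map ((*) s) xs)) (fold (A 1 N) (map ((*) s) xs) (weigh r e)) =
        (\<lambda>w. r ^ r0 * core_vector (map ((*) s) xs) w)"
      unfolding e core_vector_def by (simp only: lin_scale[OF lin_fold[OF lin_hs]])
    ultimately show ?thesis by (simp add: fun_eq_iff weigh_def mult.commute)
  qed
  moreover have "core_vector xs z * core_denom \<epsilon> (map ((*) s) xs) = core_vector (map ((*) s) xs) z * core_denom \<epsilon> xs"
    using X_scale[of z xs "[]" s] assms s by simp
  moreover have "core_denom \<epsilon> (map ((*) s) xs) = r ^ ?d * core_denom \<epsilon> xs"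
    unfolding r(2) vand_scale assms(3) by simp
  moreover have v: "0 < core_denom \<epsilon> xs" using assms(5) by (rule vand_pos)
  ultimately have "core_vector xs z * (r ^ ?d * core_denom \<epsilon> xs) * r ^ r0 = r ^ rank2 z * core_vector xs z * core_denom \<epsilon> xs"
    by (intro cross_mult')
  then have "core_vector xs z * (r ^ (r0 + ?d) - r ^ rank2 z) = 0"
    using v by (simp add: power_add algebra_simps)
  moreover have "r ^ (r0 + ?d) < r ^ rank2 z"
    using rank2_wd[OF assms(1,2)] r(1) by (intro power_strict_increasing) auto
  ultimately show ?thesis by simp
qed

text \<open>\<open>B (Suc k) N\<close> in the variables \<open>xs\<close> restores the product from
  \<open>core_vector xs\<close>, and at weakly dominant points that vector is a multiple of
  \<open>delta g\<close>.\<close>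

lemma A_wd:
  assumes "wd k z" "length xs = k" "distinct xs" "\<And>x. x \<in> set xs \<Longrightarrow> 0 < x"
  shows "fold (A (Suc k) N) vs (fold (A 1 N) xs e) z =
    core_vector xs g * fold (A (Suc k) N) vs (fold (B (Suc k) N) xs (delta g)) z"
proof -
  have "fold (B (Suc k) N) xs (core_vector xs) = fold (A 1 N) xs e"
  proof -
    show ?thesis unfolding core_vector_def by (rule fold_A_uminus)
  qed
  then have "fold (A (Suc k) N) vs (fold (A 1 N) xs e) z = fold (A (Suc k) N) vs (fold (B (Suc k) N) xs (core_vector xs)) z"
    by simp
  also have "\<dots> = fold (A (Suc k) N) vs (fold (B (Suc k) N) xs (\<lambda>z. core_vector xs g * delta g z)) z"
    using X_eq_0[OF _ _ assms(2-4)]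
    by (intro fold_A_local[OF fold_A_local(2)] assms(1)) (auto simp: delta_def)
  also have "\<dots> = core_vector xs g * fold (A (Suc k) N) vs (fold (B (Suc k) N) xs (delta g)) z"
    by (simp only: lin_scale[OF lin_fold[OF lin_hs]])
  finally show ?thesis .
qed

end

section \<open>The base vectors of the two cases\<close>

lemma prod_transp_simps [simp]: "prod_transp [] = id" "prod_transp ((a, b) # ps) = transpose a b \<circ> prod_transp ps"
  by (simp_all add: prod_transp_def)

lemma prod_transp_other: "p \<notin> fst ` set ps \<Longrightarrow> p \<notin> snd ` set ps \<Longrightarrow> prod_transp ps p = p"
proof (induction ps)
  case (Cons ab ps)
  then show ?case by (cases ab) simp
qed simp

lemma prod_transp_pair:
  assumes "distinct (map fst ps @ map snd ps)" "(a, b) \<in> set ps"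
  shows "prod_transp ps a = b \<and> prod_transp ps b = a"
  using assms
proof (induction ps)
  case (Cons cd ps)
  obtain c d where cd: "cd = (c, d)" by (cases cd)
  show ?case
  proof (cases "(a, b) = (c, d)")
    case True
    then have "prod_transp ps a = a" "prod_transp ps b = b"
      using Cons.prems(1) cd by (auto intro!: prod_transp_other)
    then show ?thesis using True cd by simp
  next
    case False
    then have m: "(a, b) \<in> set ps" using Cons.prems(2) cd by auto
    then have "prod_transp ps a = b \<and> prod_transp ps b = a" using Cons by auto
    moreover have "a \<noteq> c" "a \<noteq> d" "b \<noteq> c" "b \<noteq> d"
      using m Cons.prems(1) cd by (auto simp: image_iff)
    ultimately show ?thesis using cd by simp
  qed
qed simp

lemma g_invol_apply: "g_invol k p = (if 1 \<le> p \<and> p \<le> k then k + p else if k < p \<and> p \<le> 2 * k then p - k else p)"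
proof -
  let ?ps = "map (\<lambda>i. (i, k + i)) [1..<k + 1]"
  have d: "distinct (map fst ?ps @ map snd ?ps)"
    by (auto simp: comp_def distinct_map inj_on_def simp del: upt_Suc)
  consider "1 \<le> p" "p \<le> k" | "k < p" "p \<le> 2 * k" | "p = 0 \<or> 2 * k < p" by linarith
  then show ?thesis
  proof cases
    case 1
    then have "(p, k + p) \<in> set ?ps" by auto
    then show ?thesis using prod_transp_pair[OF d] 1 unfolding g_invol_def by simp
  next
    case 2
    then have "(p - k, p) \<in> set ?ps" by force
    then show ?thesis using prod_transp_pair[OF d] 2 unfolding g_invol_def by simp
  next
    case 3
    then have "g_invol k p = p" unfolding g_invol_def by (intro prod_transp_other) auto
    then show ?thesis using 3 by auto
  qed
qed

lemma v_invol_apply: "v_invol m p = (if p = 0 \<or> 2 * m < p then p else if odd p then Suc p else p - 1)"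
proof -
  let ?ps = "map (\<lambda>i. (2 * i - 1, 2 * i)) [1..<m + 1]"
  have "2 * i - 1 \<noteq> 2 * j" if "1 \<le> i" for i j :: nat using that by presburger
  then have d: "distinct (map fst ?ps @ map snd ?ps)"
    by (force simp: comp_def distinct_map inj_on_def simp del: upt_Suc)
  consider "p = 0 \<or> 2 * m < p" | "odd p" "p \<le> 2 * m" | "even p" "p \<noteq> 0" "p \<le> 2 * m" by linarith
  then show ?thesis
  proof cases
    case 1
    then have "v_invol m p = p" unfolding v_invol_def by (intro prod_transp_other) auto
    then show ?thesis using 1 by auto
  next
    case 2
    then obtain j where j: "p = 2 * j + 1" by (elim oddE)
    then have "(p, Suc p) \<in> set ?ps" using 2 by (auto simp: image_iff intro!: bexI[of _ "Suc j"] simp del: upt_Suc)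
    then show ?thesis using prod_transp_pair[OF d] 2 unfolding v_invol_def by auto
  next
    case 3
    then obtain j where j: "p = 2 * j" by (elim evenE)
    then have "(p - 1, p) \<in> set ?ps" using 3 by auto
    then show ?thesis using prod_transp_pair[OF d] 3 unfolding v_invol_def by auto
  qed
qed

lemma InvolI: "(\<And>p. z (z p) = p) \<Longrightarrow> z 0 = 0 \<Longrightarrow> (\<And>p. n < p \<Longrightarrow> z p = p) \<Longrightarrow> z \<in> Invol"
proof -
  assume a: "\<And>p. z (z p) = p" "z 0 = 0" "\<And>p. n < p \<Longrightarrow> z p = p"
  have "{i. z i \<noteq> i} \<subseteq> {..n}" using a(3) by (auto simp: not_less[symmetric])
  then show "z \<in> Invol" using a(1,2) finite_subset by (auto simp: Invol_iff)
qed

lemma g_invol_Invol: "g_invol k \<in> Invol"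
  by (rule InvolI[of _ "2 * k"]) (auto simp: g_invol_apply)

lemma v_invol_Invol: "v_invol k \<in> Invol"
proof (rule InvolI[of _ "2 * k"])
  fix p
  show "v_invol k (v_invol k p) = p"
  proof (cases "p = 0 \<or> 2 * k < p")
    case False
    show ?thesis
    proof (cases "odd p")
      case True
      then have "Suc p \<le> 2 * k" using False by presburger
      then show ?thesis using False True by (simp add: v_invol_apply)
    next
      case ev: False
      then have "odd (p - 1)" "p - 1 \<noteq> 0" using False by presburger+
      then show ?thesis using False ev by (auto simp: v_invol_apply)
    qed
  qed (simp add: v_invol_apply)
qed (auto simp: v_invol_apply)

section \<open>Weakly dominant involutions: the least one, the rank and the number of cycles\<close>

lemma wd_g_invol: "wd k (g_invol k)"
  by (auto simp: wd_def g_invol_Invol g_invol_apply)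

lemma wd_small: "wd k z \<Longrightarrow> k < p \<Longrightarrow> z p \<le> k \<Longrightarrow> 1 \<le> z p"
  by (metis Invol_pos One_nat_def Suc_leI less_nat_zero_code neq0_conv wd_def)

lemma wd_eq_g_invol:
  assumes "wd k z" "\<And>i. 1 \<le> i \<Longrightarrow> i \<le> k \<Longrightarrow> z i = k + i"
  shows "z = g_invol k"
proof
  fix p
  have z: "z \<in> Invol" using assms(1) by (simp add: wd_def)
  consider "p = 0" | "1 \<le> p" "p \<le> k" | "k < p" "p \<le> 2 * k" | "2 * k < p" by linarith
  then show "z p = g_invol k p"
  proof cases
    case 1
    then show ?thesis using z by (simp add: Invol_iff g_invol_apply)
  next
    case 2
    then show ?thesis using assms(2) by (simp add: g_invol_apply)
  next
    case 3
    then have "z (p - k) = p" using assms(2)[of "p - k"] by simp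
    then have "z p = p - k" using Invol_invol[OF z] by metis
    then show ?thesis using 3 by (simp add: g_invol_apply)
  next
    case 4
    have "z p = p"
    proof (rule ccontr)
      assume "z p \<noteq> p"
      moreover have "k < p" using 4 by simp
      ultimately have "z p \<le> k" using assms(1) unfolding wd_def by blast
      moreover have "1 \<le> z p" using wd_small[OF assms(1)] 4 calculation by simp
      ultimately have "z (z p) = k + z p" by (intro assms(2))
      then show False using Invol_invol[OF z, of p] \<open>z p \<le> k\<close> 4 by simp
    qed
    then show ?thesis using 4 by (simp add: g_invol_apply)
  qed
qed

text \<open>Since \<open>z\<close> increases above \<open>k\<close>, the partners of
  \<open>1, 2, ..., k\<close> must be \<open>k + 1, k + 2, ...\<close> in this order; this is proved
  by induction on \<open>i\<close>.\<close>

lemma wd_no_descent: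
  assumes "wd k z" "\<And>i. k < i \<Longrightarrow> z i < z (Suc i)"
  shows "z = g_invol k"
proof (rule wd_eq_g_invol[OF assms(1)])
  have z: "z \<in> Invol" using assms(1) by (simp add: wd_def)
  have mono: "z p < z q" if "k < p" "p < q" for p q
    using that(2)
  proof (induction q rule: less_induct)
    case (less q)
    obtain q' where q: "q = Suc q'" using less.prems by (cases q) auto
    then show ?case
      using less.IH[of q'] assms(2)[of q'] that(1) less.prems by (cases "p = q'") auto
  qed
  fix i assume "1 \<le> i" "i \<le> k"
  then show "z i = k + i"
  proof (induction i rule: less_induct)
    case (less i)
    have zi: "k < z i" using less.prems assms(1) by (simp add: wd_def)
    have "\<not> k + i < z i"
    proof
      \<comment> \<open>By monotonicity the partner of \<open>k + i\<close> would be some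
        \<open>j < i\<close>, whereas the partner of \<open>j\<close> is \<open>k + j\<close> by
        induction.\<close>
      assume l: "k + i < z i"
      then have lt: "z (k + i) < i" using mono[of "k + i" "z i"] Invol_invol[OF z] less.prems by simp
      then have "1 \<le> z (k + i)" using wd_small[OF assms(1), of "k + i"] less.prems by simp
      then have "z (z (k + i)) = k + z (k + i)" using less.IH lt less.prems by simp
      then show False using Invol_invol[OF z] lt by simp
    qed
    moreover have "\<not> z i < k + i"
    proof
      assume l: "z i < k + i"
      define j where "j = z i - k"
      have j: "1 \<le> j" "j < i" "z i = k + j" using l zi by (auto simp: j_def)
      then have "z j = z i" using less by simp
      then show False using Invol_eq_iff[OF z] j(2) by simp
    qed
    ultimately show ?case by simp
  qed
qed

text \<open>The pairs \<open>(i, z j)\<close> with \<open>i\<close> and \<open>j\<close> at most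
  \<open>k\<close> are \<open>k * k\<close> inversions, and \<open>1, ..., k\<close> are
  exceedances. If \<open>z\<close> is not \<open>g_invol k\<close>, a descent above \<open>k\<close>
  provides one more inversion.\<close>

lemma wd_rank2:
  assumes "wd k z"
  shows "k * k + k \<le> rank2 z" "z \<noteq> g_invol k \<Longrightarrow> k * k + k < rank2 z"
proof -
  have z: "z \<in> Invol" using assms by (simp add: wd_def)
  note fin = finite_invs[OF Invol_bij(2)[OF z] Invol_bij(4)[OF z]]
  define Q where "Q = (\<lambda>(i, j). (i, z j)) ` ({1..k} \<times> {1..k})"
  have "inj_on (\<lambda>(i, j). (i, z j)) ({1..k} \<times> {1..k})" using Invol_eq_iff[OF z] by (auto simp: inj_on_def)
  then have cQ: "card Q = k * k" by (simp add: Q_def card_image card_cartesian_product)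
  have Q: "Q \<subseteq> invs z"
    using assms Invol_invol[OF z] by (fastforce simp: Q_def invs_def wd_def)
  have "finite {i. i < z i}" by (rule finite_subset[OF _ Invol_bij(4)[OF z]]) auto
  moreover have "{1..k} \<subseteq> {i. i < z i}" using assms by (fastforce simp: wd_def)
  ultimately have "card {1..k} \<le> card {i. i < z i}" by (rule card_mono)
  then have ex: "k \<le> card {i. i < z i}" by simp
  show "k * k + k \<le> rank2 z" using card_mono[OF fin Q] ex cQ by (simp add: rank2_def)
  assume "z \<noteq> g_invol k"
  then obtain i where i: "k < i" "\<not> z i < z (Suc i)" using wd_no_descent[OF assms] by blast
  then have "z (Suc i) < z i" using Invol_eq_iff[OF z, of i "Suc i"] by linarith
  then have "insert (i, Suc i) Q \<subseteq> invs z" using Q by (simp add: invs_def)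
  moreover have "(i, Suc i) \<notin> Q" "finite Q" using i by (auto simp: Q_def)
  ultimately show "k * k + k < rank2 z"
    using card_mono[OF fin, of "insert (i, Suc i) Q"] ex cQ by (simp add: rank2_def)
qed

lemma kappa_wd:
  assumes "wd k z"
  shows "kappa z = k"
proof -
  have z: "z \<in> Invol" using assms by (simp add: wd_def)
  have "{{i, j} | i j. i \<noteq> j \<and> z i = j \<and> z j = i} = (\<lambda>i. {i, z i}) ` {1..k}"
  proof (intro equalityI subsetI)
    fix s assume "s \<in> {{i, j} | i j. i \<noteq> j \<and> z i = j \<and> z j = i}"
    then obtain i j where s: "s = {i, j}" "i \<noteq> j" "z i = j" "z j = i" by auto
    have pos: "1 \<le> i" "1 \<le> j" using s z by (metis Invol_iff One_nat_def Suc_leI neq0_conv)+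
    show "s \<in> (\<lambda>i. {i, z i}) ` {1..k}"
    proof (cases "i \<le> k")
      case True
      then show ?thesis using s pos by auto
    next
      case False
      then have "j \<le> k" using assms s by (metis not_le wd_def)
      then show ?thesis using s pos by (auto intro!: image_eqI[of _ _ j])
    qed
  next
    fix s assume "s \<in> (\<lambda>i. {i, z i}) ` {1..k}"
    then obtain i where i: "1 \<le> i" "i \<le> k" "s = {i, z i}" by auto
    then have "i \<noteq> z i" using assms by (fastforce simp: wd_def)
    then show "s \<in> {{i, j} | i j. i \<noteq> j \<and> z i = j \<and> z j = i}"
      using i Invol_invol[OF z] by blast
  qed
  moreover have "inj_on (\<lambda>i. {i, z i}) {1..k}"
    using assms by (fastforce simp: inj_on_def doubleton_eq_iff wd_def)
  ultimately show ?thesis by (simp add: kappa_def card_image)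
qed

lemma weakly_dominant_wd:
  assumes "y \<in> Invol" "weakly_dominant y"
  shows "wd (kappa y) y"
proof -
  obtain bs where bs: "distinct bs" "\<And>b. b \<in> set bs \<Longrightarrow> length bs < b"
      "y = prod_transp (zip [1..<length bs + 1] bs)"
    using assms(2) unfolding weakly_dominant_def by auto
  let ?k = "length bs" and ?ps = "zip [1..<length bs + 1] bs"
  have mf: "map fst ?ps = [1..<?k + 1]" "map snd ?ps = bs" by (simp_all del: upt_Suc)
  then have st: "fst ` set ?ps = {1..?k}" "snd ` set ?ps = set bs"
    by (metis atLeastLessThanSuc_atLeastAtMost Suc_eq_plus1 set_map set_upt, metis set_map)
  have d: "distinct (map fst ?ps @ map snd ?ps)"
    unfolding mf using bs(1,2) by (fastforce simp del: upt_Suc)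
  have "wd ?k y" unfolding wd_def
  proof (intro conjI allI impI)
    fix i assume "1 \<le> i" "i \<le> ?k"
    then have "i \<in> fst ` set ?ps" using st(1) by simp
    then obtain b where ib: "(i, b) \<in> set ?ps" by auto
    then have "y i = b" using prod_transp_pair[OF d] bs(3) by simp
    moreover have "b \<in> set bs" using ib st(2) by force
    ultimately show "?k < y i" using bs(2) by simp
  next
    fix i assume i: "?k < i"
    show "y i \<le> ?k \<or> y i = i"
    proof (cases "i \<in> snd ` set ?ps")
      case True
      then obtain a where ai: "(a, i) \<in> set ?ps" by auto
      then have "y i = a" using prod_transp_pair[OF d] bs(3) by simp
      moreover have "a \<in> {1..?k}" using ai st(1) by force
      ultimately show ?thesis by simp
    next
      case False
      then show ?thesis using prod_transp_other[of i ?ps] st(1) i bs(3) by simp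
    qed
  qed (rule assms(1))
  then show ?thesis using kappa_wd by metis
qed

section \<open>The base vector of the identity\<close>

lemma rank2_id [simp]: "rank2 id = 0"
proof -
  have "invs id = {}" by (auto simp: invs_def)
  then show ?thesis by (simp add: rank2_def)
qed

text \<open>\<open>U i\<close> is defined by looking down from \<open>z\<close>; on basis vectors it
  is the raising operator.\<close>

lemma U_delta:
  assumes "w \<in> Invol" "1 \<le> i" "w i < w (Suc i)"
  shows "U i (delta w) = delta (rtimes w i)"
proof
  fix z
  show "U i (delta w) z = delta (rtimes w i) z"
    using assms rtimes_rtimes rtimes_at'[OF assms(1,3)] rtimes_Invol[OF assms(1,2)]
    by (auto simp: U_def delta_def)
qed

lemma U_delta_desc: "w (Suc i) < w i \<Longrightarrow> U i (delta w) = (\<lambda>z. 0)"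
  by (rule ext) (auto simp: U_def delta_def dest: rtimes_at)

lemma delta_nonzero: "delta w z \<noteq> 0 \<longleftrightarrow> z = w"
  by (simp add: delta_def)

lemma rtimes_id: "rtimes id i = simple_transp i"
  by (subst rtimes_commuting) auto

lemma simple_transp_Invol: "1 \<le> i \<Longrightarrow> simple_transp i \<in> Invol"
  using rtimes_Invol[of id i] by (simp add: rtimes_id)

text \<open>The letters \<open>i, i + 1\<close> and \<open>i + 1, i\<close> lead from the identity
  to the same involution by the braid relation, so \<open>h i x\<close> and
  \<open>h (Suc i) x\<close> commute on \<open>delta id\<close>. The larger letters commute with
  \<open>i\<close>, and induction reverses the product.\<close>

lemma A_delta_id: "1 \<le> i \<Longrightarrow> A i N x (delta id) = B i N x (delta id)"
proof (induction "N - i" arbitrary: i)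
  case (Suc d)
  then have iN: "i < N" and d: "d = N - Suc i" by simp_all
  have IH: "A (Suc i) N x (delta id) = B (Suc i) N x (delta id)" using Suc.hyps(1)[OF d] Suc.prems by simp
  show ?case
  proof (cases "Suc i < N")
    case False
    then have "N = Suc i" using iN by simp
    then show ?thesis by simp
  next
    case True
    let ?s = "simple_transp i" and ?t = "simple_transp (Suc i)"
    have "rtimes ?t i = ?s \<circ> ?t \<circ> ?s" "rtimes ?s (Suc i) = ?t \<circ> ?s \<circ> ?t"
      using Suc.prems by (subst rtimes_conj; simp add: simple_transp_Invol)+
    then have r: "rtimes (rtimes id (Suc i)) i = rtimes (rtimes id i) (Suc i)"
      unfolding rtimes_id using simple_transp_braid by simp
    have "U i (U (Suc i) (delta id)) = delta (rtimes (rtimes id (Suc i)) i)"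
      using Suc.prems by (simp add: U_delta rtimes_id simple_transp_Invol)
    moreover have "U (Suc i) (U i (delta id)) = delta (rtimes (rtimes id i) (Suc i))"
      using Suc.prems by (simp add: U_delta rtimes_id simple_transp_Invol)
    ultimately have "U i (U (Suc i) (delta id)) = U (Suc i) (U i (delta id))" using r by simp
    then have hh: "h i x (h (Suc i) x (delta id)) = h (Suc i) x (h i x (delta id))"
      by (intro ext) (simp add: h_h_expand)
    have "A i N x (delta id) = h i x (B (Suc (Suc i)) N x (h (Suc i) x (delta id)))"
      using A_rec[OF iN] IH B_rec[OF True] by metis
    also have "\<dots> = B (Suc (Suc i)) N x (h i x (h (Suc i) x (delta id)))"
      by (rule h_hs_commute) auto
    also have "\<dots> = B i N x (delta id)"
      unfolding hh using B_rec[OF iN] B_rec[OF True] by metis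
    finally show ?thesis .
  qed
qed simp

lemma base_id:
  assumes "k < N \<or> k = 0"
  shows "base_vector N k 1 0 (delta id) (g_invol k)"
proof
  show "k < N \<or> k = 0" by (rule assms)
  show "A 1 N x (delta id) = B 1 N x (delta id)" for x by (rule A_delta_id) simp
  show "crossing a z \<le> 1 - 1" if "delta id z \<noteq> 0" for z a
    using that by (simp add: delta_nonzero crossing_def)
  show "rank2 z = 0" if "delta id z \<noteq> 0" for z using that by (simp add: delta_nonzero)
  \<comment> \<open>The left side is \<open>k * k + k\<close>, the bound of
    \<open>wd_rank2\<close>.\<close>
  show "0 + k * (k - 1) + 2 * k * 1 < rank2 z" if "wd k z" "z \<noteq> g_invol k" for z
    using wd_rank2(2)[OF that] by (cases k) auto
  fix z vs ys assume "wd k z" "1 \<le> k"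
  have "poly_family (0 + length [1..<Suc k]) (\<lambda>t. fold (A (Suc k) N) vs (B 1 (Suc k) t (fold (A 1 N) ys (delta id))))"
    by (intro polyn_fold polyn_hs polyn_hs_var polyn_const)
  moreover have "0 + length [1..<Suc k] = k - 1 + 1" using \<open>1 \<le> k\<close> by simp
  ultimately show "\<exists>p. degree p \<le> k - 1 + 1 \<and>
      (\<forall>t. fold (A (Suc k) N) vs (B 1 (Suc k) t (fold (A 1 N) ys (delta id))) z = poly p t)"
    unfolding poly_family_def by metis
qed simp

section \<open>The base vector of \<open>v_invol k\<close>\<close>

lemma v_invol_odd: "odd p \<Longrightarrow> p < 2 * m \<Longrightarrow> v_invol m p = Suc p \<and> v_invol m (Suc p) = p"
  by (cases "p = 0") (auto simp: v_invol_apply)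

lemma rank2_v_invol: "rank2 (v_invol m) = 2 * m"
proof (induction m)
  case 0
  have "v_invol 0 = id" by (simp add: v_invol_def)
  then show ?case by (metis rank2_id mult_0_right)
next
  case (Suc m)
  let ?i = "2 * m + 1"
  have f: "v_invol m ?i = ?i" "v_invol m (Suc ?i) = Suc ?i" by (simp_all add: v_invol_apply)
  have "rtimes (v_invol m) ?i = v_invol m \<circ> simple_transp ?i"
    using f by (intro rtimes_commuting v_invol_Invol) auto
  also have "\<dots> = v_invol (Suc m)"
  proof
    fix p
    show "(v_invol m \<circ> simple_transp ?i) p = v_invol (Suc m) p"
      by (cases "p = ?i"; cases "p = Suc ?i") (auto simp: v_invol_apply)
  qed
  finally have "v_invol (Suc m) = rtimes (v_invol m) ?i" by simp
  then show ?case using rank2_rtimes_asc[OF v_invol_Invol, of ?i m] f Suc by simp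
qed

text \<open>Induction in steps of two. The factors with letters \<open>i\<close> and
  \<open>i + 2\<close> act trivially on \<open>delta (v_invol k)\<close>, because \<open>i\<close>
  and \<open>i + 2\<close> are descents. After the letter \<open>i + 1\<close> both letters lead to
  the same involution, so the last factor \<open>h i x\<close> may be replaced by
  \<open>h (i + 2) x\<close>.\<close>

lemma A_delta_v: "odd i \<Longrightarrow> A i (2 * k) x (delta (v_invol k)) = B i (2 * k) x (delta (v_invol k))"
proof (induction "2 * k - i" arbitrary: i rule: less_induct)
  case less
  let ?v = "v_invol k"
  let ?N = "2 * k"
  consider "?N \<le> i" | "Suc i = ?N" | "Suc (Suc i) < ?N" using less.prems by (metis even_Suc even_mult_iff dvd_refl linorder_cases not_less_eq not_less_less_Suc_eq less_or_eq_imp_le Suc_lessI)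
  then show ?case
  proof cases
    case 1
    then show ?thesis by simp
  next
    case 2
    then show ?thesis by (simp flip: 2)
  next
    case 3
    let ?j = "Suc i" and ?l = "Suc (Suc i)"
    have i1: "1 \<le> i" using less.prems by presburger
    have ol: "odd ?l" using less.prems by simp
    have l1: "i < ?N" "?j < ?N" "?l < ?N" using 3 by auto
    have vi: "?v i = ?j" "?v ?j = i" "?v ?l = Suc ?l" "?v (Suc ?l) = ?l"
      using v_invol_odd[OF less.prems l1(1)] v_invol_odd[OF ol l1(3)] by auto
    have h0: "h i x (delta ?v) = delta ?v" "h ?l x (delta ?v) = delta ?v"
      using U_delta_desc[of ?v i] U_delta_desc[of ?v ?l] vi by (simp_all add: h_def)
    have IH: "A ?l ?N x (delta ?v) = B ?l ?N x (delta ?v)" using less.hyps[of ?l] ol 3 by simp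
    let ?w = "rtimes ?v ?j"
    have w: "?w = simple_transp ?j \<circ> ?v \<circ> simple_transp ?j"
      using vi by (intro rtimes_conj v_invol_Invol) auto
    have wI: "?w \<in> Invol" by (intro rtimes_Invol v_invol_Invol) simp
    have wv: "?w i = ?l" "?w ?j = Suc ?l" "?w ?l = i" "?w (Suc ?l) = ?j"
      unfolding w using vi by simp_all
    have c1: "rtimes ?w i = simple_transp i \<circ> ?w \<circ> simple_transp i"
      using wv by (intro rtimes_conj wI) auto
    have c2: "rtimes ?w ?l = simple_transp ?l \<circ> ?w \<circ> simple_transp ?l"
      using wv by (intro rtimes_conj wI) auto
    have "rtimes ?w i = rtimes ?w ?l" unfolding c1 c2
    proof
      fix p
      have "?w p \<noteq> i" "?w p \<noteq> ?j" "?w p \<noteq> ?l" "?w p \<noteq> Suc ?l" if "p \<notin> {i, ?j, ?l, Suc ?l}"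
        using that wv Invol_invol[OF wI] by (metis insertCI)+
      then show "(simple_transp i \<circ> ?w \<circ> simple_transp i) p = (simple_transp ?l \<circ> ?w \<circ> simple_transp ?l) p"
        using wv by (cases "p \<in> {i, ?j, ?l, Suc ?l}") auto
    qed
    moreover have Uj: "U ?j (delta ?v) = delta ?w" using vi by (intro U_delta v_invol_Invol) auto
    moreover have "U i (delta ?w) = delta (rtimes ?w i)" "U ?l (delta ?w) = delta (rtimes ?w ?l)"
      using wv i1 by (auto intro!: U_delta wI)
    ultimately have UU: "U i (U ?j (delta ?v)) = U ?l (U ?j (delta ?v))" by simp
    have hh: "h i x (h ?j x (delta ?v)) = h ?l x (h ?j x (delta ?v))"
      using U_delta_desc[of ?v i] U_delta_desc[of ?v ?l] vi UU by (intro ext) (simp add: h_h_expand)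
    have "B ?l ?N x (delta ?v) = B (Suc ?l) ?N x (delta ?v)" using B_rec[OF l1(3)] h0 by metis
    then have "A i ?N x (delta ?v) = h i x (h ?j x (B (Suc ?l) ?N x (delta ?v)))"
      using A_rec[OF l1(1)] A_rec[OF l1(2)] IH by metis
    also have "h ?j x (B (Suc ?l) ?N x (delta ?v)) = B (Suc ?l) ?N x (h ?j x (delta ?v))"
      by (rule h_hs_commute) auto
    also have "h i x \<dots> = B (Suc ?l) ?N x (h i x (h ?j x (delta ?v)))"
      by (rule h_hs_commute) auto
    also have "\<dots> = B i ?N x (delta ?v)"
      unfolding hh using B_rec[OF l1(1)] B_rec[OF l1(2)] B_rec[OF l1(3)] h0 by metis
    finally show ?thesis .
  qed
qed

text \<open>The term of highest degree takes \<open>t * U i\<close> from every factor. Separating it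
  lowers the degree bound by one wherever that term is known to vanish.\<close>

lemma hs_top_coefficient:
  "ls \<noteq> [] \<Longrightarrow> poly_family (length ls - 1) (\<lambda>t z. hs ls t f z - t ^ length ls * fold U ls f z)"
proof (induction ls rule: rev_nonempty_induct)
  case (single i)
  have "poly_family 0 (\<lambda>t. f)" by (rule polyn_const)
  then show ?case by (simp add: h_def)
next
  case (snoc i ls)
  let ?n = "length ls" and ?W = "fold U ls f"
  define G where "G t z = hs ls t f z - t ^ ?n * ?W z" for t z
  have G: "poly_family (?n - 1) G" using snoc.IH by (simp add: G_def[abs_def])
  have n: "Suc (?n - 1) = ?n" using snoc.hyps by simp
  have F: "hs ls t f = (\<lambda>z. G t z + t ^ ?n * ?W z)" for t by (simp add: G_def)
  have m: "poly_family ?n (\<lambda>t z. t ^ ?n * ?W z)"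
    unfolding poly_family_def
  proof
    fix z show "\<exists>p. degree p \<le> ?n \<and> (\<forall>t. t ^ ?n * ?W z = poly p t)"
      by (intro exI[of _ "monom (?W z) ?n"]) (simp add: degree_monom_le poly_monom mult.commute)
  qed
  have "poly_family ?n (\<lambda>t z. (G t z + 1 * (t * U i (G t) z)) + 1 * (t ^ ?n * ?W z))"
    using G polyn_times_var[OF polyn_U[OF G]] m unfolding n
    by (intro polyn_add_mult) (auto intro: polyn_mono)
  moreover have "hs (ls @ [i]) t f z - t ^ length (ls @ [i]) * fold U (ls @ [i]) f z =
      (G t z + 1 * (t * U i (G t) z)) + 1 * (t ^ ?n * ?W z)" for t z
    unfolding hs_simps F by (simp add: h_def U_linear algebra_simps)
  ultimately show ?case by simp
qed

definition fpf :: "nat \<Rightarrow> (nat \<Rightarrow> nat) \<Rightarrow> bool" where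
  "fpf m z \<longleftrightarrow> (\<forall>p. 1 \<le> p \<longrightarrow> p \<le> m \<longrightarrow> z p \<noteq> p)"

text \<open>If \<open>z\<close> joins \<open>i\<close> and \<open>i + 1\<close>, the lower
  involution would fix \<open>i\<close>. Otherwise lowering is conjugation by
  \<open>simple_transp i\<close>, which maps \<open>{1..m}\<close> to itself because
  \<open>i < m\<close>.\<close>

lemma fpf_lower:
  assumes "z \<in> Invol" "1 \<le> i" "i < m" "z (Suc i) < z i" "fpf m (rtimes z i)"
  shows "fpf m z"
proof (cases "z i = Suc i")
  case True
  then have "rtimes z i i = i" using assms(1,4) Invol_invol[OF assms(1), of i] by (simp add: rtimes_desc)
  then show ?thesis using assms by (simp add: fpf_def)
next
  case False
  then have e: "rtimes z i = simple_transp i \<circ> z \<circ> simple_transp i" using assms by (simp add: rtimes_desc)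
  show ?thesis unfolding fpf_def
  proof (intro allI impI notI)
    fix p assume p: "1 \<le> p" "p \<le> m" "z p = p"
    have "rtimes z i (simple_transp i p) = simple_transp i p" using p by (simp add: e)
    moreover have "1 \<le> simple_transp i p" "simple_transp i p \<le> m"
      using p assms(2,3) by (cases "p = i"; cases "p = Suc i"; simp)+
    ultimately show False using assms(5) by (simp add: fpf_def)
  qed
qed

lemma fpf_hs:
  assumes "\<And>z. f z \<noteq> 0 \<Longrightarrow> fpf m z" "\<And>i. i \<in> set ls \<Longrightarrow> i < m" "hs ls x f z \<noteq> 0"
  shows "fpf m z"
  using assms
proof (induction ls arbitrary: f)
  case (Cons i ls)
  have "fpf m z" if "h i x f z \<noteq> 0" for z
    using that
  proof (cases rule: h_nonzero_cases)
    case 2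
    then show ?thesis using fpf_lower Cons.prems(1,2) by auto
  qed (use Cons.prems in auto)
  then show ?case using Cons.IH[of "h i x f"] Cons.prems(2,3) by auto
qed simp

lemma fpf_fold_A:
  "(\<And>z. f z \<noteq> 0 \<Longrightarrow> fpf m z) \<Longrightarrow> fold (A 1 m) xs f z \<noteq> 0 \<Longrightarrow> fpf m z"
proof (induction xs arbitrary: f)
  case (Cons x xs)
  have "fpf m z" if "A 1 m x f z \<noteq> 0" for z
    using fpf_hs[OF Cons.prems(1) _ that] by simp
  then show ?case using Cons.IH[of "A 1 m x f"] Cons.prems(2) by simp
qed simp

text \<open>In a chain of ascents \<open>1, 2, \<dots>, j\<close> starting at a fixed-point-free involution, the point \<open>1\<close>
  is carried to \<open>j + 1\<close> and stays to the left of its partner.\<close>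

lemma fpf_U_chain:
  assumes "\<And>z. f z \<noteq> 0 \<Longrightarrow> 1 < z 1" "fold U [1..<Suc j] f z \<noteq> 0"
  shows "Suc j < z (Suc j)"
  using assms(2)
proof (induction j arbitrary: z)
  case 0
  then show ?case using assms(1) by simp
next
  case (Suc j)
  let ?i = "Suc j"
  have "U ?i (fold U [1..<?i] f) z \<noteq> 0" using Suc.prems by simp
  then have z: "z \<in> Invol" "z (Suc ?i) < z ?i" "fold U [1..<?i] f (rtimes z ?i) \<noteq> 0"
    by (auto simp: U_def split: if_splits)
  from Suc.IH[OF z(3)] have lt: "?i < rtimes z ?i ?i" .
  have "z ?i \<noteq> Suc ?i"
  proof
    assume "z ?i = Suc ?i"
    then have "rtimes z ?i ?i = ?i" using z Invol_invol[OF z(1), of ?i] by (simp add: rtimes_desc)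
    then show False using lt by simp
  qed
  then have "rtimes z ?i ?i = simple_transp ?i (z (Suc ?i))" using z by (simp add: rtimes_desc)
  moreover have "z (Suc ?i) \<noteq> ?i" using \<open>z ?i \<noteq> Suc ?i\<close> Invol_invol[OF z(1)] by metis
  moreover have "z (Suc ?i) \<noteq> Suc ?i" using lt calculation(1) by auto
  ultimately show ?case using lt by simp
qed

lemma base_v: "base_vector (2 * k) k 0 (2 * k) (delta (v_invol k)) (g_invol k)"
proof
  let ?v = "v_invol k"
  show "k < 2 * k \<or> k = 0" by auto
  show "A 1 (2 * k) x (delta ?v) = B 1 (2 * k) x (delta ?v)" for x by (rule A_delta_v) simp
  show "crossing a z \<le> 1 - 0" if "delta ?v z \<noteq> 0" for z a
  proof -
    have "{i. i \<le> a \<and> a < ?v i} \<subseteq> {a}" by (auto simp: v_invol_apply split: if_splits)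
    then have "crossing a ?v \<le> card {a}" unfolding crossing_def by (intro card_mono) auto
    then show ?thesis using that by (simp add: delta_nonzero)
  qed
  show "rank2 z = 2 * k" if "delta ?v z \<noteq> 0" for z using that by (simp add: delta_nonzero rank2_v_invol)
  show "2 * k + k * (k - 1) + 2 * k * 0 < rank2 z" if "wd k z" "z \<noteq> g_invol k" for z
    using wd_rank2(2)[OF that] by (cases k) auto
  fix z vs ys assume z: "wd k z" and k: "1 \<le> k"
  let ?F = "fold (A 1 (2 * k)) ys (delta ?v)" and ?T = "fold (A (Suc k) (2 * k)) vs"
  define W where "W = fold U [1..<Suc k] ?F"
  define G where "G t z = B 1 (Suc k) t ?F z - t ^ k * W z" for t z
  have len: "length [1..<Suc k] = k" by simp
  have G: "poly_family (k - 1) G"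
    using hs_top_coefficient[of "[1..<Suc k]" ?F] k unfolding len G_def[abs_def] W_def by (simp del: upt_Suc)
  have F: "B 1 (Suc k) t ?F = (\<lambda>z. G t z + t ^ k * W z)" for t by (simp add: G_def)
  \<comment> \<open>\<open>W\<close> is the coefficient of \<open>t ^ k\<close>. By
    \<open>fpf_U_chain\<close> its support consists of involutions in which \<open>k + 1\<close> is
    the left end of an arc, and weak dominance forbids such an arc. This lowers the degree from
    \<open>k\<close> to \<open>k - 1\<close>.\<close>
  have W0: "W w = 0" if "wd k w" for w
  proof (rule ccontr)
    assume "W w \<noteq> 0"
    have "fpf (2 * k) ?v" by (auto simp: fpf_def v_invol_apply)
    then have "1 < z 1" if "?F z \<noteq> 0" for z
    proof -
      have "fpf (2 * k) w" if "delta ?v w \<noteq> 0" for w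
        using that \<open>fpf (2 * k) ?v\<close> unfolding delta_nonzero by simp
      from fpf_fold_A[OF this that] have "fpf (2 * k) z" .
      then have "z 1 \<noteq> 1" using k by (simp add: fpf_def)
      moreover have "z 1 \<noteq> 0"
      proof -
        have "z \<in> Invol"
        proof (rule ccontr)
          assume "z \<notin> Invol"
          \<comment> \<open>Outside \<open>Invol\<close> every \<open>U i\<close> vanishes, so the
            value there remains that of \<open>delta\<close>, namely \<open>0\<close>.\<close>
          then have "hs ls x f z = f z" for ls x f by (induction ls arbitrary: f) (simp_all add: h_def U_def)
          then have "fold (A 1 (2 * k)) ys f z = f z" for f by (induction ys arbitrary: f) simp_all
          then show False using that \<open>z \<notin> Invol\<close> v_invol_Invol by (auto simp: delta_def split: if_splits)
        qed
        then show ?thesis using Invol_pos[of z 1] by simp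
      qed
      ultimately show ?thesis by linarith
    qed
    then have "Suc k < w (Suc k)" using fpf_U_chain \<open>W w \<noteq> 0\<close> unfolding W_def by blast
    moreover have "w (Suc k) \<le> k \<or> w (Suc k) = Suc k" using that by (simp add: wd_def)
    ultimately show False by auto
  qed
  have "?T W z = ?T (\<lambda>z. 0) z" by (rule fold_A_local[OF _ z]) (rule W0)
  then have TW: "?T W z = 0" by (simp only: fold_zero)
  have "?T (B 1 (Suc k) t ?F) z = ?T (G t) z" for t
    unfolding F linD[OF lin_fold[OF lin_hs]] TW by simp
  moreover have "poly_family (k - 1) (\<lambda>t. ?T (G t))" by (intro polyn_fold polyn_hs G)
  ultimately show "\<exists>p. degree p \<le> k - 1 + 0 \<and> (\<forall>t. ?T (B 1 (Suc k) t ?F) z = poly p t)"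
    unfolding poly_family_def by (metis add_0_right)
qed simp

section \<open>Words as chains in the weak order\<close>

lemma foldl_rtimes:
  assumes "e \<in> Invol" "\<forall>i\<in>set a. 1 \<le> i"
  shows "foldl rtimes e a \<in> Invol \<and> rank2 (foldl rtimes e a) \<le> rank2 e + 2 * length a"
  using assms(2)
proof (induction a rule: rev_induct)
  case (snoc i a)
  let ?w = "foldl rtimes e a"
  have w: "?w \<in> Invol" "rank2 ?w \<le> rank2 e + 2 * length a" and i: "1 \<le> i" using snoc by auto
  have "rank2 (rtimes ?w i) \<le> rank2 ?w + 2"
    using rank2_rtimes_asc[OF w(1) i] rank2_rtimes_desc[OF w(1) i] Invol_eq_iff[OF w(1), of i "Suc i"]
    by (cases "?w i" "?w (Suc i)" rule: linorder_cases) auto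
  then show ?case using w rtimes_Invol[OF w(1) i] by simp
qed (simp add: assms(1))

text \<open>The rank condition forces every letter to be an ascent: the words are the saturated
  chains from \<open>e\<close> to \<open>z\<close> in the involution weak order.\<close>

definition chain :: "(nat \<Rightarrow> nat) \<Rightarrow> nat list \<Rightarrow> (nat \<Rightarrow> nat) \<Rightarrow> bool" where
  "chain e a z \<longleftrightarrow> (\<forall>i\<in>set a. 1 \<le> i) \<and> foldl rtimes e a = z \<and> rank2 z = rank2 e + 2 * length a"

lemma chain_Nil: "chain e [] z \<longleftrightarrow> z = e"
  by (auto simp: chain_def)

lemma chain_Invol: "e \<in> Invol \<Longrightarrow> chain e a z \<Longrightarrow> z \<in> Invol"
  using foldl_rtimes by (auto simp: chain_def)

text \<open>A letter raises \<open>rank2\<close> by at most 2, so the total required by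
  \<open>chain\<close> leaves no room for a last letter that is a descent.\<close>

lemma chain_snoc:
  assumes "e \<in> Invol"
  shows "chain e (a @ [i]) z \<longleftrightarrow> z \<in> Invol \<and> 1 \<le> i \<and> z (Suc i) < z i \<and> chain e a (rtimes z i)"
proof
  assume c: "chain e (a @ [i]) z"
  let ?w = "foldl rtimes e a"
  have i: "1 \<le> i" and z: "rtimes ?w i = z" and a: "\<forall>i\<in>set a. 1 \<le> i" using c by (auto simp: chain_def)
  have w: "?w \<in> Invol" "rank2 ?w \<le> rank2 e + 2 * length a" using foldl_rtimes[OF assms a] by auto
  have zI: "z \<in> Invol" using chain_Invol[OF assms c] .
  have "\<not> ?w (Suc i) < ?w i"
    using rank2_rtimes_desc[OF w(1) i] z w(2) c by (auto simp: chain_def)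
  then have asc: "?w i < ?w (Suc i)" using Invol_eq_iff[OF w(1), of i "Suc i"] by linarith
  have "rank2 z = rank2 ?w + 2" using rank2_rtimes_asc[OF w(1) i asc] z by simp
  moreover have "z (Suc i) < z i" using rtimes_at'[OF w(1) asc] z by simp
  moreover have "rtimes z i = ?w" using rtimes_rtimes[OF w(1) i] z by simp
  ultimately show "z \<in> Invol \<and> 1 \<le> i \<and> z (Suc i) < z i \<and> chain e a (rtimes z i)"
    using zI i a c by (auto simp: chain_def)
next
  assume r: "z \<in> Invol \<and> 1 \<le> i \<and> z (Suc i) < z i \<and> chain e a (rtimes z i)"
  then have "rtimes (rtimes z i) i = z" "rank2 z = rank2 (rtimes z i) + 2"
    using rtimes_rtimes rank2_rtimes_desc by blast+
  then show "chain e (a @ [i]) z" using r by (auto simp: chain_def)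
qed

lemma increasing_perm_id:
  assumes "bij z" "z 0 = 0" "\<And>i. 1 \<le> i \<Longrightarrow> z i < z (Suc i)"
  shows "z = id"
proof
  fix p
  have step: "z i < z (Suc i)" for i
  proof (cases "i = 0")
    case True
    have "z (Suc 0) \<noteq> z 0" using assms(1) by (simp add: bij_is_inj inj_eq)
    then show ?thesis using True assms(2) by simp
  qed (use assms(3) in simp)
  have mono: "i < j \<Longrightarrow> z i < z j" for i j using step by (rule lift_Suc_mono_less)
  have ge: "p \<le> z p" for p
  proof (induction p)
    case (Suc p)
    then show ?case using step[of p] by simp
  qed simp
  show "z p = id p"
  proof (induction p rule: less_induct)
    case (less p)
    obtain q where q: "z q = p" using assms(1) by (metis bij_pointE)
    show ?case
    proof (rule ccontr)
      assume "z p \<noteq> id p"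
      then have "p < z p" using ge[of p] by simp
      then show False using q less.IH[of q] mono[of p q] by (cases p q rule: linorder_cases) auto
    qed
  qed
qed

lemma ex_chain:
  "z \<in> Invol \<Longrightarrow> \<exists>a. chain id a z"
proof (induction "rank2 z" arbitrary: z rule: less_induct)
  case less
  show ?case
  proof (cases "z = id")
    case True
    then show ?thesis by (metis chain_Nil)
  next
    case False
    then obtain i where i: "1 \<le> i" "\<not> z i < z (Suc i)"
      using increasing_perm_id Invol_bij(1)[OF less.prems] less.prems by (auto simp: Invol_iff)
    then have d: "z (Suc i) < z i" using Invol_eq_iff[OF less.prems, of i "Suc i"] by linarith
    have "rank2 (rtimes z i) < rank2 z" using rank2_rtimes_desc[OF less.prems i(1) d] by simp
    then obtain a where "chain id a (rtimes z i)" using less.hyps rtimes_Invol[OF less.prems i(1)] by blast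
    then show ?thesis using chain_snoc[OF id_Invol] less.prems i(1) d by blast
  qed
qed

text \<open>Twice the length of any word for \<open>z\<close> is at least \<open>rank2 z\<close>,
  and chains attain this bound.\<close>

lemma involution_words_eq: "z \<in> Invol \<Longrightarrow> involution_words z = {a. chain id a z}"
proof -
  assume z: "z \<in> Invol"
  obtain c where c: "chain id c z" using ex_chain[OF z] by blast
  have lb: "rank2 z \<le> 2 * length b" if "\<forall>i\<in>set b. 1 \<le> i" "foldl rtimes id b = z" for b
    using foldl_rtimes[OF id_Invol that(1)] that(2) by simp
  show ?thesis
  proof (intro equalityI subsetI)
    fix a assume "a \<in> involution_words z"
    then have a: "\<forall>i\<in>set a. 1 \<le> i" "foldl rtimes id a = z" "length a \<le> length c"
      using c by (auto simp: involution_words_def shortest_words_def chain_def)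
    then show "a \<in> {a. chain id a z}" using lb[OF a(1,2)] c by (auto simp: chain_def)
  next
    fix a assume "a \<in> {a. chain id a z}"
    then show "a \<in> involution_words z"
      using lb by (auto simp: involution_words_def shortest_words_def chain_def)
  qed
qed

text \<open>Ranks add up along concatenation, so the choice of the prefix does not matter;
  \<open>ex_chain\<close> provides one, which keeps the quantifier over prefixes from being
  vacuous.\<close>

lemma rel_involution_words_eq:
  assumes "e \<in> Invol" "z \<in> Invol"
  shows "rel_involution_words e z = {a. chain e a z}"
proof -
  obtain c where c: "chain id c e" using ex_chain[OF assms(1)] by blast
  have "chain id (b @ a) z \<longleftrightarrow> chain e a z" if "chain id b e" for a b
    using that by (auto simp: chain_def)
  then show ?thesis
    using c by (auto simp: rel_involution_words_def involution_words_eq[OF assms(1)] involution_words_eq[OF assms(2)])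
qed

section \<open>Truncation of the letters, and expansion of operator products into words with
  compatible sequences\<close>

definition fixes_above :: "nat \<Rightarrow> (nat \<Rightarrow> nat) \<Rightarrow> bool" where
  "fixes_above N z \<longleftrightarrow> (\<forall>p>N. z p = p)"

lemma fixes_above_desc:
  assumes "z \<in> Invol" "fixes_above N z" "1 \<le> i" "z (Suc i) < z i"
  shows "i < N" "fixes_above N (rtimes z i)"
proof -
  show iN: "i < N"
  proof (rule ccontr)
    assume n: "\<not> i < N"
    then have s: "z (Suc i) = Suc i" using assms(2) by (simp add: fixes_above_def)
    then have "z (z i) = z i" using assms(2,4) n by (simp add: fixes_above_def)
    then show False using Invol_invol[OF assms(1)] s assms(4) by simp
  qed
  show "fixes_above N (rtimes z i)"
    using assms iN by (auto simp: fixes_above_def rtimes_desc)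
qed

lemma chain_letters:
  assumes "e \<in> Invol"
  shows "chain e a z \<Longrightarrow> fixes_above N z \<Longrightarrow> set a \<subseteq> {1..<N}"
proof (induction a arbitrary: z rule: rev_induct)
  case (snoc i a)
  have c: "z \<in> Invol" "1 \<le> i" "z (Suc i) < z i" "chain e a (rtimes z i)"
    using snoc.prems(1) chain_snoc[OF assms] by auto
  then show ?case using snoc.IH[OF c(4)] fixes_above_desc[OF c(1) snoc.prems(2) c(2,3)] by auto
qed simp

text \<open>A letter creates a descent at its own place, so it cannot be repeated at once. Hence
  weak and strict descents of such words agree.\<close>

lemma chain_adjacent:
  assumes "e \<in> Invol"
  shows "chain e a z \<Longrightarrow> Suc j < length a \<Longrightarrow> a ! j \<noteq> a ! Suc j"
proof (induction a arbitrary: z rule: rev_induct)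
  case (snoc i a)
  have c: "z \<in> Invol" "1 \<le> i" "z (Suc i) < z i" "chain e a (rtimes z i)"
    using snoc.prems(1) chain_snoc[OF assms] by auto
  show ?case
  proof (cases "Suc j < length a")
    case True
    then show ?thesis using snoc.IH[OF c(4)] by (simp add: nth_append)
  next
    case False
    then have j: "Suc j = length a" using snoc.prems(2) by simp
    then obtain a' i' where a: "a = a' @ [i']" by (metis length_0_conv nat.distinct(1) rev_exhaust)
    have "i' \<noteq> i"
      using c(4) rtimes_at[OF c(1,3)] unfolding a chain_snoc[OF assms] by auto
    then show ?thesis using j unfolding a by (simp add: nth_append)
  qed
qed simp

text \<open>Expanding the product means choosing a subsequence \<open>J\<close> of the factors, and
  the chosen operators contribute to \<open>z\<close> exactly when their letters form a chain from
  \<open>e\<close>.\<close>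

lemma fold_h_subseqs:
  fixes x :: "nat \<Rightarrow> real"
  assumes "e \<in> Invol" "distinct S"
  shows "fold (\<lambda>(j, i). h i (x j)) S (delta e) z =
    (\<Sum>J\<in>{J. subseq J S \<and> chain e (map snd J) z}. prod_list (map (x \<circ> fst) J))"
  using assms(2)
proof (induction S arbitrary: z rule: rev_induct)
  case Nil
  have n: "subseq J [] \<longleftrightarrow> J = []" for J :: "(nat \<times> nat) list" by (cases J) auto
  have c: "{J. J = [] \<and> chain e (map snd J) z} = (if z = e then {[]} else {})" by (auto simp: chain_Nil)
  show ?case unfolding fold_simps n c by (simp add: delta_def)
next
  case (snoc s S)
  obtain j i where s: "s = (j, i)" by (cases s)
  let ?P = "\<lambda>J. prod_list (map (x \<circ> fst) J)"
  let ?C = "\<lambda>z. {J. subseq J S \<and> chain e (map snd J) z}"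
  have fin: "finite {J. subseq J S \<and> Q J}" for Q
  proof (rule finite_subset)
    show "{J. subseq J S \<and> Q J} \<subseteq> set (subseqs S)" by auto
  qed simp
  have sn: "subseq J (S @ [s]) \<longleftrightarrow> subseq J S \<or> (\<exists>J'. J = J' @ [s] \<and> subseq J' S)" for J
  proof
    assume "subseq J (S @ [s])"
    then obtain J1 J2 where J: "J = J1 @ J2" "subseq J1 S" "subseq J2 [s]"
      by (auto simp: subseq_append_iff)
    then have "J2 = [] \<or> J2 = [s]"
      by (cases J2) (auto split: if_splits)
    then show "subseq J S \<or> (\<exists>J'. J = J' @ [s] \<and> subseq J' S)" using J by auto
  next
    assume "subseq J S \<or> (\<exists>J'. J = J' @ [s] \<and> subseq J' S)"
    then show "subseq J (S @ [s])" by (auto intro: subseq_rev_drop_many)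
  qed
  let ?D = "{J. subseq J S \<and> chain e (map snd J @ [i]) z}"
  have split: "{J. subseq J (S @ [s]) \<and> chain e (map snd J) z} = ?C z \<union> (\<lambda>J. J @ [s]) ` ?D"
    unfolding sn by (auto simp: s)
  have disj: "?C z \<inter> (\<lambda>J. J @ [s]) ` ?D = {}"
  proof -
    have "s \<notin> set S" using snoc.prems by simp
    moreover have "set J \<subseteq> set S" if "subseq J S" for J
      using that by (metis set_nths_subset subseq_conv_nths)
    ultimately have "\<not> subseq (J @ [s]) S" for J by fastforce
    then show ?thesis by auto
  qed
  have "(\<Sum>J\<in>{J. subseq J (S @ [s]) \<and> chain e (map snd J) z}. ?P J) =
      (\<Sum>J\<in>?C z. ?P J) + (\<Sum>J\<in>?D. ?P J * x j)"
    unfolding split by (subst sum.union_disjoint[OF _ _ disj]) (auto simp: fin sum.reindex inj_on_def s)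
  also have "(\<Sum>J\<in>?D. ?P J * x j) = x j * U i (fold (\<lambda>(j, i). h i (x j)) S (delta e)) z"
  proof (cases "z \<in> Invol \<and> 1 \<le> i \<and> z (Suc i) < z i")
    case True
    then have "?D = ?C (rtimes z i)" by (auto simp: chain_snoc[OF assms(1)])
    then show ?thesis using True snoc by (simp add: U_def sum_distrib_left mult.commute comp_def)
  next
    case False
    then have D: "?D = {}" by (auto simp: chain_snoc[OF assms(1)])
    show ?thesis unfolding D using False by (auto simp: U_def)
  qed
  also have "(\<Sum>J\<in>?C z. ?P J) = fold (\<lambda>(j, i). h i (x j)) S (delta e) z" using snoc by (simp add: comp_def)
  finally have f: "(\<Sum>J\<in>{J. subseq J (S @ [s]) \<and> chain e (map snd J) z}. ?P J) =
      h i (x j) (fold (\<lambda>(j, i). h i (x j)) S (delta e)) z" by (simp only: h_def[of i "x j"])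
  show ?case unfolding f by (simp add: s)
qed

text \<open>The factors of the product of \<open>A l N\<close> over \<open>m\<close> variables in
  the order in which they act; a pair holds the index of the variable and the letter.\<close>

definition letter_seq :: "nat \<Rightarrow> nat \<Rightarrow> nat \<Rightarrow> (nat \<times> nat) list" where
  "letter_seq l N m = concat (map (\<lambda>j. map (Pair j) (rev [l..<N])) [1..<Suc m])"

lemma fold_letters: "fold (\<lambda>(j, i). h i (x j)) (map (Pair j) ls) f = hs ls (x j) f"
  by (induction ls arbitrary: f) simp_all

lemma fold_concat_letters:
  "fold (\<lambda>(j, i). h i (x j)) (concat (map (\<lambda>j. map (Pair j) ls) js)) f = fold (hs ls) (map x js) f"
  by (induction js arbitrary: f) (simp_all add: fold_letters)

abbreviation word_order :: "nat \<times> nat \<Rightarrow> nat \<times> nat \<Rightarrow> bool" where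
  "word_order \<equiv> \<lambda>(j, i) (j', i'). j < j' \<or> j = j' \<and> i' < i"

lemma set_letter_seq: "set (letter_seq l N m) = {1..m} \<times> {l..<N}"
  by (auto simp: letter_seq_def)

lemma sorted_letter_seq: "sorted_wrt word_order (letter_seq l N m)"
proof (induction m)
  case (Suc m)
  have "letter_seq l N (Suc m) = letter_seq l N m @ map (Pair (Suc m)) (rev [l..<N])"
    by (simp add: letter_seq_def)
  moreover have "sorted_wrt word_order (map (Pair (Suc m)) (rev [l..<N]))"
    by (simp add: sorted_wrt_map sorted_wrt_rev)
  moreover have "word_order p q" if "p \<in> set (letter_seq l N m)" "q \<in> set (map (Pair (Suc m)) (rev [l..<N]))" for p q
    using that by (auto simp: set_letter_seq)
  ultimately show ?case using Suc by (simp add: sorted_wrt_append)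
qed (simp add: letter_seq_def)

lemma sorted_wrt_subseq_iff:
  assumes "sorted_wrt R S" "\<And>p q r. R p q \<Longrightarrow> R q r \<Longrightarrow> R p r" "\<And>p. \<not> R p p"
  shows "subseq J S \<longleftrightarrow> sorted_wrt R J \<and> set J \<subseteq> set S"
  using assms(1)
proof (induction S arbitrary: J)
  case (Cons s S)
  then have s: "\<And>q. q \<in> set S \<Longrightarrow> R s q" and IH: "\<And>J. subseq J S \<longleftrightarrow> sorted_wrt R J \<and> set J \<subseteq> set S" by auto
  show ?case
  proof (cases J)
    case Nil
    then show ?thesis by simp
  next
    case (Cons a J')
    have nR: "\<not> R q s" if "q \<in> set S" for q using s[OF that] assms(2,3) by blast
    show ?thesis
    proof (cases "a = s")
      case True
      have "subseq J (s # S) \<longleftrightarrow> subseq J' S" using Cons True by simp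
      also have "\<dots> \<longleftrightarrow> sorted_wrt R J' \<and> set J' \<subseteq> set S" by (rule IH)
      also have "\<dots> \<longleftrightarrow> sorted_wrt R J \<and> set J \<subseteq> set (s # S)"
        using Cons True s assms(3) by auto
      finally show ?thesis .
    next
      case False
      then have "subseq J (s # S) \<longleftrightarrow> sorted_wrt R J \<and> set J \<subseteq> set S" using Cons IH by simp
      moreover have "s \<notin> set J" if "sorted_wrt R J" "set J \<subseteq> set (s # S)"
      proof
        assume "s \<in> set J"
        then have "R a s" using Cons False that(1) by auto
        moreover have "a \<in> set S" using Cons False that(2) by auto
        ultimately show False using nR by blast
      qed
      ultimately show ?thesis by auto
    qed
  qed
next
  case Nil
  show ?case by (cases J) auto
qed

lemma subseq_letter_seq: "subseq J (letter_seq l N m) \<longleftrightarrow> sorted_wrt word_order J \<and> set J \<subseteq> {1..m} \<times> {l..<N}"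
  unfolding set_letter_seq[symmetric]
  by (rule sorted_wrt_subseq_iff[OF sorted_letter_seq]) auto

lemma distinct_letter_seq: "distinct (letter_seq l N m)"
proof -
  have "letter_seq l N m ! i \<noteq> letter_seq l N m ! j" if "i < j" "j < length (letter_seq l N m)" for i j
    using sorted_letter_seq[of l N m] that unfolding sorted_wrt_iff_nth_less by fastforce
  then show ?thesis unfolding distinct_conv_nth by (metis nat_neq_iff)
qed

text \<open>Within one variable the letters decrease, so a variable can repeat only at a descent of
  \<open>a\<close>. This is compatibility, once equal adjacent letters are excluded.\<close>

lemma compat_iff_sorted:
  assumes "length I = length a" "\<And>j. Suc j < length a \<Longrightarrow> a ! j \<noteq> a ! Suc j"
  shows "sorted_wrt word_order (zip I a) \<and> (\<forall>i\<in>set I. 1 \<le> i) \<longleftrightarrow> I \<in> compat a"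
proof -
  have tr: "transp word_order" by (rule transpI) auto
  have "sorted_wrt word_order (zip I a) \<longleftrightarrow> (\<forall>j. Suc j < length a \<longrightarrow> word_order (I ! j, a ! j) (I ! Suc j, a ! Suc j))"
    using assms(1) by (simp add: sorted_wrt_iff_nth_Suc_transp[OF tr])
  also have "\<dots> \<longleftrightarrow> (\<forall>j. Suc j < length a \<longrightarrow> I ! j \<le> I ! Suc j \<and> (a ! j < a ! Suc j \<longrightarrow> I ! j < I ! Suc j))"
    using assms(2) by (auto simp: le_less) (metis nat_neq_iff)+
  also have "\<dots> \<longleftrightarrow> sorted I \<and> (\<forall>j. Suc j < length a \<longrightarrow> a ! j < a ! Suc j \<longrightarrow> I ! j < I ! Suc j)"
    using assms(1) by (auto simp: sorted_iff_nth_Suc)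
  finally show ?thesis using assms(1) by (auto simp: compat_def)
qed

text \<open>The series of \<open>W\<close> with all variables beyond \<open>x_m\<close> set to
  zero.\<close>

definition word_sum :: "nat list set \<Rightarrow> nat \<Rightarrow> (nat \<Rightarrow> real) \<Rightarrow> real" where
  "word_sum W m x = (\<Sum>(a, I)\<in>{(a, I). a \<in> W \<and> I \<in> compat a \<and> set I \<subseteq> {1..m}}. prod_list (map x I))"

lemma word_sum_eq:
  assumes "\<And>a. a \<in> W \<Longrightarrow> set a \<subseteq> {l..<N}" "\<And>a j. a \<in> W \<Longrightarrow> Suc j < length a \<Longrightarrow> a ! j \<noteq> a ! Suc j"
  shows "word_sum W m x = (\<Sum>J\<in>{J. subseq J (letter_seq l N m) \<and> map snd J \<in> W}. prod_list (map (x \<circ> fst) J))"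
  unfolding word_sum_def
proof (rule sum.reindex_bij_witness[where i = "\<lambda>J. (map snd J, map fst J)" and j = "\<lambda>(a, I). zip I a"])
  fix p assume p: "p \<in> {(a, I). a \<in> W \<and> I \<in> compat a \<and> set I \<subseteq> {1..m}}"
  then obtain a I where p': "p = (a, I)" "a \<in> W" "I \<in> compat a" "set I \<subseteq> {1..m}" by auto
  then have l: "length I = length a" by (simp add: compat_def)
  show "(map snd (case p of (a, I) \<Rightarrow> zip I a), map fst (case p of (a, I) \<Rightarrow> zip I a)) = p"
    using p' l by simp
  have "sorted_wrt word_order (zip I a)" using compat_iff_sorted[OF l assms(2)[OF p'(2)]] p'(3) by blast
  moreover have "set (zip I a) \<subseteq> {1..m} \<times> {l..<N}"
    using assms(1)[OF p'(2)] p'(4) by (auto dest: set_zip_leftD set_zip_rightD)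
  ultimately show "(case p of (a, I) \<Rightarrow> zip I a) \<in> {J. subseq J (letter_seq l N m) \<and> map snd J \<in> W}"
    using p' l by (simp add: subseq_letter_seq)
  show "prod_list (map (x \<circ> fst) (case p of (a, I) \<Rightarrow> zip I a)) = (case p of (a, I) \<Rightarrow> prod_list (map x I))"
    using p' l by (simp flip: map_map)
next
  fix J assume J: "J \<in> {J. subseq J (letter_seq l N m) \<and> map snd J \<in> W}"
  show "(case (map snd J, map fst J) of (a, I) \<Rightarrow> zip I a) = J" by (simp add: zip_map_fst_snd)
  have s: "sorted_wrt word_order J" "set J \<subseteq> {1..m} \<times> {l..<N}" using J by (simp_all add: subseq_letter_seq)
  have I: "set (map fst J) \<subseteq> {1..m}" using s(2) by auto
  then have "map fst J \<in> compat (map snd J)"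
    using compat_iff_sorted[of "map fst J" "map snd J"] assms(2)[of "map snd J"] J s(1)
    by (fastforce simp: zip_map_fst_snd)
  then show "(map snd J, map fst J) \<in> {(a, I). a \<in> W \<and> I \<in> compat a \<and> set I \<subseteq> {1..m}}"
    using J I by simp
qed

lemma word_sum_chains:
  assumes "e \<in> Invol" "fixes_above N z"
  shows "word_sum {a. chain e a z} m x = fold (A 1 N) (map x [1..<Suc m]) (delta e) z"
proof -
  have "word_sum {a. chain e a z} m x =
      (\<Sum>J\<in>{J. subseq J (letter_seq 1 N m) \<and> chain e (map snd J) z}. prod_list (map (x \<circ> fst) J))"
    using chain_letters[OF assms(1) _ assms(2)] chain_adjacent[OF assms(1)] by (subst word_sum_eq) auto
  also have "\<dots> = fold (\<lambda>(j, i). h i (x j)) (letter_seq 1 N m) (delta e) z"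
    by (rule fold_h_subseqs[OF assms(1) distinct_letter_seq, symmetric])
  also have "\<dots> = fold (A 1 N) (map x [1..<Suc m]) (delta e) z"
    unfolding letter_seq_def fold_concat_letters ..
  finally show ?thesis .
qed

section \<open>Reduced words\<close>

definition finperm :: "(nat \<Rightarrow> nat) \<Rightarrow> bool" where
  "finperm w \<longleftrightarrow> bij w \<and> finite {i. w i \<noteq> i} \<and> w 0 = 0"

lemma finperm_id [simp]: "finperm id"
  by (simp add: finperm_def)

lemma finperm_left: "finperm w \<Longrightarrow> 1 \<le> i \<Longrightarrow> finperm (simple_transp i \<circ> w)"
proof -
  assume w: "finperm w" and i: "1 \<le> i"
  have "{p. (simple_transp i \<circ> w) p \<noteq> p} \<subseteq> {p. w p \<noteq> p} \<union> {i, Suc i}" by auto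
  then have "finite {p. (simple_transp i \<circ> w) p \<noteq> p}"
    by (rule finite_subset) (use w in \<open>simp add: finperm_def\<close>)
  moreover have "bij (simple_transp i)" by (simp add: simple_transp_def)
  ultimately show ?thesis using w i by (simp add: finperm_def bij_comp)
qed

lemma inv_left: "bij w \<Longrightarrow> inv (simple_transp i \<circ> w) = inv w \<circ> simple_transp i"
  by (simp add: o_inv_distrib simple_transp_def)

lemma finperm_invs_asc:
  "finperm w \<Longrightarrow> inv w i < inv w (Suc i) \<Longrightarrow> card (invs (simple_transp i \<circ> w)) = Suc (card (invs w))"
  by (rule card_invs_left) (simp_all add: finperm_def)

lemma finperm_invs_desc:
  assumes "finperm w" "1 \<le> i" "inv w (Suc i) < inv w i"
  shows "card (invs w) = Suc (card (invs (simple_transp i \<circ> w)))"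
proof -
  have "inv (simple_transp i \<circ> w) i < inv (simple_transp i \<circ> w) (Suc i)"
    using assms by (subst (1 2) inv_left) (auto simp: finperm_def)
  from finperm_invs_asc[OF finperm_left[OF assms(1,2)] this] show ?thesis
    by (simp add: comp_assoc[symmetric])
qed

lemma finperm_inv_neq: "finperm w \<Longrightarrow> inv w i \<noteq> inv w (Suc i)"
  by (metis bij_inv_eq_iff finperm_def n_not_Suc_n)

abbreviation word_perm :: "nat list \<Rightarrow> nat \<Rightarrow> nat" where
  "word_perm a \<equiv> foldr (\<lambda>i f. simple_transp i \<circ> f) a id"

definition lchain :: "nat list \<Rightarrow> (nat \<Rightarrow> nat) \<Rightarrow> bool" where
  "lchain a r \<longleftrightarrow> (\<forall>i\<in>set a. 1 \<le> i) \<and> word_perm a = r \<and> card (invs r) = length a"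

lemma invs_id [simp]: "invs id = {}"
  by (auto simp: invs_def)

lemma word_perm_finperm:
  "\<forall>i\<in>set a. 1 \<le> i \<Longrightarrow> finperm (word_perm a) \<and> card (invs (word_perm a)) \<le> length a"
proof (induction a)
  case (Cons i a)
  let ?w = "word_perm a"
  have i: "1 \<le> i" and a: "\<forall>i\<in>set a. 1 \<le> i" using Cons.prems by auto
  have w: "finperm ?w" "card (invs ?w) \<le> length a" using Cons.IH[OF a] by blast+
  have "inv ?w i \<noteq> inv ?w (Suc i)"
    by (rule finperm_inv_neq[OF w(1)])
  then have "card (invs (simple_transp i \<circ> ?w)) \<le> Suc (card (invs ?w))"
    using finperm_invs_asc[OF w(1), of i] finperm_invs_desc[OF w(1) i] by linarith
  moreover have "word_perm (i # a) = simple_transp i \<circ> ?w" by simp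
  ultimately have "finperm (word_perm (i # a))" "card (invs (word_perm (i # a))) \<le> length (i # a)"
    using w finperm_left[OF w(1) i] by (simp_all only: list.size)
  then show ?case ..
qed simp

lemma lchain_Nil: "lchain [] r \<longleftrightarrow> r = id"
  by (auto simp: lchain_def)

text \<open>Letters multiply on the left, so removing the first one requires a descent of the
  inverse permutation.\<close>

lemma lchain_Cons:
  assumes "finperm r"
  shows "lchain (i # a) r \<longleftrightarrow> 1 \<le> i \<and> inv r (Suc i) < inv r i \<and> lchain a (simple_transp i \<circ> r)"
proof
  assume l: "lchain (i # a) r"
  let ?w = "word_perm a"
  have i: "1 \<le> i" and r: "r = simple_transp i \<circ> ?w" and a: "\<forall>i\<in>set a. 1 \<le> i" "card (invs r) = Suc (length a)"
    using l by (auto simp: lchain_def)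
  have w: "finperm ?w" "card (invs ?w) \<le> length a" using word_perm_finperm[OF a(1)] by auto
  have "inv ?w i \<noteq> inv ?w (Suc i)"
    by (rule finperm_inv_neq[OF w(1)])
  moreover have "\<not> inv ?w (Suc i) < inv ?w i"
    using finperm_invs_desc[OF w(1) i] a(2) w(2) r by auto
  ultimately have asc: "inv ?w i < inv ?w (Suc i)" by linarith
  have "bij ?w" using w(1) unfolding finperm_def by blast
  then have "inv r = inv ?w \<circ> simple_transp i" unfolding r by (rule inv_left)
  then have "inv r (Suc i) < inv r i" using asc by simp
  moreover have "simple_transp i \<circ> r = ?w" by (simp add: r comp_assoc[symmetric])
  moreover have "card (invs ?w) = length a" using finperm_invs_asc[OF w(1) asc] a(2) r by simp
  ultimately show "1 \<le> i \<and> inv r (Suc i) < inv r i \<and> lchain a (simple_transp i \<circ> r)"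
    using i a(1) by (simp add: lchain_def)
next
  assume l: "1 \<le> i \<and> inv r (Suc i) < inv r i \<and> lchain a (simple_transp i \<circ> r)"
  then have "card (invs r) = Suc (card (invs (simple_transp i \<circ> r)))" using finperm_invs_desc[OF assms] by blast
  moreover have "word_perm a = simple_transp i \<circ> r" using l by (simp add: lchain_def)
  then have "word_perm (i # a) = r" by (simp add: comp_assoc[symmetric])
  ultimately show "lchain (i # a) r" using l by (simp add: lchain_def)
qed

lemma ex_lchain: "finperm r \<Longrightarrow> \<exists>a. lchain a r"
proof (induction "card (invs r)" arbitrary: r rule: less_induct)
  case less
  show ?case
  proof (cases "r = id")
    case True
    then show ?thesis by (metis lchain_Nil)
  next
    case False
    have b: "bij r" using less.prems by (simp add: finperm_def)
    have "inv r \<noteq> id" using False b by (metis inv_id inv_inv_eq)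
    moreover have "inv r 0 = 0" using less.prems b by (metis finperm_def bij_inv_eq_iff)
    ultimately obtain i where i: "1 \<le> i" "\<not> inv r i < inv r (Suc i)"
      using increasing_perm_id[of "inv r"] bij_imp_bij_inv[OF b] by blast
    moreover have "inv r i \<noteq> inv r (Suc i)" using b by (metis bij_inv_eq_iff n_not_Suc_n)
    ultimately have d: "inv r (Suc i) < inv r i" by linarith
    have "card (invs (simple_transp i \<circ> r)) < card (invs r)" using finperm_invs_desc[OF less.prems i(1) d] by simp
    then obtain a where "lchain a (simple_transp i \<circ> r)" using less.hyps finperm_left[OF less.prems i(1)] by blast
    then show ?thesis using lchain_Cons[OF less.prems] i(1) d by blast
  qed
qed

lemma reduced_words_eq:
  assumes "finperm r"
  shows "reduced_words r = {a. lchain a r}"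
proof -
  obtain c where c: "lchain c r" using ex_lchain[OF assms] by blast
  have lb: "card (invs r) \<le> length b" if "\<forall>i\<in>set b. 1 \<le> i" "word_perm b = r" for b
    using word_perm_finperm[OF that(1)] that(2) by simp
  show ?thesis
  proof (intro equalityI subsetI)
    fix a assume "a \<in> reduced_words r"
    then have a: "\<forall>i\<in>set a. 1 \<le> i" "word_perm a = r" "length a \<le> length c"
      using c by (auto simp: reduced_words_def shortest_words_def lchain_def)
    then show "a \<in> {a. lchain a r}" using lb[OF a(1,2)] c by (auto simp: lchain_def)
  next
    fix a assume "a \<in> {a. lchain a r}"
    then show "a \<in> reduced_words r"
      using lb by (auto simp: reduced_words_def shortest_words_def lchain_def)
  qed
qed

section \<open>The permutation \<open>r(y)\<close> and its reduced words\<close>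

text \<open>\<open>encodes k y r\<close> characterises \<open>r = r(y)\<close> without a bound \<open>n\<close>.\<close>

definition encodes :: "nat \<Rightarrow> (nat \<Rightarrow> nat) \<Rightarrow> (nat \<Rightarrow> nat) \<Rightarrow> bool" where
  "encodes k y r \<longleftrightarrow> finperm r \<and> (\<forall>i. 1 \<le> i \<longrightarrow> i \<le> k \<longrightarrow> y i = k + r i) \<and> (\<forall>p>k. r p < r (Suc p))"

lemma encodes_mono:
  assumes "encodes k y r" "k < p" "p < q"
  shows "r p < r q"
  using assms(3)
proof (induction q rule: less_induct)
  case (less q)
  obtain q' where q: "q = Suc q'" using less.prems by (cases q) auto
  then have "r q' < r (Suc q')" using assms(1,2) less.prems by (simp add: encodes_def)
  then show ?case
    using q less.IH[of q'] less.prems by (cases "p = q'") auto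
qed

lemma encodes_unique:
  assumes "encodes k y r" "encodes k y r'"
  shows "r = r'"
proof
  fix p
  have b: "bij r" "bij r'" "r 0 = 0" "r' 0 = 0" using assms by (auto simp: encodes_def finperm_def)
  have no: "\<not> f p < f' p" if f: "encodes k y f" "encodes k y f'" "k < p" "\<And>q. q < p \<Longrightarrow> f q = f' q" for f f' p
  proof
    assume lt: "f p < f' p"
    have bf: "bij f" "bij f'" using f by (auto simp: encodes_def finperm_def)
    obtain q where q: "f' q = f p" using bf(2) by (metis bij_pointE)
    consider "q < p" | "q = p" | "p < q" by linarith
    then show False
    proof cases
      case 1
      then have "f q = f p" using f(4) q by simp
      then show False using 1 bf(1) by (metis bij_is_inj inj_eq less_irrefl_nat)
    next
      case 3
      then show False using encodes_mono[OF f(2,3) 3] q lt by simp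
    qed (use q lt in simp)
  qed
  show "r p = r' p"
  proof (induction p rule: less_induct)
    case (less p)
    consider "p = 0" | "1 \<le> p" "p \<le> k" | "k < p" by linarith
    then show ?case
    proof cases
      case 2
      then have "y p = k + r p" "y p = k + r' p" using assms by (auto simp: encodes_def)
      then show ?thesis by simp
    next
      case 3
      then show ?thesis using no[OF assms 3] no[OF assms(2,1) 3] less by (metis linorder_neqE_nat)
    qed (use b in simp)
  qed
qed

lemma encodes_id: "encodes k (g_invol k) id"
  by (simp add: encodes_def g_invol_apply)

lemma encodes_id_iff:
  assumes "wd k y" "encodes k y r"
  shows "r = id \<longleftrightarrow> y = g_invol k"
proof
  assume "r = id"
  then show "y = g_invol k" using assms(2) by (intro wd_eq_g_invol[OF assms(1)]) (simp add: encodes_def)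
next
  assume "y = g_invol k"
  then show "r = id" using encodes_unique[OF assms(2)] encodes_id by blast
qed

text \<open>The value \<open>i\<close> stands in \<open>r\<close> at position
  \<open>inv r i\<close>. A position up to \<open>k\<close> is the partner of \<open>k + i\<close>
  in \<open>y\<close>, and a later position means that \<open>y\<close> fixes
  \<open>k + i\<close>.\<close>

lemma encodes_inv:
  assumes "wd k y" "encodes k y r" "1 \<le> i"
  shows "y (k + i) = (if inv r i \<le> k then inv r i else k + i)" "1 \<le> inv r i"
proof -
  have y: "y \<in> Invol" using assms(1) by (simp add: wd_def)
  have b: "bij r" "r 0 = 0" using assms(2) by (auto simp: encodes_def finperm_def)
  define P where "P = inv r i"
  have rP: "r P = i" using b(1) by (simp add: P_def bij_is_surj surj_f_inv_f)
  then show P1: "1 \<le> inv r i" using b(2) assms(3) by (cases P) (auto simp: P_def)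
  show "y (k + i) = (if inv r i \<le> k then inv r i else k + i)"
  proof (cases "P \<le> k")
    case True
    then have "y P = k + i" using assms(2) P1 rP by (simp add: encodes_def P_def)
    then show ?thesis using True Invol_invol[OF y, of P] by (simp add: P_def)
  next
    case False
    have "\<not> y (k + i) \<le> k"
    proof
      assume le: "y (k + i) \<le> k"
      moreover have "1 \<le> y (k + i)" using wd_small[OF assms(1) _ le] assms(3) by simp
      ultimately have "y (y (k + i)) = k + r (y (k + i))" using assms(2) by (simp add: encodes_def)
      then have "r (y (k + i)) = r P" using Invol_invol[OF y] rP by simp
      then have "y (k + i) = P" using b(1) by (simp add: bij_is_inj inj_eq)
      then show False using le False by simp
    qed
    moreover have "y (k + i) \<le> k \<or> y (k + i) = k + i" using assms(1,3) by (simp add: wd_def)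
    ultimately show ?thesis using False by (simp add: P_def)
  qed
qed

text \<open>Values standing after position \<open>k\<close> are in increasing order, so at a descent
  the value \<open>i + 1\<close> stands within the first \<open>k\<close> positions. The rest is
  read off from \<open>encodes_inv\<close>.\<close>

lemma encodes_desc:
  assumes "wd k y" "encodes k y r" "1 \<le> i"
  shows "inv r (Suc i) < inv r i \<longleftrightarrow> y (Suc (k + i)) < y (k + i)"
    and "y (Suc (k + i)) < y (k + i) \<Longrightarrow> inv r (Suc i) \<le> k"
proof -
  have b: "bij r" using assms(2) by (auto simp: encodes_def finperm_def)
  have rr: "r (inv r p) = p" for p using b by (simp add: bij_is_surj surj_f_inv_f)
  note e1 = encodes_inv[OF assms] and e2 = encodes_inv[OF assms(1,2), of "Suc i"]
  have "inv r i < inv r (Suc i)" if "k < inv r i" "k < inv r (Suc i)"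
  proof (rule ccontr)
    assume "\<not> inv r i < inv r (Suc i)"
    moreover have "inv r i \<noteq> inv r (Suc i)" using rr by (metis n_not_Suc_n)
    ultimately have "r (inv r (Suc i)) < r (inv r i)" using encodes_mono[OF assms(2) that(2)] by simp
    then show False by (simp add: rr)
  qed
  then show "inv r (Suc i) < inv r i \<longleftrightarrow> y (Suc (k + i)) < y (k + i)" "y (Suc (k + i)) < y (k + i) \<Longrightarrow> inv r (Suc i) \<le> k"
    using e1 e2 assms(3) by (auto split: if_splits)
qed

lemma encodes_lower:
  assumes "wd k y" "encodes k y r" "1 \<le> i" "y (Suc (k + i)) < y (k + i)"
  shows "encodes k (rtimes y (k + i)) (simple_transp i \<circ> r)"
proof -
  have y: "y \<in> Invol" using assms(1) by (simp add: wd_def)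
  have b: "bij r" and f: "finperm r" using assms(2) by (auto simp: encodes_def finperm_def)
  have "y (k + i) \<noteq> Suc (k + i)" using assms(1,3) by (metis add_diff_cancel_left' assms(4) less_add_Suc1 n_not_Suc_n not_less wd_def zero_less_diff less_add_same_cancel1 less_le_trans zero_less_one le_imp_less_Suc less_Suc_eq_le)
  then have e: "rtimes y (k + i) p = simple_transp (k + i) (y (simple_transp (k + i) p))" for p
    using rtimes_desc[OF y assms(4)] by simp
  have s: "simple_transp (k + i) (k + p) = k + simple_transp i p" for p
    by (cases "p = i"; cases "p = Suc i"; simp)
  show ?thesis unfolding encodes_def
  proof (intro conjI allI impI)
    show "finperm (simple_transp i \<circ> r)" by (rule finperm_left[OF f assms(3)])
    fix p assume "1 \<le> p" "p \<le> k"
    then show "rtimes y (k + i) p = k + (simple_transp i \<circ> r) p"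
      using assms(2,3) by (simp add: e s encodes_def)
  next
    fix p assume p: "k < p"
    have "r p < r (Suc p)" using assms(2) p by (simp add: encodes_def)
    \<comment> \<open>Exchanging the values \<open>i\<close> and \<open>i + 1\<close> breaks an
      increase only where they stand side by side, and \<open>i + 1\<close> stands at a position up
      to \<open>k\<close>.\<close>
    moreover have "r (Suc p) \<noteq> Suc i"
    proof
      assume "r (Suc p) = Suc i"
      then have "inv r (Suc i) = Suc p" using b by (metis bij_inv_eq_iff)
      then show False using encodes_desc(2)[OF assms] p by simp
    qed
    ultimately show "(simple_transp i \<circ> r) p < (simple_transp i \<circ> r) (Suc p)"
      by (simp add: simple_transp_less)
  qed
qed

text \<open>Removing the first letter \<open>i\<close> of a reduced word of \<open>r\<close>
  corresponds to removing the last letter \<open>k + i\<close> of a chain from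
  \<open>g_invol k\<close> to \<open>y\<close>. This accounts for the reversal and the
  shift.\<close>

lemma lchain_iff_chain:
  assumes "wd k y" "encodes k y r" "\<forall>i\<in>set a. 1 \<le> i"
  shows "lchain a r \<longleftrightarrow> chain (g_invol k) (rev (map ((+) k) a)) y"
  using assms
proof (induction a arbitrary: y r)
  case Nil
  then show ?case using encodes_id_iff by (simp add: lchain_Nil chain_Nil)
next
  case (Cons i a)
  have i: "1 \<le> i" and a: "\<forall>i\<in>set a. 1 \<le> i" using Cons.prems(3) by auto
  have f: "finperm r" and y: "y \<in> Invol" using Cons.prems by (auto simp: encodes_def wd_def)
  have "lchain (i # a) r \<longleftrightarrow> inv r (Suc i) < inv r i \<and> lchain a (simple_transp i \<circ> r)"
    using lchain_Cons[OF f] i by simp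
  also have "\<dots> \<longleftrightarrow> y (Suc (k + i)) < y (k + i) \<and> chain (g_invol k) (rev (map ((+) k) a)) (rtimes y (k + i))"
  proof (cases "y (Suc (k + i)) < y (k + i)")
    case True
    have "lchain a (simple_transp i \<circ> r) \<longleftrightarrow> chain (g_invol k) (rev (map ((+) k) a)) (rtimes y (k + i))"
      using True i by (intro Cons.IH wd_lower[OF Cons.prems(1)] encodes_lower[OF Cons.prems(1,2) i] a) auto
    then show ?thesis using encodes_desc(1)[OF Cons.prems(1,2) i] by blast
  next
    case False
    then show ?thesis using encodes_desc(1)[OF Cons.prems(1,2) i] by blast
  qed
  also have "\<dots> \<longleftrightarrow> chain (g_invol k) (rev (map ((+) k) (i # a))) y"
    using chain_snoc[OF g_invol_Invol] y i by simp
  finally show ?case .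
qed

lemma compat_shift: "compat (map ((+) k) a) = compat a"
  by (auto simp: compat_def)

lemma word_sum_shift: "word_sum (map ((+) k) ` W) m x = word_sum W m x"
  unfolding word_sum_def
  by (rule sum.reindex_bij_witness[where i = "\<lambda>(a, I). (map ((+) k) a, I)" and j = "\<lambda>(a, I). (map (\<lambda>i. i - k) a, I)"])
    (auto simp: compat_shift comp_def)

lemma subseq_rev: "subseq (rev xs) (rev ys) \<longleftrightarrow> subseq xs ys"
proof -
  have "subseq (rev xs) (rev ys)" if "subseq xs ys" for xs ys :: "'a list"
    using that
  proof (induction xs ys rule: list_emb.induct)
    case (list_emb_Cons xs ys y)
    then show ?case by (auto intro: subseq_rev_drop_many)
  next
    case (list_emb_Cons2 x y xs ys)
    then show ?case by (auto intro: list_emb_append_mono)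
  qed simp
  from this[of xs ys] this[of "rev xs" "rev ys"] show ?thesis by auto
qed

text \<open>Reversing the words reverses the whole order of the factors: letters now increase within
  each variable, which gives \<open>B\<close> instead of \<open>A\<close>, and the variables occur
  in reverse order.\<close>

lemma word_sum_reduced:
  assumes "wd k y" "encodes k y r" "fixes_above N y"
  shows "word_sum (reduced_words r) m x = fold (B (Suc k) N) (map x (rev [1..<Suc m])) (delta (g_invol k)) y"
proof -
  let ?g = "g_invol k"
  have f: "finperm r" using assms(2) by (simp add: encodes_def)
  define W where "W = map ((+) k) ` reduced_words r"
  have ch: "chain ?g (rev b) y" "set b \<subseteq> {Suc k..<N}" if "b \<in> W" for b
  proof -
    have "b \<in> map ((+) k) ` {a. lchain a r}" using that unfolding W_def reduced_words_eq[OF f] .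
    then obtain a where a: "b = map ((+) k) a" "lchain a r" by blast
    have l: "\<forall>i\<in>set a. 1 \<le> i" using a(2) by (simp add: lchain_def)
    then show c: "chain ?g (rev b) y" using a lchain_iff_chain[OF assms(1,2)] by simp
    from chain_letters[OF g_invol_Invol c assms(3)] show "set b \<subseteq> {Suc k..<N}" using l a(1) by fastforce
  qed
  have W: "b \<in> W \<longleftrightarrow> chain ?g (rev b) y" if "set b \<subseteq> {Suc k..<N}" for b
  proof
    assume c: "chain ?g (rev b) y"
    define a where "a = map (\<lambda>i. i - k) b"
    have ba: "b = map ((+) k) a" using that by (auto simp: a_def comp_def intro!: map_idI[symmetric])
    have "\<forall>i\<in>set a. 1 \<le> i"
    proof
      fix i assume "i \<in> set a"
      then obtain j where "j \<in> set b" "i = j - k" by (auto simp: a_def)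
      moreover from this have "Suc k \<le> j" using that by auto
      ultimately show "1 \<le> i" by simp
    qed
    then have "lchain a r" using lchain_iff_chain[OF assms(1,2)] c ba by simp
    then show "b \<in> W" unfolding W_def reduced_words_eq[OF f] using ba by blast
  qed (rule ch)
  have adj: "b ! j \<noteq> b ! Suc j" if "b \<in> W" "Suc j < length b" for b j
  proof -
    let ?j = "length b - Suc (Suc j)"
    have "rev b ! ?j \<noteq> rev b ! Suc ?j"
      using chain_adjacent[OF g_invol_Invol ch(1)[OF that(1)], of ?j] that(2) by simp
    then show ?thesis using that(2) by (simp add: rev_nth Suc_diff_Suc)
  qed
  have S: "rev (letter_seq (Suc k) N m) = concat (map (\<lambda>j. map (Pair j) [Suc k..<N]) (rev [1..<Suc m]))"
    by (simp add: letter_seq_def rev_concat rev_map comp_def del: upt_Suc)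
  have "word_sum (reduced_words r) m x = word_sum W m x" by (simp add: W_def word_sum_shift)
  also have "\<dots> = (\<Sum>J\<in>{J. subseq J (letter_seq (Suc k) N m) \<and> map snd J \<in> W}. prod_list (map (x \<circ> fst) J))"
    by (rule word_sum_eq[OF ch(2) adj])
  also have "\<dots> = (\<Sum>J\<in>{J. subseq J (rev (letter_seq (Suc k) N m)) \<and> chain ?g (map snd J) y}. prod_list (map (x \<circ> fst) J))"
  proof (rule sum.reindex_bij_witness[where i = rev and j = rev])
    fix J assume "J \<in> {J. subseq J (letter_seq (Suc k) N m) \<and> map snd J \<in> W}"
    then show "rev J \<in> {J. subseq J (rev (letter_seq (Suc k) N m)) \<and> chain ?g (map snd J) y}"
      using ch(1) by (auto simp: subseq_rev rev_map[symmetric])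
  next
    fix J assume J: "J \<in> {J. subseq J (rev (letter_seq (Suc k) N m)) \<and> chain ?g (map snd J) y}"
    then have s: "subseq (rev J) (letter_seq (Suc k) N m)" using subseq_rev[of "rev J" "letter_seq (Suc k) N m"] by simp
    then have "set (map snd (rev J)) \<subseteq> {Suc k..<N}" by (auto simp: subseq_letter_seq)
    then have "map snd (rev J) \<in> W" using W J by (simp add: rev_map[symmetric])
    then show "rev J \<in> {J. subseq J (letter_seq (Suc k) N m) \<and> map snd J \<in> W}" using s by simp
  qed (simp_all add: rev_map[symmetric] prod_list.rev)
  also have "\<dots> = fold (\<lambda>(j, i). h i (x j)) (rev (letter_seq (Suc k) N m)) (delta ?g) y"
    using fold_h_subseqs[OF g_invol_Invol, of "rev (letter_seq (Suc k) N m)"] distinct_letter_seq by simp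
  also have "\<dots> = fold (B (Suc k) N) (map x (rev [1..<Suc m])) (delta ?g) y"
    unfolding S fold_concat_letters ..
  finally show ?thesis .
qed

lemma r_perm_encodes:
  assumes "wd k y" "y \<in> S_fin n"
  shows "encodes k y (r_perm n y)"
proof -
  have y: "y \<in> Invol" using assms(1) by (simp add: wd_def)
  have k: "kappa y = k" by (rule kappa_wd[OF assms(1)])
  have fx: "y i = i" if "n < i" for i using assms(2) that by (simp add: S_fin_def)
  have le: "y i \<le> n" if "1 \<le> i" "i \<le> k" for i
  proof (rule ccontr)
    assume "\<not> y i \<le> n"
    then have "y (y i) = y i" by (simp add: fx)
    then have "y i = i" using Invol_invol[OF y] by simp
    then show False using assms(1) that by (auto simp: wd_def)
  qed
  have gt: "k < y i" if "1 \<le> i" "i \<le> k" for i using assms(1) that by (simp add: wd_def)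
  define bs where "bs = map (\<lambda>i. y i - k) [1..<k + 1]"
  define C where "C = {1..n - k} - set bs"
  define u where "u = bs @ sorted_list_of_set C"
  have r: "r_perm n y = perm_of_word u" by (simp add: r_perm_def k Let_def u_def bs_def C_def)
  have lb: "length bs = k" by (simp add: bs_def del: upt_Suc)
  have bi: "bs ! (i - 1) = y i - k" if "1 \<le> i" "i \<le> k" for i
  proof -
    have "[1..<k + 1] ! (i - 1) = 1 + (i - 1)" by (rule nth_upt) (use that in simp)
    then show ?thesis using that by (simp add: bs_def del: upt_Suc)
  qed
  have sb: "set bs \<subseteq> {1..n - k}"
  proof
    fix b assume "b \<in> set bs"
    then obtain i where "1 \<le> i" "i \<le> k" "b = y i - k" by (auto simp: bs_def simp del: upt_Suc)
    then show "b \<in> {1..n - k}" using le[of i] gt[of i] by auto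
  qed
  have db: "distinct bs" unfolding bs_def distinct_map
  proof (intro conjI inj_onI)
    fix i j assume ij: "i \<in> set [1..<k + 1]" "j \<in> set [1..<k + 1]" "y i - k = y j - k"
    then have "y i = y j" using gt[of i] gt[of j] by (auto simp del: upt_Suc)
    then show "i = j" using Invol_eq_iff[OF y] by simp
  qed simp
  have du: "distinct u" and su: "set u = {1..n - k}" using db sb by (auto simp: u_def C_def)
  have lu: "length u = n - k" using du su by (metis card_atLeastAtMost diff_Suc_1 distinct_card)
  have ub: "1 \<le> perm_of_word u i \<and> perm_of_word u i \<le> n - k" if "1 \<le> i" "i \<le> n - k" for i
  proof -
    have "u ! (i - 1) \<in> set u" using that lu by (intro nth_mem) simp
    then show ?thesis using that lu su by (simp add: perm_of_word_def)
  qed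
  have out: "perm_of_word u i = i" if "\<not> (1 \<le> i \<and> i \<le> n - k)" for i by (simp only: perm_of_word_def lu that if_False)
  have "bij_betw (perm_of_word u) {1..n - k} {1..n - k}"
  proof (rule bij_betw_imageI)
    show inj: "inj_on (perm_of_word u) {1..n - k}"
      using du lu by (auto simp: inj_on_def perm_of_word_def nth_eq_iff_index_eq)
    have "perm_of_word u ` {1..n - k} \<subseteq> {1..n - k}" using ub by auto
    then show "perm_of_word u ` {1..n - k} = {1..n - k}"
      using inj by (simp add: endo_inj_surj)
  qed
  then have "perm_of_word u permutes {1..n - k}"
    by (rule bij_imp_permutes) (simp add: out)
  then have "bij (perm_of_word u)" by (rule permutes_bij)
  moreover have "{i. perm_of_word u i \<noteq> i} \<subseteq> {1..n - k}"
  proof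
    fix p assume "p \<in> {i. perm_of_word u i \<noteq> i}"
    then show "p \<in> {1..n - k}" using out[of p] by (cases "1 \<le> p \<and> p \<le> n - k") auto
  qed
  then have "finite {i. perm_of_word u i \<noteq> i}" by (rule finite_subset) simp
  ultimately have "finperm (perm_of_word u)" by (simp add: finperm_def out)
  moreover have "y i = k + perm_of_word u i" if "1 \<le> i" "i \<le> k" for i
  proof -
    have "i - 1 < length bs" using that lb by simp
    then have "u ! (i - 1) = y i - k" using bi[OF that] by (simp add: u_def nth_append)
    moreover have "i \<le> length u" using that lb by (simp add: u_def)
    ultimately show ?thesis using that gt[OF that] by (simp add: perm_of_word_def)
  qed
  moreover have "perm_of_word u p < perm_of_word u (Suc p)" if "k < p" for p
  proof (cases "Suc p \<le> n - k")
    case True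
    have "sorted_wrt (<) (sorted_list_of_set C)" by (rule strict_sorted_list_of_set)
    moreover have "length (sorted_list_of_set C) = n - k - k" using lu lb by (simp add: u_def)
    ultimately have "sorted_list_of_set C ! (p - 1 - k) < sorted_list_of_set C ! (p - k)"
      using that True by (intro sorted_wrt_nth_less[of "(<)"]) auto
    moreover have "\<not> p - 1 < k" using that by simp
    ultimately show ?thesis using that True lu lb by (simp add: perm_of_word_def u_def nth_append)
  next
    case False
    then show ?thesis using ub[of p] out[of "Suc p"] out[of p] that by (cases "p \<le> n - k") auto
  qed
  ultimately show ?thesis by (simp add: encodes_def r)
qed

section \<open>Evaluation of power series\<close>

definition monoms :: "nat \<Rightarrow> nat \<Rightarrow> nat multiset set" where
  "monoms m d = {M. set_mset M \<subseteq> {1..m} \<and> size M = d}"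

text \<open>The part of degree \<open>d\<close>, evaluated at \<open>x_1, ..., x_m\<close> with the
  other variables zero. Taking real coefficient functions covers integer and rational series
  alike.\<close>

definition hom_eval :: "(nat multiset \<Rightarrow> real) \<Rightarrow> nat \<Rightarrow> (nat \<Rightarrow> real) \<Rightarrow> nat \<Rightarrow> real" where
  "hom_eval c m x d = (\<Sum>M\<in>monoms m d. c M * (\<Prod>i\<in>#M. x i))"

lemma finite_monoms [simp]: "finite (monoms m d)"
proof (rule finite_subset)
  show "monoms m d \<subseteq> mset ` {xs. set xs \<subseteq> {1..m} \<and> length xs = d}"
  proof
    fix M assume "M \<in> monoms m d"
    moreover obtain xs where "M = mset xs" using ex_mset by metis
    ultimately show "M \<in> mset ` {xs. set xs \<subseteq> {1..m} \<and> length xs = d}" by (auto simp: monoms_def)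
  qed
qed (simp add: finite_lists_length_eq)

lemma EV_mult:
  assumes "\<And>M. c M = (\<Sum>(A, B)\<in>msplits M. a A * b B)"
  shows "hom_eval c m x d = (\<Sum>i\<le>d. hom_eval a m x i * hom_eval b m x (d - i))"
proof -
  let ?x = "\<lambda>M. \<Prod>i\<in>#M. x i"
  have "hom_eval c m x d = (\<Sum>M\<in>monoms m d. \<Sum>p\<in>msplits M. a (fst p) * b (snd p) * ?x M)"
    by (simp add: hom_eval_def assms sum_distrib_right case_prod_unfold)
  also have "\<dots> = (\<Sum>(M, p)\<in>(SIGMA M:monoms m d. msplits M). a (fst p) * b (snd p) * ?x M)"
    by (rule sum.Sigma) auto
  also have "\<dots> = (\<Sum>(i, p)\<in>(SIGMA i:{..d}. monoms m i \<times> monoms m (d - i)). (a (fst p) * ?x (fst p)) * (b (snd p) * ?x (snd p)))"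
    by (rule sum.reindex_bij_witness[where i = "\<lambda>(i, p). (fst p + snd p, p)" and j = "\<lambda>(M, p). (size (fst p), p)"])
      (auto simp: monoms_def mult_ac subset_eq)
  also have "\<dots> = (\<Sum>i\<le>d. \<Sum>p\<in>monoms m i \<times> monoms m (d - i). (a (fst p) * ?x (fst p)) * (b (snd p) * ?x (snd p)))"
    by (rule sum.Sigma[symmetric]) auto
  also have "\<dots> = (\<Sum>i\<le>d. hom_eval a m x i * hom_eval b m x (d - i))"
    by (simp add: hom_eval_def sum_product sum.cartesian_product case_prod_unfold)
  finally show ?thesis .
qed

lemma compat_mset_props: "I \<in> compat a \<Longrightarrow> size (mset I) = length a" "I \<in> compat a \<Longrightarrow> 0 \<notin># mset I"
  by (auto simp: compat_def)

lemma EV_word_series: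
  assumes "finite W" "\<And>a. a \<in> W \<Longrightarrow> length a = n"
  shows "hom_eval (\<lambda>M. real_of_int (mcoeff (word_series W) M)) m x d = (if d = n then word_sum W m x else 0)"
proof (cases "d = n")
  case False
  have e: "{I \<in> compat a. mset I = M} = {}" if "a \<in> W" "M \<in> monoms m d" for a M
    using that False assms(2) compat_mset_props(1) by (fastforce simp: monoms_def)
  have "mcoeff (word_series W) M = 0" if "M \<in> monoms m d" for M
    unfolding word_series_def mcoeff_Abs_mfps
  proof (intro sum.neutral ballI)
    fix a assume "a \<in> W"
    with e[OF this that] show "int (card {I \<in> compat a. mset I = M}) = 0" by (simp only: card.empty of_nat_0)
  qed
  then show ?thesis using False by (simp add: hom_eval_def)
next
  case True
  let ?x = "\<lambda>M. \<Prod>i\<in>#M. x i"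
  let ?K = "\<lambda>a. {I \<in> compat a. set I \<subseteq> {1..m}}"
  have fK: "finite (?K a)" for a
  proof (rule finite_subset)
    show "?K a \<subseteq> {I. set I \<subseteq> {1..m} \<and> length I = length a}" by (auto simp: compat_def)
  qed (simp add: finite_lists_length_eq)
  have K: "(\<Sum>M\<in>monoms m d. real (card {I \<in> compat a. mset I = M}) * ?x M) = (\<Sum>I\<in>?K a. prod_list (map x I))"
    if "a \<in> W" for a
  proof -
    have "(\<Sum>I\<in>?K a. prod_list (map x I)) = (\<Sum>M\<in>monoms m d. \<Sum>I\<in>{I \<in> ?K a. mset I = M}. prod_list (map x I))"
      by (rule sum.group[OF fK finite_monoms, symmetric])
        (use True assms(2)[OF that] in \<open>auto simp: monoms_def compat_def\<close>)
    also have "\<dots> = (\<Sum>M\<in>monoms m d. real (card {I \<in> compat a. mset I = M}) * ?x M)"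
    proof (rule sum.cong[OF refl])
      fix M assume "M \<in> monoms m d"
      then have "{I \<in> ?K a. mset I = M} = {I \<in> compat a. mset I = M}" by (auto simp: monoms_def)
      moreover have "prod_list (map x I) = ?x M" if "mset I = M" for I
        using that by (simp add: prod_mset_prod_list[symmetric])
      ultimately show "(\<Sum>I\<in>{I \<in> ?K a. mset I = M}. prod_list (map x I)) = real (card {I \<in> compat a. mset I = M}) * ?x M"
        by simp
    qed
    finally show ?thesis by simp
  qed
  have "hom_eval (\<lambda>M. real_of_int (mcoeff (word_series W) M)) m x d =
      (\<Sum>M\<in>monoms m d. \<Sum>a\<in>W. real (card {I \<in> compat a. mset I = M}) * ?x M)"
    by (simp add: hom_eval_def word_series_def sum_distrib_right)
  also have "\<dots> = (\<Sum>a\<in>W. \<Sum>M\<in>monoms m d. real (card {I \<in> compat a. mset I = M}) * ?x M)"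
    by (rule sum.swap)
  also have "\<dots> = (\<Sum>a\<in>W. \<Sum>I\<in>?K a. prod_list (map x I))" using K by (rule sum.cong[OF refl])
  also have "\<dots> = (\<Sum>(a, I)\<in>(SIGMA a:W. ?K a). prod_list (map x I))" by (rule sum.Sigma) (use assms(1) fK in auto)
  also have "(SIGMA a:W. ?K a) = {(a, I). a \<in> W \<and> I \<in> compat a \<and> set I \<subseteq> {1..m}}" by auto
  finally show ?thesis using True by (simp add: word_sum_def)
qed

lemma base_expansion_unique:
  fixes c c' :: "nat \<Rightarrow> nat"
  assumes "\<And>i. i < m \<Longrightarrow> c i < b" "\<And>i. i < m \<Longrightarrow> c' i < b" "(\<Sum>i<m. c i * b ^ i) = (\<Sum>i<m. c' i * b ^ i)" "i < m"
  shows "c i = c' i"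
  using assms
proof (induction m arbitrary: c c' i)
  case (Suc m)
  have s: "(\<Sum>i<Suc m. f i * b ^ i) = f 0 + b * (\<Sum>i<m. f (Suc i) * b ^ i)" for f :: "nat \<Rightarrow> nat"
    by (simp only: sum.lessThan_Suc_shift) (simp add: sum_distrib_left mult_ac)
  have e: "c 0 + b * (\<Sum>i<m. c (Suc i) * b ^ i) = c' 0 + b * (\<Sum>i<m. c' (Suc i) * b ^ i)"
    using Suc.prems(3) unfolding s .
  have c0: "c 0 < b" "c' 0 < b" using Suc.prems(1,2) by auto
  have "c 0 = (c 0 + b * (\<Sum>i<m. c (Suc i) * b ^ i)) mod b" using c0 by simp
  also have "\<dots> = c' 0" unfolding e using c0 by simp
  finally have 0: "c 0 = c' 0" .
  then have tl: "(\<Sum>i<m. c (Suc i) * b ^ i) = (\<Sum>i<m. c' (Suc i) * b ^ i)" using e c0 by simp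
  have "c (Suc j) = c' (Suc j)" if "j < m" for j
  proof (rule Suc.IH[OF _ _ tl that])
    show "c (Suc i) < b" "c' (Suc i) < b" if "i < m" for i
      using Suc.prems(1)[of "Suc i"] Suc.prems(2)[of "Suc i"] that by auto
  qed
  then show ?case using 0 Suc.prems(4) by (cases i) auto
qed simp

text \<open>Kronecker substitution \<open>x\<^sub>i = t\<^bsup>b\<^sup>i\<^esup>\<close> with \<open>b > d\<close> separates the monomials of degree \<open>d\<close>.\<close>

lemma EV_eq_0_imp:
  assumes "\<And>x. (\<forall>i. 0 < x i) \<Longrightarrow> inj_on x {1..m} \<Longrightarrow> hom_eval c m x d = 0" "M \<in> monoms m d"
  shows "c M = 0"
proof -
  \<comment> \<open>The base exceeds every multiplicity, and it is at least 2 even for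
    \<open>d = 0\<close>, so that its powers are distinct.\<close>
  define b where "b = Suc (Suc d)"
  define w where "w M = (\<Sum>i<m. count M (Suc i) * b ^ i)" for M
  have inj: "inj_on w (monoms m d)"
  proof (rule inj_onI)
    fix M M' assume M: "M \<in> monoms m d" "M' \<in> monoms m d" "w M = w M'"
    have lt: "count L i < b" if "L \<in> monoms m d" for L i
      using that count_le_size[of L i] by (simp add: monoms_def b_def)
    have eq: "count M (Suc i) = count M' (Suc i)" if "i < m" for i
      using base_expansion_unique[of m "\<lambda>i. count M (Suc i)" b "\<lambda>i. count M' (Suc i)" i] M lt that
      by (simp add: w_def)
    show "M = M'"
    proof (rule multiset_eqI)
      fix i
      show "count M i = count M' i"
      proof (cases "i \<in> {1..m}")
        case True
        then obtain j where "i = Suc j" "j < m" by (cases i) auto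
        then show ?thesis using eq by simp
      next
        case False
        then have "i \<notin># M" "i \<notin># M'" using M by (auto simp: monoms_def)
        then show ?thesis by (simp add: not_in_iff)
      qed
    qed
  qed
  have mon: "(\<Prod>i\<in>#L. t ^ (b ^ (i - 1))) = t ^ w L" if "L \<in> monoms m d" for L and t :: real
  proof -
    have "(\<Prod>i\<in>#L. t ^ (b ^ (i - 1))) = (\<Prod>i\<in>set_mset L. (t ^ (b ^ (i - 1))) ^ count L i)"
      by (rule image_prod_mset_multiplicity)
    also have "\<dots> = (\<Prod>i\<in>{1..m}. (t ^ (b ^ (i - 1))) ^ count L i)"
      using that by (intro prod.mono_neutral_left) (auto simp: monoms_def not_in_iff)
    also have "\<dots> = (\<Prod>i<m. (t ^ (b ^ i)) ^ count L (Suc i))"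
      by (rule prod.reindex_bij_witness[where i = Suc and j = "\<lambda>i. i - 1"]) auto
    also have "\<dots> = t ^ w L" by (simp add: w_def power_sum mult.commute flip: power_mult)
    finally show ?thesis .
  qed
  define p where "p = (\<Sum>L\<in>monoms m d. monom (c L) (w L))"
  \<comment> \<open>For \<open>t > 1\<close> the substituted values are positive and distinct, as
    the hypothesis demands, and there are infinitely many such \<open>t\<close>.\<close>
  have "poly p t = 0" if "1 < t" for t
  proof -
    let ?x = "\<lambda>i :: nat. t ^ (b ^ (i - 1))"
    have "inj_on ?x {1..m}"
    proof (rule inj_onI)
      fix i j assume ij: "i \<in> {1..m}" "j \<in> {1..m}" "?x i = ?x j"
      then have "b ^ (i - 1) = b ^ (j - 1)" using that by (simp add: power_inject_exp)
      then have "i - 1 = j - 1" by (simp add: b_def power_inject_exp)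
      then show "i = j" using ij by auto
    qed
    then have "hom_eval c m ?x d = 0" using that by (intro assms(1)) auto
    moreover have "hom_eval c m ?x d = poly p t"
      unfolding hom_eval_def p_def poly_sum poly_monom by (rule sum.cong) (simp_all only: mon)
    ultimately show ?thesis by simp
  qed
  then have "{1<..} \<subseteq> {t. poly p t = 0}" by auto
  then have "infinite {t. poly p t = 0}" using infinite_Ioi finite_subset by blast
  then have "p = 0" using poly_roots_finite by blast
  then have "0 = coeff p (w M)" by simp
  also have "\<dots> = (\<Sum>L\<in>monoms m d. if L = M then c L else 0)"
    unfolding p_def coeff_sum coeff_monom
    by (rule sum.cong[OF refl]) (use inj assms(2) in \<open>auto dest: inj_onD\<close>)
  also have "\<dots> = c M" using assms(2) by simp
  finally show ?thesis by simp
qed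

lemma EV_power_sum:
  assumes "1 \<le> n"
  shows "hom_eval (\<lambda>M. of_rat (mcoeff (power_sum n) M)) m x d = (if d = n then \<Sum>i=1..m. x i ^ n else 0)"
proof (cases "d = n")
  case False
  then show ?thesis by (auto simp: hom_eval_def power_sum_def monoms_def intro!: sum.neutral)
next
  case True
  have "hom_eval (\<lambda>M. of_rat (mcoeff (power_sum n) M)) m x d =
      (\<Sum>M\<in>replicate_mset n ` {1..m}. of_rat (mcoeff (power_sum n) M) * (\<Prod>i\<in>#M. x i))"
    unfolding hom_eval_def
  proof (rule sum.mono_neutral_right)
    show "replicate_mset n ` {1..m} \<subseteq> monoms m d" using True by (auto simp: monoms_def split: if_splits)
    show "\<forall>M\<in>monoms m d - replicate_mset n ` {1..m}. of_rat (mcoeff (power_sum n) M) * (\<Prod>i\<in>#M. x i) = 0"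
    proof
      fix M assume M: "M \<in> monoms m d - replicate_mset n ` {1..m}"
      have no: "\<not> (\<exists>i\<ge>1. M = replicate_mset n i)"
      proof
        assume "\<exists>i\<ge>1. M = replicate_mset n i"
        then obtain i where i: "1 \<le> i" "M = replicate_mset n i" by auto
        then have "i \<in># M" using assms by simp
        then have "i \<in> {1..m}" using M by (auto simp: monoms_def)
        then show False using M i by auto
      qed
      show "of_rat (mcoeff (power_sum n) M) * (\<Prod>i\<in>#M. x i) = 0"
        by (simp only: power_sum_def mcoeff_Abs_mfps no if_False of_rat_0 mult_zero_left)
    qed
  qed simp
  also have "\<dots> = (\<Sum>i=1..m. x i ^ n)"
  proof (subst sum.reindex)
    show "inj_on (replicate_mset n) {1..m}"
    proof (rule inj_onI)
      fix i j assume "replicate_mset n i = replicate_mset n j"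
      then have "set_mset (replicate_mset n i) = set_mset (replicate_mset n j)" by simp
      then show "i = j" using assms by (simp split: if_splits)
    qed
    show "sum ((\<lambda>M. of_rat (mcoeff (power_sum n) M) * (\<Prod>i\<in>#M. x i)) \<circ> replicate_mset n) {1..m} = (\<Sum>i=1..m. x i ^ n)"
      by (rule sum.cong[OF refl]) (auto simp: power_sum_def)
  qed
  finally show ?thesis using True by simp
qed

text \<open>Appending the variables \<open>t\<close> and \<open>- t\<close> does not change an odd
  power sum, and this invariance passes to sums and products.\<close>

lemma Q_odd_cancel:
  assumes "f \<in> Q_odd_power_sums"
  shows "hom_eval (\<lambda>M. of_rat (mcoeff f M)) (Suc (Suc m)) (x(Suc m := t, Suc (Suc m) := - t)) d =
    hom_eval (\<lambda>M. of_rat (mcoeff f M)) m x d"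
  using assms
proof (induction f arbitrary: d rule: Q_odd_power_sums.induct)
  case (const c)
  have "hom_eval (\<lambda>M. of_rat (mcoeff (mconst c) M)) m x d = (if d = 0 then of_rat c else 0)" for m x
  proof -
    have "hom_eval (\<lambda>M. of_rat (mcoeff (mconst c) M)) m x d = (\<Sum>M\<in>monoms m d. if M = {#} then of_rat c else 0)"
      unfolding hom_eval_def by (rule sum.cong) (auto simp: mconst_def)
    also have "\<dots> = (if {#} \<in> monoms m d then of_rat c else 0)" by simp
    finally show ?thesis by (simp add: monoms_def)
  qed
  then show ?case by simp
next
  case (gen n)
  then have n: "1 \<le> n" by (cases n) auto
  have "(\<Sum>i=1..Suc (Suc m). (x(Suc m := t, Suc (Suc m) := - t)) i ^ n) = (\<Sum>i=1..m. x i ^ n)"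
    using gen by simp
  then show ?case unfolding EV_power_sum[OF n] by simp
next
  case (add f g)
  have "hom_eval (\<lambda>M. of_rat (mcoeff (f + g) M)) m x d = hom_eval (\<lambda>M. of_rat (mcoeff f M)) m x d + hom_eval (\<lambda>M. of_rat (mcoeff g M)) m x d" for m x
    by (simp add: hom_eval_def plus_mfps_def of_rat_add distrib_right sum.distrib)
  then show ?case using add by simp
next
  case (mult f g)
  have "of_rat (mcoeff (f * g) M) = (\<Sum>(A, B)\<in>msplits M. of_rat (mcoeff f A) * (of_rat (mcoeff g B) :: real))" for M
    by (simp add: times_mfps_def of_rat_sum of_rat_mult case_prod_unfold)
  then show ?case using mult by (simp only: EV_mult)
qed

section \<open>Supersymmetry and the factorisation\<close>

definition vanishes_below :: "nat \<Rightarrow> ((nat \<Rightarrow> nat) \<Rightarrow> real) \<Rightarrow> bool" where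
  "vanishes_below c f \<longleftrightarrow> (\<forall>z. rank2 z < c \<longrightarrow> f z = 0)"

text \<open>Every \<open>U i\<close> raises \<open>rank2\<close> by 2, so what it adds to a vector
  starting at rank \<open>c\<close> starts at rank \<open>c + 2\<close>.\<close>

lemma hs_low:
  assumes "vanishes_below c f"
  shows "rank2 z < c + 2 \<Longrightarrow> hs ls x f z = f z"
  using assms
proof (induction ls arbitrary: f z)
  case (Cons i ls)
  have e: "h i x f z = f z" if "rank2 z < c + 2" for z
  proof (cases "z \<in> Invol \<and> 1 \<le> i \<and> z (Suc i) < z i")
    case True
    then have "rank2 z = rank2 (rtimes z i) + 2" using rank2_rtimes_desc by blast
    then have "f (rtimes z i) = 0" using that Cons.prems(2) by (simp add: vanishes_below_def)
    then show ?thesis by (simp add: h_def U_def)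
  next
    case False
    then show ?thesis by (auto simp: h_def U_def)
  qed
  then have "vanishes_below c (h i x f)" using Cons.prems(2) by (simp add: vanishes_below_def)
  then show ?case using Cons.IH Cons.prems(1) e by simp
qed simp

lemma fold_hs_low:
  assumes "vanishes_below c f" "rank2 z < c + 2"
  shows "fold (hs ls) xs f z = f z"
  using assms(1)
proof (induction xs arbitrary: f)
  case (Cons x xs)
  have "vanishes_below c (hs ls x f)" using Cons.prems hs_low[OF Cons.prems] by (simp add: vanishes_below_def)
  then show ?case using Cons.IH hs_low[OF Cons.prems assms(2)] by simp
qed simp

text \<open>\<open>hs ls x\<close> is unipotent, so that a vector is determined at \<open>y\<close> by its images under the
  positive powers of \<open>hs ls x\<close>.\<close>

lemma unipotent_zero:
  assumes "\<And>j. ((hs ls x) ^^ Suc j) f y = 0"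
  shows "f y = 0"
proof -
  define \<nu> where "\<nu> f = (\<lambda>z. hs ls x f z + (- 1) * f z)" for f
  have linear_op: "linear_op \<nu>"
    unfolding linear_op_def \<nu>_def linD[OF lin_hs] by (auto simp: algebra_simps)
  have linp: "linear_op (\<nu> ^^ n)" for n
  proof (induction n)
    case (Suc n)
    then show ?case using linear_op by (simp add: linear_op_def)
  qed (simp add: linear_op_def)
  have "vanishes_below (2 * n) ((\<nu> ^^ n) f)" for n
  proof (induction n)
    case (Suc n)
    then show ?case using hs_low[OF Suc] by (simp add: vanishes_below_def \<nu>_def)
  qed (simp add: vanishes_below_def)
  from this[of "Suc (rank2 y)"] have "rank2 y < 2 * Suc (rank2 y) \<Longrightarrow> (\<nu> ^^ Suc (rank2 y)) f y = 0"
    unfolding vanishes_below_def by blast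
  moreover have "rank2 y < 2 * Suc (rank2 y)" by simp
  ultimately have "(\<nu> ^^ Suc (rank2 y)) f y = 0" by blast
  \<comment> \<open>In the expansion of the power of \<open>hs ls x - 1\<close> only the constant
    term survives at \<open>y\<close>, because all positive powers of \<open>hs ls x\<close> vanish
    there.\<close>
  moreover have "(\<nu> ^^ n) (((hs ls x) ^^ j) f) y = (if j = 0 then (- 1) ^ n * f y else 0)" for n j
  proof (induction n arbitrary: j)
    case 0
    show ?case using assms[of "j - 1"] by (cases j) auto
  next
    case (Suc n)
    have "(\<nu> ^^ Suc n) (((hs ls x) ^^ j) f) y = (\<nu> ^^ n) (\<nu> (((hs ls x) ^^ j) f)) y"
      by (simp only: funpow_Suc_right comp_apply)
    also have "\<nu> (((hs ls x) ^^ j) f) = (\<lambda>z. ((hs ls x) ^^ Suc j) f z + (- 1) * ((hs ls x) ^^ j) f z)"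
      by (simp add: \<nu>_def)
    also have "(\<nu> ^^ n) \<dots> y = (\<nu> ^^ n) (((hs ls x) ^^ Suc j) f) y + (- 1) * (\<nu> ^^ n) (((hs ls x) ^^ j) f) y"
      by (simp only: linD[OF linp])
    finally show ?case using Suc[of j] Suc[of "Suc j"] by simp
  qed
  from this[of "Suc (rank2 y)" 0] have "(\<nu> ^^ Suc (rank2 y)) f y = (- 1) ^ Suc (rank2 y) * f y" by simp
  ultimately show ?thesis by simp
qed

lemma fold_replicate: "fold g (replicate n x) f = (g x ^^ n) f"
  by (induction n arbitrary: f) (simp_all add: funpow_swap1)

text \<open>\<open>A l N v\<close> is the inverse of \<open>T = B l N (- v)\<close>. After a
  positive power of \<open>T\<close>, the versions with \<open>A l N v\<close> and with
  \<open>B l N v\<close> both become products of factors \<open>B\<close>, equal at \<open>y\<close>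
  by the cancellation property; \<open>unipotent_zero\<close> removes the power of
  \<open>T\<close>.\<close>

lemma superize:
  assumes "\<And>us t. fold (B l N) (us @ [t, - t]) f y = fold (B l N) us f y"
  shows "fold (A l N) vs (fold (B l N) us f) y = fold (B l N) (us @ vs) f y"
proof (induction vs arbitrary: us)
  case (Cons v vs)
  let ?T = "B l N (- v)" and ?F = "fold (B l N) us f"
  define G where "G = fold (A l N) vs (A l N v ?F)"
  define G' where "G' = fold (A l N) vs (B l N v ?F)"
  have comm: "(?T ^^ n) (fold (A l N) vs g) = fold (A l N) vs ((?T ^^ n) g)" for n g
    unfolding fold_replicate[symmetric] by (rule fold_A_B_commute[symmetric])
  have T1: "(?T ^^ Suc n) (A l N v ?F) = (?T ^^ n) ?F" for n
    by (simp add: funpow_swap1)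
  have pw: "(?T ^^ n) (fold (B l N) ws f) = fold (B l N) (ws @ replicate n (- v)) f" for n ws
    by (simp add: fold_replicate)
  \<comment> \<open>Inserting the pair \<open>v, - v\<close> raises the power of \<open>T\<close> by
    one and supplies the factor \<open>B l N v\<close>.\<close>
  have eq: "(?T ^^ Suc n) G y = (?T ^^ Suc n) G' y" for n
  proof -
    have "(?T ^^ Suc n) G y = fold (A l N) vs ((?T ^^ n) ?F) y" unfolding G_def comm T1 ..
    also have "\<dots> = fold (B l N) (us @ replicate n (- v) @ vs) f y" unfolding pw Cons.IH by simp
    also have "\<dots> = fold (B l N) ((us @ replicate n (- v) @ vs) @ [v, - v]) f y" by (rule assms[symmetric])
    also have "\<dots> = fold (B l N) ((us @ [v]) @ replicate (Suc n) (- v) @ vs) f y"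
      by (rule fun_cong[OF fold_B_mset]) simp
    also have "\<dots> = fold (A l N) vs ((?T ^^ Suc n) (B l N v ?F)) y"
    proof -
      have "B l N v ?F = fold (B l N) (us @ [v]) f" by simp
      then show ?thesis using Cons.IH[of "(us @ [v]) @ replicate (Suc n) (- v)"] by (simp only: pw append_assoc)
    qed
    also have "\<dots> = (?T ^^ Suc n) G' y" unfolding G'_def comm ..
    finally show ?thesis .
  qed
  have linT: "linear_op (?T ^^ n)" for n
  proof (induction n)
    case (Suc n)
    then show ?case using lin_hs[of "[l..<N]" "- v"] by (simp add: linear_op_def)
  qed (simp add: linear_op_def)
  have "(\<lambda>z. G z + (- 1) * G' z) y = 0"
  proof (rule unipotent_zero[where ls = "[l..<N]" and x = "- v" and f = "\<lambda>z. G z + (- 1) * G' z" and y = y])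
    fix j
    have "(?T ^^ Suc j) (\<lambda>z. G z + (- 1) * G' z) y = (?T ^^ Suc j) G y + (- 1) * (?T ^^ Suc j) G' y"
      by (simp only: linD[OF linT])
    then show "(?T ^^ Suc j) (\<lambda>z. G z + (- 1) * G' z) y = 0"
      unfolding eq by (simp only: mult_minus1 right_minus)
  qed
  then have "G y = G' y" by simp
  then show ?case using Cons.IH[of "us @ [v]"] by (simp add: G_def G'_def)
qed simp

lemma list_as_map: "map (\<lambda>i. us ! (i - 1)) [1..<Suc (length us)] = us"
  by (rule nth_equalityI) (simp_all del: upt_Suc)

lemma word_sum_reduced_list:
  assumes "wd k y" "encodes k y r" "fixes_above N y"
  shows "word_sum (reduced_words r) m x = fold (B (Suc k) N) (map x [1..<Suc m]) (delta (g_invol k)) y"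
  unfolding word_sum_reduced[OF assms] rev_map[symmetric]
  by (rule fun_cong[OF fold_B_mset]) simp

lemma EV_reduced:
  assumes "wd k y" "encodes k y r" "fixes_above N y"
  shows "hom_eval (\<lambda>M. real_of_int (mcoeff (F_Stanley r) M)) m x d =
    (if d = card (invs r) then fold (B (Suc k) N) (map x [1..<Suc m]) (delta (g_invol k)) y else 0)"
proof -
  have f: "finperm r" using assms(2) by (simp add: encodes_def)
  have "finite (reduced_words r)"
  proof (rule finite_subset)
    show "reduced_words r \<subseteq> {a. set a \<subseteq> {0..<N} \<and> length a = card (invs r)}"
    proof
      fix a assume "a \<in> reduced_words r"
      then have a: "lchain a r" by (simp add: reduced_words_eq[OF f])
      then have "\<forall>i\<in>set a. 1 \<le> i" by (simp add: lchain_def)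
      from lchain_iff_chain[OF assms(1,2) this] a have "chain (g_invol k) (rev (map ((+) k) a)) y" by blast
      from chain_letters[OF g_invol_Invol this assms(3)] show "a \<in> {a. set a \<subseteq> {0..<N} \<and> length a = card (invs r)}"
        using a by (fastforce simp: lchain_def)
    qed
  qed (simp add: finite_lists_length_eq)
  from EV_word_series[OF this, of "card (invs r)"] show ?thesis
    unfolding F_Stanley_def word_sum_reduced_list[OF assms, symmetric]
    by (simp add: reduced_words_eq[OF f] lchain_def)
qed

text \<open>The product of factors \<open>B\<close> evaluates the Stanley function of
  \<open>r\<close> in its own degree, so membership in the ring of odd power sums yields the
  cancellation needed by \<open>superize\<close>.\<close>

lemma Gamma_cancel:
  assumes "wd k y" "encodes k y r" "fixes_above N y" "F_Stanley r \<in> Gamma_ring"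
  shows "fold (B (Suc k) N) (us @ [t, - t]) (delta (g_invol k)) y = fold (B (Suc k) N) us (delta (g_invol k)) y"
proof -
  define x where "x i = us ! (i - 1)" for i
  define m where "m = length us"
  let ?x = "x(Suc m := t, Suc (Suc m) := - t)" and ?F = "map_mfps rat_of_int (F_Stanley r)"
  have us: "map x [1..<Suc m] = us" using list_as_map[of us] by (simp add: x_def[abs_def] m_def)
  have us': "map ?x [1..<Suc (Suc (Suc m))] = us @ [t, - t]"
  proof -
    have "map ?x [1..<Suc m] = map x [1..<Suc m]" by (rule map_cong) auto
    then show ?thesis using us by simp
  qed
  have c: "(\<lambda>M. of_rat (mcoeff ?F M)) = (\<lambda>M. real_of_int (mcoeff (F_Stanley r) M))"
    by (simp add: map_mfps_def)
  have "?F \<in> Q_odd_power_sums" using assms(4) by (simp add: Gamma_ring_def)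
  from Q_odd_cancel[OF this, of m x t "card (invs r)"] show ?thesis
    unfolding c EV_reduced[OF assms(1-3)] us us' by simp
qed

lemma EV_chains:
  assumes "e \<in> Invol" "z \<in> Invol" "fixes_above N z"
  shows "hom_eval (\<lambda>M. real_of_int (mcoeff (Fhat_rel e z) M)) m x d =
    (if d = (rank2 z - rank2 e) div 2 then fold (A 1 N) (map x [1..<Suc m]) (delta e) z else 0)"
proof -
  have "finite {a. chain e a z}"
  proof (rule finite_subset)
    show "{a. chain e a z} \<subseteq> {a. set a \<subseteq> {1..<N} \<and> length a = (rank2 z - rank2 e) div 2}"
      using chain_letters[OF assms(1) _ assms(3)] by (auto simp: chain_def)
  qed (simp add: finite_lists_length_eq)
  from EV_word_series[OF this, of "(rank2 z - rank2 e) div 2"] show ?thesis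
    unfolding Fhat_rel_def rel_involution_words_eq[OF assms(1,2)] word_sum_chains[OF assms(1,3), symmetric]
    by (simp add: chain_def)
qed

lemma word_series_0: "0 \<in># M \<Longrightarrow> mcoeff (word_series W) M = 0"
proof -
  assume "0 \<in># M"
  then have e: "{I \<in> compat a. mset I = M} = {}" for a using compat_mset_props(2) by auto
  show ?thesis unfolding word_series_def mcoeff_Abs_mfps e by simp
qed

text \<open>Both identities are instances, with \<open>w\<close> the identity or
  \<open>v_invol k\<close>. In the expansion over splittings each term at \<open>y\<close> is a core
  coefficient times the same value, which is taken out of the sum; the remaining sum is the same
  expansion at \<open>g_invol k\<close>.\<close>

lemma Fhat_rel_factorisation:
  assumes base_vector: "base_vector N k \<epsilon> (rank2 w) (delta w) (g_invol k)" and w: "w \<in> Invol"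
    and y: "wd k y" "fixes_above N y" and g: "fixes_above N (g_invol k)"
    and r: "encodes k y r" "F_Stanley r \<in> Gamma_ring" and le: "rank2 w \<le> k * k + k"
  shows "Fhat_rel w y = Fhat_rel w (g_invol k) * F_Stanley r"
proof -
  let ?g = "g_invol k"
  let ?A = "fold (A (Suc k) N)" and ?B = "fold (B (Suc k) N)"
  interpret base_vector N k \<epsilon> "rank2 w" "delta w" ?g by (rule base_vector)
  have yI: "y \<in> Invol" using y(1) by (simp add: wd_def)
  have eval: "fold (A 1 N) xs (delta w) y = fold (A 1 N) xs (delta w) ?g * ?B xs (delta ?g) y"
    if xs: "distinct xs" "k \<le> length xs" "\<And>x. x \<in> set xs \<Longrightarrow> 0 < x" for xs
  proof -
    from A_expand[OF kN xs(1,2)] obtain T where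
      "(\<forall>(c, us, vs)\<in>set T. length us = k \<and> mset us + mset vs = mset xs) \<and>
       (\<forall>f z. fold (A 1 N) xs f z = (\<Sum>(c, us, vs)\<leftarrow>T. c * ?A vs (fold (A 1 N) us f) z))"
      by (rule exE)
    then have T: "\<forall>(c, us, vs)\<in>set T. length us = k \<and> mset us + mset vs = mset xs"
      "\<And>f z. fold (A 1 N) xs f z = (\<Sum>(c, us, vs)\<leftarrow>T. c * ?A vs (fold (A 1 N) us f) z)"
      by blast+
    have us: "length us = k" "distinct us" "\<And>x. x \<in> set us \<Longrightarrow> 0 < x" "mset (us @ vs) = mset xs"
      if "(c, us, vs) \<in> set T" for c us vs
    proof -
      show "length us = k" and m: "mset (us @ vs) = mset xs" using T(1) that by auto
      have "distinct (us @ vs)" using m xs(1) mset_eq_imp_distinct_iff by blast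
      then show "distinct us" by simp
      have "set (us @ vs) = set xs" using m by (rule mset_eq_setD)
      then show "0 < x" if "x \<in> set us" for x using xs(3) that by auto
    qed
    have "fold (A 1 N) xs (delta w) y = (\<Sum>(c, us, vs)\<leftarrow>T. c * (core_vector us ?g * ?B xs (delta ?g) y))"
      unfolding T(2)
    proof (rule arg_cong[where f = sum_list], rule map_cong[OF refl])
      fix p assume "p \<in> set T"
      moreover obtain c us vs where p: "p = (c, us, vs)" by (cases p)
      ultimately have m: "(c, us, vs) \<in> set T" by simp
      have aw: "?A vs (fold (A 1 N) us (delta w)) y = core_vector us ?g * ?A vs (?B us (delta ?g)) y"
        by (rule A_wd[OF y(1) us(1,2)[OF m]]) (rule us(3)[OF m])
      have "?A vs (?B us (delta ?g)) y = ?B (us @ vs) (delta ?g) y"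
        by (rule superize[OF Gamma_cancel[OF y(1) r(1) y(2) r(2)]])
      also have "\<dots> = ?B xs (delta ?g) y" by (rule fun_cong[OF fold_B_mset]) (rule us(4)[OF m])
      finally show "(case p of (c, us, vs) \<Rightarrow> c * ?A vs (fold (A 1 N) us (delta w)) y) =
          (case p of (c, us, vs) \<Rightarrow> c * (core_vector us ?g * ?B xs (delta ?g) y))"
        unfolding p prod.case aw by simp
    qed
    moreover have "fold (A 1 N) xs (delta w) ?g = (\<Sum>(c, us, vs)\<leftarrow>T. c * core_vector us ?g)"
      unfolding T(2)
    proof (rule arg_cong[where f = sum_list], rule map_cong[OF refl])
      fix p assume "p \<in> set T"
      moreover obtain c us vs where p: "p = (c, us, vs)" by (cases p)
      ultimately have m: "(c, us, vs) \<in> set T" by simp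
      have aw: "?A vs (fold (A 1 N) us (delta w)) ?g = core_vector us ?g * ?A vs (?B us (delta ?g)) ?g"
        by (rule A_wd[OF wd_g_invol us(1,2)[OF m]]) (rule us(3)[OF m])
      \<comment> \<open>At \<open>g_invol k\<close> itself the factors with letters above
        \<open>k\<close> leave the coefficient 1, since they add only terms of higher rank.\<close>
      have "vanishes_below (rank2 ?g) (delta ?g)" by (auto simp: vanishes_below_def delta_def)
      then have "vanishes_below (rank2 ?g) (?B us (delta ?g))"
        using fold_hs_low[of "rank2 ?g" "delta ?g"] by (simp add: vanishes_below_def)
      from fold_hs_low[OF this, of ?g] have "?A vs (?B us (delta ?g)) ?g = ?B us (delta ?g) ?g" by simp
      also have "\<dots> = delta ?g ?g"
        by (rule fold_hs_low[of "rank2 ?g"]) (auto simp: vanishes_below_def delta_def)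
      also have "\<dots> = 1" by (simp add: delta_def)
      finally show "(case p of (c, us, vs) \<Rightarrow> c * ?A vs (fold (A 1 N) us (delta w)) ?g) =
          (case p of (c, us, vs) \<Rightarrow> c * core_vector us ?g)"
        unfolding p prod.case aw by simp
    qed
    ultimately show ?thesis
      by (simp add: sum_list_mult_const[symmetric] case_prod_unfold mult.assoc)
  qed
  \<comment> \<open>The degrees of the two factors. The hypothesis \<open>le\<close> guarantees that
    the subtraction of ranks is not cut off at zero.\<close>
  define dg where "dg = (rank2 ?g - rank2 w) div 2"
  define dr where "dr = card (invs r)"
  have dy: "(rank2 y - rank2 w) div 2 = dg + dr"
  proof -
    have "finperm r" using r(1) by (simp add: encodes_def)
    then obtain a where a: "lchain a r" using ex_lchain by blast
    then have "\<forall>i\<in>set a. 1 \<le> i" by (simp add: lchain_def)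
    from lchain_iff_chain[OF y(1) r(1) this] a have "chain ?g (rev (map ((+) k) a)) y" by blast
    then have "rank2 y = rank2 ?g + 2 * dr" using a by (simp add: chain_def lchain_def dr_def)
    moreover have "rank2 w \<le> rank2 ?g" using le wd_rank2(1)[OF wd_g_invol, of k] by simp
    ultimately show ?thesis by (simp add: dg_def)
  qed
  show ?thesis
  proof (rule mfps_eqI)
    fix M
    show "mcoeff (Fhat_rel w y) M = mcoeff (Fhat_rel w ?g * F_Stanley r) M"
    proof (cases "0 \<in># M")
      case True
      have "mcoeff (Fhat_rel w ?g) A * mcoeff (F_Stanley r) B = 0" if "A + B = M" for A B
        using that True word_series_0 by (auto simp: Fhat_rel_def F_Stanley_def)
      then have "mcoeff (Fhat_rel w ?g * F_Stanley r) M = 0"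
        unfolding times_mfps_def mcoeff_Abs_mfps by (intro sum.neutral) (auto simp: msplits_def)
      then show ?thesis using True by (simp add: Fhat_rel_def word_series_0)
    next
      case False
      \<comment> \<open>Large enough to cover all indices in \<open>M\<close>, and at least
        \<open>k\<close>, the number of variables that \<open>eval\<close> requires.\<close>
      define m where "m = k + Max (insert 0 (set_mset M))"
      have M: "M \<in> monoms m (size M)"
      proof -
        have "set_mset M \<subseteq> {1..m}"
        proof
          fix i assume i: "i \<in># M"
          then have "i \<le> Max (insert 0 (set_mset M))" by (intro Max_ge) auto
          moreover have "i \<noteq> 0" using i False by metis
          ultimately show "i \<in> {1..m}" by (simp add: m_def)
        qed
        then show ?thesis by (simp add: monoms_def)
      qed
      let ?cy = "\<lambda>M. real_of_int (mcoeff (Fhat_rel w y) M)"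
      let ?cg = "\<lambda>M. real_of_int (mcoeff (Fhat_rel w ?g) M)" and ?cr = "\<lambda>M. real_of_int (mcoeff (F_Stanley r) M)"
      let ?cp = "\<lambda>M. real_of_int (mcoeff (Fhat_rel w ?g * F_Stanley r) M)"
      have "?cy M - ?cp M = 0"
      proof (rule EV_eq_0_imp[OF _ M])
        fix x :: "nat \<Rightarrow> real" assume x: "\<forall>i. 0 < x i" "inj_on x {1..m}"
        let ?xs = "map x [1..<Suc m]" and ?d = "size M"
        have "distinct ?xs" using x(2) by (simp add: distinct_map atLeastLessThanSuc_atLeastAtMost del: upt_Suc)
        then have ev: "fold (A 1 N) ?xs (delta w) y = fold (A 1 N) ?xs (delta w) ?g * ?B ?xs (delta ?g) y"
          using x(1) by (intro eval) (auto simp: m_def simp del: upt_Suc)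
        have "hom_eval ?cp m x ?d = (\<Sum>i\<le>?d. hom_eval ?cg m x i * hom_eval ?cr m x (?d - i))"
          by (rule EV_mult) (simp add: times_mfps_def case_prod_unfold)
        \<comment> \<open>Both factors are homogeneous, so at most one term of the convolution
          survives.\<close>
        also have "\<dots> = (\<Sum>i\<le>?d. if i = dg \<and> ?d = dg + dr then fold (A 1 N) ?xs (delta w) ?g * ?B ?xs (delta ?g) y else 0)"
          unfolding EV_chains[OF w g_invol_Invol g] EV_reduced[OF y(1) r(1) y(2)] dg_def[symmetric] dr_def[symmetric]
          by (rule sum.cong) auto
        also have "\<dots> = (if ?d = dg + dr then fold (A 1 N) ?xs (delta w) y else 0)"
          unfolding ev by (cases "?d = dg + dr") (auto simp del: upt_Suc)
        also have "\<dots> = hom_eval ?cy m x ?d"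
          unfolding EV_chains[OF w yI y(2)] dy ..
        finally show "hom_eval (\<lambda>M. ?cy M - ?cp M) m x ?d = 0"
          by (simp add: hom_eval_def left_diff_distrib sum_subtractf)
      qed
      then show ?thesis by simp
    qed
  qed
qed

text \<open>The partners of \<open>1, ..., k\<close> are distinct points of
  \<open>{Suc k..n}\<close>.\<close>

lemma wd_double_le:
  assumes "wd k y" "y \<in> S_fin n"
  shows "2 * k \<le> n"
proof -
  have y: "y \<in> Invol" using assms(1) by (simp add: wd_def)
  have "y ` {1..k} \<subseteq> {Suc k..n}"
  proof
    fix p assume "p \<in> y ` {1..k}"
    then obtain i where i: "1 \<le> i" "i \<le> k" "p = y i" by auto
    then have "k < p" using assms(1) by (simp add: wd_def)
    moreover have "p \<le> n"
    proof (rule ccontr)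
      assume "\<not> p \<le> n"
      then have "y p = p" using assms(2) by (simp add: S_fin_def)
      then show False using i Invol_invol[OF y, of i] \<open>k < p\<close> by simp
    qed
    ultimately show "p \<in> {Suc k..n}" by simp
  qed
  moreover have "inj_on y {1..k}" using Invol_eq_iff[OF y] by (simp add: inj_on_def)
  ultimately have "card {1..k} \<le> card {Suc k..n}" using card_inj_on_le by blast
  then show ?thesis by (cases "k \<le> n") auto
qed

lemma S_fin_fixes_above: "y \<in> S_fin n \<Longrightarrow> fixes_above n y"
  by (simp add: S_fin_def fixes_above_def)

theorem theorem3p42:
  fixes y :: "nat \<Rightarrow> nat" and n k :: nat
  assumes "y \<in> Invol" and "weakly_dominant y" and "k = kappa y" and "y \<in> S_fin n"
    and "F_Stanley (r_perm n y) \<in> Gamma_ring"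
  shows "Fhat y = Fhat (g_invol k) * F_Stanley (r_perm n y) \<and>
    (fpf_invol k y \<longrightarrow> Fhat_FPF k y = Fhat_FPF k (g_invol k) * F_Stanley (r_perm n y))"
proof (intro conjI impI)
  have y: "wd k y" using weakly_dominant_wd[OF assms(1,2)] assms(3) by simp
  have r: "encodes k y (r_perm n y)" by (rule r_perm_encodes[OF y assms(4)])
  have kn: "2 * k \<le> n" by (rule wd_double_le[OF y assms(4)])
  have g: "fixes_above N (g_invol k)" if "2 * k \<le> N" for N
    using that by (auto simp: fixes_above_def g_invol_apply)
  have "base_vector n k 1 (rank2 id) (delta id) (g_invol k)"
    unfolding rank2_id using kn by (intro base_id) auto
  then show "Fhat y = Fhat (g_invol k) * F_Stanley (r_perm n y)"
    unfolding Fhat_def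
    by (rule Fhat_rel_factorisation[OF _ id_Invol y S_fin_fixes_above[OF assms(4)] g[OF kn] r assms(5)]) (simp only: rank2_id)
  assume "fpf_invol k y"
  \<comment> \<open>Here the letters are truncated at \<open>2 * k\<close> instead of
    \<open>n\<close>, as \<open>base_v\<close> requires.\<close>
  then have f: "fixes_above (2 * k) y" using S_fin_fixes_above by (simp add: fpf_invol_def)
  have "base_vector (2 * k) k 0 (rank2 (v_invol k)) (delta (v_invol k)) (g_invol k)"
    unfolding rank2_v_invol by (rule base_v)
  moreover have "rank2 (v_invol k) \<le> k * k + k" unfolding rank2_v_invol by (cases k) auto
  ultimately show "Fhat_FPF k y = Fhat_FPF k (g_invol k) * F_Stanley (r_perm n y)"
    unfolding Fhat_FPF_def
    by (intro Fhat_rel_factorisation[OF _ v_invol_Invol y f g[OF order.refl] r assms(5)])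
qed

end
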